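(* Let $M$ be an $n$-dimensional Hadamard manifold, let $f:M\to\mathbb{R}\cup\{+\infty\}$ be proper, let $p\in M$ and let $x\in\operatorname{dom}f$. Then, for every $y\in M$, $$f(x)+f_p^*(y)=H_p(x,y)\quad\Longleftrightarrow\quad V_p(x,y)\in\partial B^p f(x).$$ In particular, the choice $y=p$ yields $$x\in\operatorname*{argmin}_{z\in M}f(z)\quad\Longleftrightarrow\quad 0_x\in\partial B^p f(x)\quad\Longleftrightarrow\quad f(x)+f_p^*(p)=H_p(x,p)=0,$$ where $0_x$ denotes the zero vector of $T_xM$.
   Context: A Hadamard manifold is a complete, simply connected Riemannian manifold of nonpositive sectional curvature; $d$ is its Riemannian distance and $\exp$ its exponential map (each $\exp_p$ is a diffeomorphism). A function $f:M\to\mathbb{R}\cup\{+\infty\}$ is proper if $\operatorname{dom}f=\{x: f(x)<+\infty\}\neq\varnothing$. For $q\in M$ and a unit vector $u\in T_qM$, $\gamma_{(q,u)}(t)=\exp_q(tu)$, $t\ge 0$, is the unit-speed geodesic ray from $q$ in direction $u$, and $B_u^q(x)=\lim_{t\to+\infty}\bigl(d(x,\gamma_{(q,u)}(t))-t\bigr)$ is the Busemann function. For a nonzero $u\in T_qM$, $B_u^q:=B_{u/\|u\|}^q$. Two unit-speed rays $\gamma,\sigma$ are asymptotic if $t\mapsto d(\gamma(t),\sigma(t))$ is bounded on $[0,\infty)$; for each ray and each point $q$ there is exactly one ray from $q$ asymptotic to it. Busemann coupling with base point $p$: $H_p:M\times M\to\mathbb{R}$, $H_p(z,y)=d(p,z)\,B^p_{-\exp_p^{-1}z}(y)$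 if $z\ne p$, and $H_p(p,y)=0$. Conjugate: $f_p^*(y)=\sup_{z\in M}\{H_p(z,y)-f(z)\}\in\mathbb{R}\cup\{+\infty\}$. For $x\in M$ and $v\in T_xM\setminus\{0\}$, $\eta_{p,x}(v)\in T_pM$ is the unique unit vector such that $\gamma_{(p,\eta_{p,x}(v))}$ and $\gamma_{(x,-v/\|v\|)}$ are asymptotic; $Y_p(x,v):=\exp_p(-\|v\|\,\eta_{p,x}(v))$ for $v\neq 0$ and $Y_p(x,0):=p$. For $y\ne p$, let $\eta_p(y):=-\exp_p^{-1}y/d(p,y)$ and let $u_{x,y}\in T_xM$ be the unique unit vector such that $\gamma_{(p,\eta_p(y))}$ and $\gamma_{(x,-u_{x,y})}$ are asymptotic; $V_p(x,y):=d(p,y)\,u_{x,y}\in T_xM$ for $y\ne p$ and $V_p(x,p):=0$. $B^p$-subdifferential: for $x\in\operatorname{dom}f$, $\partial B^p f(x)$ is the set of all $v\in T_xM$ such that $f(z)\ge f(x)+H_p(z,Y_p(x,v))-H_p(x,Y_p(x,v))$ for all $z\in M$. *)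

theory Defs
  imports "HOL-Analysis.Analysis"
begin

section \<open>Smooth maps between open subsets of Euclidean spaces\<close>

text \<open>Both notions are meant for open \<open>S\<close>; the derivatives involved are directional ones, which
  is enough because the source space is finite-dimensional in all uses.\<close>

primrec Ck_on :: "nat \<Rightarrow> 'a::euclidean_space set \<Rightarrow> ('a \<Rightarrow> 'b::real_normed_vector) \<Rightarrow> bool" where
  "Ck_on 0 S f \<longleftrightarrow> continuous_on S f"
| "Ck_on (Suc k) S f \<longleftrightarrow>
     (\<forall>x\<in>S. f differentiable (at x)) \<and> (\<forall>v. Ck_on k S (\<lambda>x. frechet_derivative f (at x) v))"

definition smooth_on :: "'a::euclidean_space set \<Rightarrow> ('a \<Rightarrow> 'b::real_normed_vector) \<Rightarrow> bool" where
  "smooth_on S f \<longleftrightarrow> (\<forall>k. Ck_on k S f)"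


section \<open>Smooth manifolds\<close>

text \<open>
  The manifold is the whole type \<open>'m\<close>, with the topology of the type; Hausdorff and second
  countable are type class constraints. It is modelled on the Euclidean space \<open>'e\<close>, so its
  dimension is \<open>DIM('e)\<close>. A chart is a pair of a domain and a coordinate map, which is only
  meaningful on the domain.

  The tangent space at \<open>x\<close> is the model space \<open>'e\<close> itself: a tangent vector at \<open>x\<close> is represented
  by its coordinates in one chosen chart around \<open>x\<close>, the chart \<open>chart_at M x\<close> below. The field
  \<open>rmetric\<close> is the metric tensor in this representation.
\<close>

type_synonym ('m, 'e) chart = "'m set \<times> ('m \<Rightarrow> 'e)"

record ('m, 'e) riemannian =
  atlas :: "('m, 'e) chart set"
  rmetric :: "'m \<Rightarrow> 'e \<Rightarrow> 'e \<Rightarrow> real"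

definition chart_inv :: "('m, 'e) chart \<Rightarrow> 'e \<Rightarrow> 'm" where
  "chart_inv c = inv_into (fst c) (snd c)"

definition chart_image :: "('m, 'e) chart \<Rightarrow> 'e set" where
  "chart_image c = snd c ` fst c"

definition is_chart :: "('m::topological_space, 'e::euclidean_space) chart \<Rightarrow> bool" where
  "is_chart c \<longleftrightarrow> open (fst c) \<and> open (chart_image c) \<and>
     homeomorphism (fst c) (chart_image c) (snd c) (chart_inv c)"

definition compatible_charts ::
  "('m, 'e::euclidean_space) chart \<Rightarrow> ('m, 'e) chart \<Rightarrow> bool" where
  "compatible_charts c d \<longleftrightarrow>
     smooth_on (snd c ` (fst c \<inter> fst d)) (snd d \<circ> chart_inv c) \<and>
     smooth_on (snd d ` (fst c \<inter> fst d)) (snd c \<circ> chart_inv d)"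

definition smooth_manifold ::
  "('m::{t2_space, second_countable_topology}, 'e::euclidean_space) riemannian \<Rightarrow> bool" where
  "smooth_manifold M \<longleftrightarrow>
     (\<forall>c\<in>atlas M. is_chart c) \<and> (\<Union>c\<in>atlas M. fst c) = UNIV \<and>
     (\<forall>c\<in>atlas M. \<forall>d\<in>atlas M. compatible_charts c d)"

definition maximal_atlas :: "('m::topological_space, 'e::euclidean_space) riemannian \<Rightarrow> ('m, 'e) chart set" where
  "maximal_atlas M = {c. is_chart c \<and> (\<forall>d\<in>atlas M. compatible_charts c d)}"

definition chart_at :: "('m, 'e) riemannian \<Rightarrow> 'm \<Rightarrow> ('m, 'e) chart" where
  "chart_at M x = (SOME c. c \<in> atlas M \<and> x \<in> fst c)"

text \<open>The tangent vector, at the point with coordinates \<open>a\<close> in the chart \<open>c\<close>, whose coordinates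
  in the chart \<open>c\<close> are \<open>v\<close>.\<close>

definition from_chart ::
  "('m, 'e::euclidean_space) riemannian \<Rightarrow> ('m, 'e) chart \<Rightarrow> 'e \<Rightarrow> 'e \<Rightarrow> 'e" where
  "from_chart M c a v = frechet_derivative (snd (chart_at M (chart_inv c a)) \<circ> chart_inv c) (at a) v"

definition velocity ::
  "('m, 'e::euclidean_space) riemannian \<Rightarrow> (real \<Rightarrow> 'm) \<Rightarrow> real \<Rightarrow> 'e" where
  "velocity M c t = vector_derivative (\<lambda>s. snd (chart_at M (c t)) (c s)) (at t)"


section \<open>Riemannian metrics, length and distance\<close>

definition metric_coords ::
  "('m, 'e::euclidean_space) riemannian \<Rightarrow> ('m, 'e) chart \<Rightarrow> 'e \<Rightarrow> 'e \<Rightarrow> 'e \<Rightarrow> real" where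
  "metric_coords M c a u v = rmetric M (chart_inv c a) (from_chart M c a u) (from_chart M c a v)"

definition riemannian_manifold ::
  "('m::{t2_space, second_countable_topology}, 'e::euclidean_space) riemannian \<Rightarrow> bool" where
  "riemannian_manifold M \<longleftrightarrow> smooth_manifold M \<and>
     (\<forall>x. bilinear (rmetric M x)) \<and>
     (\<forall>x u v. rmetric M x u v = rmetric M x v u) \<and>
     (\<forall>x v. v \<noteq> 0 \<longrightarrow> rmetric M x v v > 0) \<and>
     (\<forall>c\<in>maximal_atlas M. \<forall>u v. smooth_on (chart_image c) (\<lambda>a. metric_coords M c a u v))"

definition tnorm :: "('m, 'e) riemannian \<Rightarrow> 'm \<Rightarrow> 'e \<Rightarrow> real" where
  "tnorm M x v = sqrt (rmetric M x v v)"

definition C1_curve_on ::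
  "('m::topological_space, 'e::euclidean_space) riemannian \<Rightarrow> real \<Rightarrow> real \<Rightarrow> (real \<Rightarrow> 'm) \<Rightarrow> bool" where
  "C1_curve_on M a b c \<longleftrightarrow> continuous_on {a..b} c \<and>
     (\<forall>k\<in>maximal_atlas M. \<exists>D. continuous_on {t\<in>{a..b}. c t \<in> fst k} D \<and>
        (\<forall>t\<in>{a..b}. c t \<in> fst k \<longrightarrow>
           ((\<lambda>s. snd k (c s)) has_vector_derivative D t) (at t within {a..b})))"

definition piecewise_C1_path ::
  "('m::topological_space, 'e::euclidean_space) riemannian \<Rightarrow> (real \<Rightarrow> 'm) \<Rightarrow> bool" where
  "piecewise_C1_path M c \<longleftrightarrow>
     (\<exists>(n::nat) \<tau>. \<tau> 0 = 0 \<and> \<tau> n = 1 \<and>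
        (\<forall>i<n. \<tau> i < \<tau> (Suc i) \<and> C1_curve_on M (\<tau> i) (\<tau> (Suc i)) c))"

text \<open>The finitely many break points, where \<open>velocity\<close> is not meaningful, do not affect the
  integral.\<close>

definition curve_length ::
  "('m, 'e::euclidean_space) riemannian \<Rightarrow> (real \<Rightarrow> 'm) \<Rightarrow> real" where
  "curve_length M c = integral {0..1} (\<lambda>t. tnorm M (c t) (velocity M c t))"

definition rdist ::
  "('m::topological_space, 'e::euclidean_space) riemannian \<Rightarrow> 'm \<Rightarrow> 'm \<Rightarrow> real" where
  "rdist M x y = Inf {curve_length M c | c.
     piecewise_C1_path M c \<and> pathstart c = x \<and> pathfinish c = y}"


section \<open>Levi-Civita connection and curvature in coordinates\<close>

text \<open>Here \<open>G\<close> is a metric in coordinates, \<open>G a u v\<close> being the inner product at \<open>a\<close> of the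
  coordinate vectors \<open>u\<close> and \<open>v\<close>. By the Koszul formula for constant vector fields, the
  Levi-Civita derivative of the constant field \<open>v\<close> in direction \<open>u\<close> is \<open>christoffel G a u v\<close>, that
  is, the covariant derivative of a vector field \<open>X\<close> in direction \<open>u\<close> is
  \<open>DX(u) + christoffel G a u X\<close>.\<close>

definition christoffel ::
  "('e::euclidean_space \<Rightarrow> 'e \<Rightarrow> 'e \<Rightarrow> real) \<Rightarrow> 'e \<Rightarrow> 'e \<Rightarrow> 'e \<Rightarrow> 'e" where
  "christoffel G a u v = (THE w. \<forall>z.
     2 * G a w z = frechet_derivative (\<lambda>b. G b v z) (at a) u
                 + frechet_derivative (\<lambda>b. G b u z) (at a) v
                 - frechet_derivative (\<lambda>b. G b u v) (at a) z)"

text \<open>\<open>R(u,v)w = \<nabla>\<^sub>u\<nabla>\<^sub>v w - \<nabla>\<^sub>v\<nabla>\<^sub>u w\<close> for constant fields \<open>u\<close>, \<open>v\<close>, \<open>w\<close> (which commute).\<close>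

definition curvature ::
  "('e::euclidean_space \<Rightarrow> 'e \<Rightarrow> 'e \<Rightarrow> real) \<Rightarrow> 'e \<Rightarrow> 'e \<Rightarrow> 'e \<Rightarrow> 'e \<Rightarrow> 'e" where
  "curvature G a u v w =
     frechet_derivative (\<lambda>b. christoffel G b v w) (at a) u
   - frechet_derivative (\<lambda>b. christoffel G b u w) (at a) v
   + christoffel G a u (christoffel G a v w)
   - christoffel G a v (christoffel G a u w)"

text \<open>Sectional curvature and the geodesic equation do not depend on the chart, so the conditions
  below, imposed in all charts of the maximal atlas, amount to the same in any atlas.\<close>

definition sectional_curvature ::
  "('e::euclidean_space \<Rightarrow> 'e \<Rightarrow> 'e \<Rightarrow> real) \<Rightarrow> 'e \<Rightarrow> 'e \<Rightarrow> 'e \<Rightarrow> real" where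
  "sectional_curvature G a u v =
     G a (curvature G a u v v) u / (G a u u * G a v v - (G a u v)\<^sup>2)"

definition nonpositive_curvature ::
  "('m::topological_space, 'e::euclidean_space) riemannian \<Rightarrow> bool" where
  "nonpositive_curvature M \<longleftrightarrow>
     (\<forall>c\<in>maximal_atlas M. \<forall>a\<in>chart_image c. \<forall>u v. u \<noteq> v \<and> independent {u, v} \<longrightarrow>
        sectional_curvature (metric_coords M c) a u v \<le> 0)"


section \<open>Geodesics, completeness and Hadamard manifolds\<close>

text \<open>Geodesics defined on all of \<open>\<real>\<close>; \<open>D\<close> is the coordinate velocity in the chart \<open>k\<close>.\<close>

definition geodesic ::
  "('m::topological_space, 'e::euclidean_space) riemannian \<Rightarrow> (real \<Rightarrow> 'm) \<Rightarrow> bool" where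
  "geodesic M c \<longleftrightarrow> continuous_on UNIV c \<and>
     (\<forall>k\<in>maximal_atlas M. \<exists>D. \<forall>t. c t \<in> fst k \<longrightarrow>
        ((\<lambda>s. snd k (c s)) has_vector_derivative D t) (at t) \<and>
        (D has_vector_derivative
           - christoffel (metric_coords M k) (snd k (c t)) (D t) (D t)) (at t))"

definition geodesically_complete ::
  "('m::topological_space, 'e::euclidean_space) riemannian \<Rightarrow> bool" where
  "geodesically_complete M \<longleftrightarrow>
     (\<forall>x v. \<exists>c. geodesic M c \<and> c 0 = x \<and> velocity M c 0 = v)"

definition hadamard_manifold ::
  "('m::{t2_space, second_countable_topology}, 'e::euclidean_space) riemannian \<Rightarrow> bool" where
  "hadamard_manifold M \<longleftrightarrow> riemannian_manifold M \<and> geodesically_complete M \<and>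
     simply_connected (UNIV :: 'm set) \<and> nonpositive_curvature M"

definition exp_map ::
  "('m::topological_space, 'e::euclidean_space) riemannian \<Rightarrow> 'm \<Rightarrow> 'e \<Rightarrow> 'm" where
  "exp_map M x v = (THE c. geodesic M c \<and> c 0 = x \<and> velocity M c 0 = v) 1"

definition exp_inv ::
  "('m::topological_space, 'e::euclidean_space) riemannian \<Rightarrow> 'm \<Rightarrow> 'm \<Rightarrow> 'e" where
  "exp_inv M x = inv (exp_map M x)"


section \<open>Rays, Busemann functions and the Busemann coupling\<close>

definition ray ::
  "('m::topological_space, 'e::euclidean_space) riemannian \<Rightarrow> 'm \<Rightarrow> 'e \<Rightarrow> real \<Rightarrow> 'm" where
  "ray M q u t = exp_map M q (t *\<^sub>R u)"

definition asymptotic ::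
  "('m::topological_space, 'e::euclidean_space) riemannian \<Rightarrow> (real \<Rightarrow> 'm) \<Rightarrow> (real \<Rightarrow> 'm) \<Rightarrow> bool" where
  "asymptotic M \<gamma> \<sigma> \<longleftrightarrow> bounded ((\<lambda>t. rdist M (\<gamma> t) (\<sigma> t)) ` {0..})"

definition unit_dir :: "('m, 'e::euclidean_space) riemannian \<Rightarrow> 'm \<Rightarrow> 'e \<Rightarrow> 'e" where
  "unit_dir M x v = v /\<^sub>R tnorm M x v"

text \<open>Defined for every nonzero \<open>u\<close>; for a unit vector, \<open>unit_dir M q u = u\<close>.\<close>

definition busemann ::
  "('m::topological_space, 'e::euclidean_space) riemannian \<Rightarrow> 'm \<Rightarrow> 'e \<Rightarrow> 'm \<Rightarrow> real" where
  "busemann M q u x = Lim at_top (\<lambda>t. rdist M x (ray M q (unit_dir M q u) t) - t)"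

definition coupling ::
  "('m::topological_space, 'e::euclidean_space) riemannian \<Rightarrow> 'm \<Rightarrow> 'm \<Rightarrow> 'm \<Rightarrow> real" where
  "coupling M p z y = (if z = p then 0 else rdist M p z * busemann M p (- exp_inv M p z) y)"


section \<open>Conjugate and subdifferential\<close>

text \<open>A function into \<open>\<real> \<union> {+\<infinity>}\<close> is an \<open>ereal\<close>-valued function that avoids \<open>-\<infinity>\<close>.\<close>

definition edomain :: "('m \<Rightarrow> ereal) \<Rightarrow> 'm set" where
  "edomain f = {x. f x < \<infinity>}"

definition proper_fun :: "('m \<Rightarrow> ereal) \<Rightarrow> bool" where
  "proper_fun f \<longleftrightarrow> (\<forall>x. f x \<noteq> -\<infinity>) \<and> edomain f \<noteq> {}"

definition conjugate ::
  "('m::topological_space, 'e::euclidean_space) riemannian \<Rightarrow> 'm \<Rightarrow> ('m \<Rightarrow> ereal) \<Rightarrow> 'm \<Rightarrow> ereal" where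
  "conjugate M p f y = (SUP z. ereal (coupling M p z y) - f z)"

definition eta_vec ::
  "('m::topological_space, 'e::euclidean_space) riemannian \<Rightarrow> 'm \<Rightarrow> 'm \<Rightarrow> 'e \<Rightarrow> 'e" where
  "eta_vec M p x v = (THE \<eta>. tnorm M p \<eta> = 1 \<and>
     asymptotic M (ray M p \<eta>) (ray M x (- unit_dir M x v)))"

definition Y_point ::
  "('m::topological_space, 'e::euclidean_space) riemannian \<Rightarrow> 'm \<Rightarrow> 'm \<Rightarrow> 'e \<Rightarrow> 'm" where
  "Y_point M p x v = (if v = 0 then p else exp_map M p (- tnorm M x v *\<^sub>R eta_vec M p x v))"

definition eta_point ::
  "('m::topological_space, 'e::euclidean_space) riemannian \<Rightarrow> 'm \<Rightarrow> 'm \<Rightarrow> 'e" where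
  "eta_point M p y = - exp_inv M p y /\<^sub>R rdist M p y"

definition u_vec ::
  "('m::topological_space, 'e::euclidean_space) riemannian \<Rightarrow> 'm \<Rightarrow> 'm \<Rightarrow> 'm \<Rightarrow> 'e" where
  "u_vec M p x y = (THE u. tnorm M x u = 1 \<and>
     asymptotic M (ray M p (eta_point M p y)) (ray M x (- u)))"

definition V_vec ::
  "('m::topological_space, 'e::euclidean_space) riemannian \<Rightarrow> 'm \<Rightarrow> 'm \<Rightarrow> 'm \<Rightarrow> 'e" where
  "V_vec M p x y = (if y = p then 0 else rdist M p y *\<^sub>R u_vec M p x y)"

definition B_subdifferential ::
  "('m::topological_space, 'e::euclidean_space) riemannian \<Rightarrow> 'm \<Rightarrow> ('m \<Rightarrow> ereal) \<Rightarrow> 'm \<Rightarrow> 'e set" where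
  "B_subdifferential M p f x = {v. \<forall>z.
     f z \<ge> f x + ereal (coupling M p z (Y_point M p x v) - coupling M p x (Y_point M p x v))}"

end

theory Submission
  imports Defs
begin

text \<open>
  Everything rests on \<open>Y\<^sub>p(x, V\<^sub>p(x, y)) = y\<close> and \<open>H\<^sub>p(z, p) = 0\<close>; granted these, the theorem is the
  equality case of the Fenchel-Young inequality. Both are consequences of the Cartan-Hadamard theorem
  in the form: \<open>exp\<^sub>x\<close> is a bijection with \<open>\<bar>v - w\<bar> \<le> d(exp\<^sub>x v, exp\<^sub>x w)\<close>.

  The geodesic flow has a strict derivative along each geodesic, which solves the linearized
  equation, and for nonpositive curvature the length of a Jacobi field vanishing at \<open>0\<close> is a convex
  function. So the derivative of \<open>exp\<^sub>x\<close> does not decrease lengths; by invariance of domain \<open>exp\<^sub>x\<close> is a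
  local homeomorphism, and by the length estimate curves lift along it. Since \<open>M\<close> is simply
  connected, \<open>exp\<^sub>x\<close> is bijective, and lifting curves bounds their length from below. This expansion
  property at the points of a geodesic is the CAT(0) inequality, from which asymptotic rays are
  constructed as limits of geodesics; their uniqueness is the expansion property again.
\<close>

section \<open>Strict derivatives and continuously differentiable maps\<close>

text \<open>Differentiating \<open>exp_map\<close> yields a derivative at one vector
  \<open>v\<close>, built along one geodesic, with no control of its continuity in \<open>v\<close>.
  This is why strict derivatives are used: their error estimate holds for all pairs of points near
  \<open>v\<close>, so a lower bound on the derivative already forces injectivity near
  \<open>v\<close>, and they compose with chart changes. The linearized equation is not solved on
  its own; its solutions are limits of difference quotients of nearby geodesics, which exist for all
  time by completeness.

  The other obstacle is that a geodesic crosses many charts. Statements along it are propagated by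
  induction over real time, each step inside a single chart, and quantities such as the squared
  length of a Jacobi field are first shown to be independent of the chart.

  Once the expansion property holds at every point, no differential calculus remains: the distance
  formula and all comparison estimates come from it by a suitable choice of base point. In
  particular a ray from \<open>p\<close> is minimizing, so that d(p, ray(t)) = t; this makes the
  coupling with \<open>p\<close> vanish.\<close>

definition strict_deriv ::
  "('a::euclidean_space \<Rightarrow> 'b::real_normed_vector) \<Rightarrow> ('a \<Rightarrow> 'b) \<Rightarrow> 'a \<Rightarrow> bool" where
  "strict_deriv f A v \<longleftrightarrow> bounded_linear A \<and>
     (\<forall>\<epsilon>>0. \<exists>\<delta>>0. \<forall>x\<in>ball v \<delta>. \<forall>y\<in>ball v \<delta>. norm (f y - f x - A (y - x)) \<le> \<epsilon> * norm (y - x))"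

lemma strict_derivD:
  assumes "strict_deriv f A v" "0 < \<epsilon>"
  obtains \<delta> where "0 < \<delta>"
    "\<And>x y. \<lbrakk>x \<in> ball v \<delta>; y \<in> ball v \<delta>\<rbrakk> \<Longrightarrow> norm (f y - f x - A (y - x)) \<le> \<epsilon> * norm (y - x)"
  using assms unfolding strict_deriv_def by blast

lemma strict_deriv_linear: "bounded_linear A \<Longrightarrow> strict_deriv A A v"
  unfolding strict_deriv_def
  by (auto simp: linear_diff bounded_linear.linear intro!: exI[of _ 1])

text \<open>The case \<epsilon> = 1 of the definition together with a norm bound \<open>K\<close> of
  \<open>A\<close> gives the constant \<open>1 + K\<close>. The chain rule and the flow use it to
  control pairs of nearby points.\<close>

lemma strict_deriv_Lipschitz:
  assumes "strict_deriv f A v"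
  obtains \<delta> C where "0 < \<delta>" "0 < C"
    "\<And>x y. \<lbrakk>x \<in> ball v \<delta>; y \<in> ball v \<delta>\<rbrakk> \<Longrightarrow> norm (f y - f x) \<le> C * norm (y - x)"
proof -
  have A: "bounded_linear A" using assms by (simp add: strict_deriv_def)
  obtain \<delta> where \<delta>: "0 < \<delta>"
    "\<And>x y. \<lbrakk>x \<in> ball v \<delta>; y \<in> ball v \<delta>\<rbrakk> \<Longrightarrow> norm (f y - f x - A (y - x)) \<le> 1 * norm (y - x)"
    using strict_derivD[OF assms zero_less_one] by metis
  obtain K where K: "0 < K" "\<And>x. norm (A x) \<le> norm x * K"
    using bounded_linear.pos_bounded[OF A] by metis
  have "norm (f y - f x) \<le> (1 + K) * norm (y - x)" if "x \<in> ball v \<delta>" "y \<in> ball v \<delta>" for x y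
  proof -
    have "norm (f y - f x) \<le> norm (f y - f x - A (y - x)) + norm (A (y - x))"
      by (metis diff_add_cancel norm_triangle_ineq)
    also have "\<dots> \<le> 1 * norm (y - x) + norm (y - x) * K"
      using \<delta>(2)[OF that] K(2)[of "y - x"] by linarith
    finally show ?thesis by (simp add: algebra_simps)
  qed
  then show thesis using that[of \<delta> "1 + K"] \<delta>(1) K(1) by auto
qed

lemma strict_deriv_has_derivative:
  assumes "strict_deriv f A v"
  shows "(f has_derivative A) (at v)"
  unfolding has_derivative_at_alt
proof (intro conjI allI impI)
  show "bounded_linear A" using assms by (simp add: strict_deriv_def)
  fix e :: real assume "0 < e"
  then obtain \<delta> where \<delta>: "0 < \<delta>"
    "\<And>x y. \<lbrakk>x \<in> ball v \<delta>; y \<in> ball v \<delta>\<rbrakk> \<Longrightarrow> norm (f y - f x - A (y - x)) \<le> e * norm (y - x)"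
    using strict_derivD[OF assms] by metis
  show "\<exists>d>0. \<forall>y. norm (y - v) < d \<longrightarrow> norm (f y - f v - A (y - v)) \<le> e * norm (y - v)"
  proof (intro exI[of _ \<delta>] conjI allI impI)
    fix y assume "norm (y - v) < \<delta>"
    then show "norm (f y - f v - A (y - v)) \<le> e * norm (y - v)"
      using \<delta>(1) by (intro \<delta>(2)) (auto simp: dist_norm norm_minus_commute)
  qed (rule \<delta>(1))
qed

lemma strict_deriv_isCont: "strict_deriv f A v \<Longrightarrow> isCont f v"
  using strict_deriv_has_derivative has_derivative_continuous by blast

lemma strict_deriv_bounded_linear: "strict_deriv f A v \<Longrightarrow> bounded_linear A"
  by (simp add: strict_deriv_def)

text \<open>The filter is \<open>nhds v\<close> and not \<open>at v\<close>, because the pairs in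
  the definition may contain \<open>v\<close> itself.\<close>

lemma strict_deriv_cong_ev:
  assumes "strict_deriv f A v" "\<forall>\<^sub>F x in nhds v. f x = g x"
  shows "strict_deriv g A v"
  unfolding strict_deriv_def
proof (intro conjI allI impI)
  show "bounded_linear A" using assms by (simp add: strict_deriv_def)
  fix e :: real assume "0 < e"
  then obtain \<delta> where \<delta>: "0 < \<delta>"
    "\<And>x y. \<lbrakk>x \<in> ball v \<delta>; y \<in> ball v \<delta>\<rbrakk> \<Longrightarrow> norm (f y - f x - A (y - x)) \<le> e * norm (y - x)"
    using strict_derivD[OF assms(1)] by metis
  obtain d where d: "0 < d" "\<And>x. dist x v < d \<Longrightarrow> f x = g x"
    using assms(2) unfolding eventually_nhds_metric by blast
  show "\<exists>\<delta>>0. \<forall>x\<in>ball v \<delta>. \<forall>y\<in>ball v \<delta>. norm (g y - g x - A (y - x)) \<le> e * norm (y - x)"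
  proof (intro exI[of _ "min \<delta> d"] conjI ballI)
    fix x y assume "x \<in> ball v (min \<delta> d)" "y \<in> ball v (min \<delta> d)"
    then show "norm (g y - g x - A (y - x)) \<le> e * norm (y - x)"
      using \<delta>(2)[of x y] d(2)[of x] d(2)[of y] by (simp add: dist_commute)
  qed (use \<delta> d in auto)
qed

lemma strict_deriv_compose:
  assumes f: "strict_deriv f A v" and g: "strict_deriv g B (f v)"
  shows "strict_deriv (\<lambda>x. g (f x)) (\<lambda>x. B (A x)) v"
  unfolding strict_deriv_def
proof (intro conjI allI impI)
  have A: "bounded_linear A" and B: "bounded_linear B" using f g by (auto simp: strict_deriv_def)
  show "bounded_linear (\<lambda>x. B (A x))" by (rule bounded_linear_compose[OF B A])
  fix e :: real assume "0 < e"
  obtain K where K: "0 < K" "\<And>x. norm (B x) \<le> norm x * K"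
    using bounded_linear.pos_bounded[OF B] by metis
  obtain d1 C where d1: "0 < d1" and C: "0 < C"
    and L: "\<And>x y. \<lbrakk>x \<in> ball v d1; y \<in> ball v d1\<rbrakk> \<Longrightarrow> norm (f y - f x) \<le> C * norm (y - x)"
    using strict_deriv_Lipschitz[OF f] by metis
  \<comment> \<open>Each of the two error terms may use half of \<open>e\<close>: the error of
    \<open>f\<close> is magnified by the norm bound \<open>K\<close> of \<open>B\<close>, the error
    of \<open>g\<close> by the Lipschitz constant \<open>C\<close> of \<open>f\<close>.\<close>
  define e1 where "e1 = e / (2 * K)"
  define e2 where "e2 = e / (2 * C)"
  have "0 < e1" "0 < e2" using \<open>0 < e\<close> K(1) C by (auto simp: e1_def e2_def)
  obtain d2 where d2: "0 < d2"
    "\<And>x y. \<lbrakk>x \<in> ball v d2; y \<in> ball v d2\<rbrakk> \<Longrightarrow> norm (f y - f x - A (y - x)) \<le> e1 * norm (y - x)"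
    using strict_derivD[OF f \<open>0 < e1\<close>] by metis
  obtain d3 where d3: "0 < d3"
    "\<And>x y. \<lbrakk>x \<in> ball (f v) d3; y \<in> ball (f v) d3\<rbrakk> \<Longrightarrow> norm (g y - g x - B (y - x)) \<le> e2 * norm (y - x)"
    using strict_derivD[OF g \<open>0 < e2\<close>] by metis
  define d where "d = min d1 (min d2 (d3 / C))"
  have "0 < d" using d1 d2(1) d3(1) C by (simp add: d_def)
  have near: "f x \<in> ball (f v) d3" if "x \<in> ball v d" for x
  proof -
    have "norm (f x - f v) \<le> C * norm (x - v)" using L[of v x] that d1 by (auto simp: d_def)
    also have "\<dots> < C * (d3 / C)"
      using that C by (intro mult_strict_left_mono) (auto simp: d_def dist_norm norm_minus_commute)
    finally show ?thesis using C by (simp add: dist_norm norm_minus_commute)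
  qed
  have "norm (g (f y) - g (f x) - B (A (y - x))) \<le> e * norm (y - x)"
    if x: "x \<in> ball v d" and y: "y \<in> ball v d" for x y
  proof -
    have eq: "g (f y) - g (f x) - B (A (y - x))
        = (g (f y) - g (f x) - B (f y - f x)) + B (f y - f x - A (y - x))"
      by (simp add: linear_diff bounded_linear.linear B)
    have "norm (g (f y) - g (f x) - B (f y - f x)) \<le> e2 * norm (f y - f x)"
      using d3(2)[OF near[OF x] near[OF y]] .
    also have "\<dots> \<le> e2 * (C * norm (y - x))"
      using L[of x y] x y \<open>0 < e2\<close> by (intro mult_left_mono) (auto simp: d_def)
    also have "\<dots> = e / 2 * norm (y - x)" using C by (simp add: e2_def)
    finally have 1: "norm (g (f y) - g (f x) - B (f y - f x)) \<le> e / 2 * norm (y - x)" .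
    have "norm (B (f y - f x - A (y - x))) \<le> norm (f y - f x - A (y - x)) * K" by (rule K(2))
    also have "\<dots> \<le> e1 * norm (y - x) * K"
      using d2(2)[of x y] x y K(1) by (intro mult_right_mono) (auto simp: d_def)
    also have "\<dots> = e / 2 * norm (y - x)" using K(1) by (simp add: e1_def)
    finally have 2: "norm (B (f y - f x - A (y - x))) \<le> e / 2 * norm (y - x)" .
    have "norm (g (f y) - g (f x) - B (A (y - x))) \<le> e / 2 * norm (y - x) + e / 2 * norm (y - x)"
      unfolding eq using norm_triangle_ineq 1 2 by (meson add_mono order_trans)
    then show ?thesis by (simp add: field_simps)
  qed
  then show "\<exists>\<delta>>0. \<forall>x\<in>ball v \<delta>. \<forall>y\<in>ball v \<delta>.
      norm (g (f y) - g (f x) - B (A (y - x))) \<le> e * norm (y - x)"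
    using \<open>0 < d\<close> by blast
qed

text \<open>Continuity of the derivative is asked direction by direction, which is what
  \<open>Ck_on\<close> delivers. In finite dimension this is continuity in the operator norm, as
  \<open>C1_on_unif\<close> exploits.\<close>

definition C1_on ::
  "'a::euclidean_space set \<Rightarrow> ('a \<Rightarrow> 'b::real_normed_vector) \<Rightarrow> ('a \<Rightarrow> 'a \<Rightarrow> 'b) \<Rightarrow> bool" where
  "C1_on W F F' \<longleftrightarrow> open W \<and> (\<forall>x\<in>W. (F has_derivative F' x) (at x)) \<and>
     (\<forall>h. continuous_on W (\<lambda>x. F' x h))"

lemma C1_onD:
  assumes "C1_on W F F'"
  shows "open W" "\<And>x. x \<in> W \<Longrightarrow> (F has_derivative F' x) (at x)" "\<And>h. continuous_on W (\<lambda>x. F' x h)"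
    "\<And>x. x \<in> W \<Longrightarrow> bounded_linear (F' x)" "continuous_on W F"
  using assms unfolding C1_on_def
  by (auto intro: has_derivative_bounded_linear has_derivative_continuous continuous_at_imp_continuous_on)

text \<open>The closed neighbourhood is the Minkowski sum of two compact sets, \<open>K\<close> and
  a closed ball.\<close>

lemma compact_in_open_tube:
  fixes K W :: "'a::euclidean_space set"
  assumes "compact K" "open W" "K \<subseteq> W"
  obtains r where "0 < r" "compact (\<Union>x\<in>K. cball x r)" "(\<Union>x\<in>K. cball x r) \<subseteq> W"
proof -
  obtain r where r: "0 < r" "(\<Union>x\<in>K. cball x r) \<subseteq> W"
    using compact_subset_open_imp_cball_epsilon_subset[OF assms] by metis
  have "(\<Union>x\<in>K. cball x r) = {x + y | x y. x \<in> K \<and> y \<in> cball 0 r}"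
  proof (intro equalityI subsetI)
    fix z assume "z \<in> (\<Union>x\<in>K. cball x r)"
    then obtain x where x: "x \<in> K" "z \<in> cball x r" by blast
    then have "z = x + (z - x)" "z - x \<in> cball 0 r" by (auto simp: dist_norm norm_minus_commute)
    then show "z \<in> {x + y | x y. x \<in> K \<and> y \<in> cball 0 r}" using x(1) by blast
  next
    fix z assume "z \<in> {x + y | x y. x \<in> K \<and> y \<in> cball 0 r}"
    then show "z \<in> (\<Union>x\<in>K. cball x r)" by (force simp: dist_norm)
  qed
  then have "compact (\<Union>x\<in>K. cball x r)"
    using compact_sums[OF assms(1) compact_cball, of 0 r] by (simp only:)
  with r that show thesis by blast
qed

text \<open>Strict differentiability with one radius for all points of a compact set: the derivative
  is uniformly continuous on a compact tube around \<open>K\<close>, and the mean value inequality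
  is applied to \<open>F - F' z\<close> near \<open>z\<close>. The compact sets in question are
  traces of solutions.\<close>

lemma C1_on_unif:
  fixes F :: "'a::euclidean_space \<Rightarrow> 'b::euclidean_space"
  assumes C: "C1_on W F F'" and K: "compact K" "K \<subseteq> W" and \<epsilon>: "0 < \<epsilon>"
  obtains \<rho> where "0 < \<rho>" "\<And>z. z \<in> K \<Longrightarrow> ball z \<rho> \<subseteq> W"
    "\<And>z x y. \<lbrakk>z \<in> K; x \<in> ball z \<rho>; y \<in> ball z \<rho>\<rbrakk>
      \<Longrightarrow> norm (F y - F x - F' z (y - x)) \<le> \<epsilon> * norm (y - x)"
proof -
  obtain r where r: "0 < r" and cr: "compact (\<Union>x\<in>K. cball x r)" and rW: "(\<Union>x\<in>K. cball x r) \<subseteq> W"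
    using compact_in_open_tube[OF K(1) C1_onD(1)[OF C] K(2)] by metis
  define T where "T = (\<Union>x\<in>K. cball x r)"
  define Fb where "Fb x = Blinfun (F' x)" for x
  have Fb: "blinfun_apply (Fb x) = F' x" if "x \<in> W" for x
    unfolding Fb_def by (rule bounded_linear_Blinfun_apply[OF C1_onD(4)[OF C that]])
  have "continuous_on W Fb"
  proof (rule continuous_on_blinfun_componentwise)
    fix i :: 'a
    show "continuous_on W (\<lambda>x. blinfun_apply (Fb x) i)"
      by (rule continuous_on_eq[OF C1_onD(3)[OF C, of i]]) (simp add: Fb)
  qed
  then have "uniformly_continuous_on T Fb"
    using cr rW by (auto simp: T_def intro: compact_uniformly_continuous continuous_on_subset)
  then obtain d where d: "0 < d" "\<And>x x'. \<lbrakk>x \<in> T; x' \<in> T; dist x' x < d\<rbrakk> \<Longrightarrow> dist (Fb x') (Fb x) < \<epsilon>"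
    using \<epsilon> unfolding uniformly_continuous_on_def by metis
  define \<rho> where "\<rho> = min d r"
  have \<rho>: "0 < \<rho>" using d r by (simp add: \<rho>_def)
  have sub: "ball z \<rho> \<subseteq> T" if "z \<in> K" for z using that by (force simp: T_def \<rho>_def)
  have main: "norm (F y - F x - F' z (y - x)) \<le> \<epsilon> * norm (y - x)"
    if z: "z \<in> K" and x: "x \<in> ball z \<rho>" and y: "y \<in> ball z \<rho>" for x y z
  proof -
    have zW: "z \<in> W" using z K by auto
    have lin: "bounded_linear (F' z)" by (rule C1_onD(4)[OF C zW])
    have "norm ((F y - F' z y) - (F x - F' z x)) \<le> \<epsilon> * norm (y - x)"
    proof (rule differentiable_bound[where S = "ball z \<rho>" and f' = "\<lambda>w h. F' w h - F' z h"])
      fix w assume w: "w \<in> ball z \<rho>"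
      then have wW: "w \<in> W" using sub[OF z] rW unfolding T_def by blast
      show "((\<lambda>y. F y - F' z y) has_derivative (\<lambda>h. F' w h - F' z h)) (at w within ball z \<rho>)"
        by (intro has_derivative_diff has_derivative_at_withinI[OF C1_onD(2)[OF C wW]]
            bounded_linear_imp_has_derivative lin)
      have "onorm (\<lambda>h. F' w h - F' z h) = norm (Fb w - Fb z)"
        by (simp add: norm_blinfun.rep_eq minus_blinfun.rep_eq Fb wW zW)
      also have "\<dots> \<le> \<epsilon>"
        using d(2)[of z w] w z sub[OF z] r by (force simp: \<rho>_def dist_norm T_def norm_minus_commute)
      finally show "onorm (\<lambda>h. F' w h - F' z h) \<le> \<epsilon>" .
    qed (use x y in auto)
    then show ?thesis
      by (simp add: linear_diff bounded_linear.linear[OF lin] algebra_simps)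
  qed
  show thesis
  proof (rule that[OF \<rho>])
    show "ball z \<rho> \<subseteq> W" if "z \<in> K" for z using sub[OF that] rW unfolding T_def by blast
  qed (rule main)
qed

lemma C1_on_bound:
  fixes F :: "'a::euclidean_space \<Rightarrow> 'b::euclidean_space"
  assumes C: "C1_on W F F'" and K: "compact K" "K \<subseteq> W"
  obtains L where "0 < L" "\<And>z h. z \<in> K \<Longrightarrow> norm (F' z h) \<le> L * norm h"
proof -
  have "\<exists>B. \<forall>z\<in>K. norm (F' z i) \<le> B" for i
  proof -
    have "compact ((\<lambda>z. F' z i) ` K)"
      by (rule compact_continuous_image[OF continuous_on_subset[OF C1_onD(3)[OF C] K(2)] K(1)])
    then have "bounded ((\<lambda>z. F' z i) ` K)" by (rule compact_imp_bounded)
    then show ?thesis by (auto simp: bounded_iff)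
  qed
  then obtain B where B: "\<And>i z. z \<in> K \<Longrightarrow> norm (F' z i) \<le> B i" by metis
  define L where "L = (\<Sum>i\<in>Basis. \<bar>B i\<bar>) + 1"
  have "norm (F' z h) \<le> L * norm h" if z: "z \<in> K" for z h
  proof -
    interpret bounded_linear "F' z" using C1_onD(4)[OF C] z K by blast
    have "F' z h = F' z (\<Sum>i\<in>Basis. (h \<bullet> i) *\<^sub>R i)" by (simp add: euclidean_representation)
    also have "\<dots> = (\<Sum>i\<in>Basis. (h \<bullet> i) *\<^sub>R F' z i)" by (simp add: sum scaleR)
    finally have "norm (F' z h) \<le> (\<Sum>i\<in>Basis. \<bar>h \<bullet> i\<bar> * norm (F' z i))"
      using sum_norm_le[of Basis "\<lambda>i. (h \<bullet> i) *\<^sub>R F' z i" "\<lambda>i. \<bar>h \<bullet> i\<bar> * norm (F' z i)"] by simp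
    also have "\<dots> \<le> (\<Sum>i\<in>Basis. norm h * \<bar>B i\<bar>)"
      using B[OF z] by (intro sum_mono mult_mono Basis_le_norm) (auto intro: order_trans[OF _ abs_ge_self])
    also have "\<dots> \<le> L * norm h" by (simp add: L_def sum_distrib_left[symmetric] algebra_simps)
    finally show ?thesis .
  qed
  moreover have "0 < L" by (simp add: L_def add_nonneg_pos sum_nonneg)
  ultimately show thesis using that by blast
qed

lemma C1_on_strict_deriv:
  fixes F :: "'a::euclidean_space \<Rightarrow> 'b::euclidean_space"
  assumes C: "C1_on W F F'" and z: "z \<in> W"
  shows "strict_deriv F (F' z) z"
  unfolding strict_deriv_def
proof (intro conjI allI impI)
  show "bounded_linear (F' z)" by (rule C1_onD(4)[OF C z])
  fix e :: real assume "0 < e"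
  then obtain \<rho> where "0 < \<rho>"
    "\<And>x y. \<lbrakk>x \<in> ball z \<rho>; y \<in> ball z \<rho>\<rbrakk> \<Longrightarrow> norm (F y - F x - F' z (y - x)) \<le> e * norm (y - x)"
    using C1_on_unif[OF C, of "{z}" e] z by (metis compact_sing empty_subsetI insert_subset singletonI)
  then show "\<exists>\<delta>>0. \<forall>x\<in>ball z \<delta>. \<forall>y\<in>ball z \<delta>. norm (F y - F x - F' z (y - x)) \<le> e * norm (y - x)"
    by blast
qed

section \<open>Families of linear maps depending on a parameter\<close>

lemma euclidean_linear_expand:
  fixes f :: "'a::euclidean_space \<Rightarrow> 'b::real_vector"
  assumes "linear f"
  shows "f x = (\<Sum>i\<in>Basis. (x \<bullet> i) *\<^sub>R f i)"
proof -
  have "f x = f (\<Sum>i\<in>Basis. (x \<bullet> i) *\<^sub>R i)" by (simp add: euclidean_representation)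
  also have "\<dots> = (\<Sum>i\<in>Basis. (x \<bullet> i) *\<^sub>R f i)" by (simp add: linear_sum[OF assms] linear_scale[OF assms])
  finally show ?thesis .
qed

text \<open>Linearity reduces the dependence on \<open>u\<close> to finitely many basis vectors, so
  that separate continuity becomes joint continuity.\<close>

lemma linear_family_continuous_on:
  fixes L :: "'c::topological_space \<Rightarrow> 'u::euclidean_space \<Rightarrow> 'b::real_normed_vector"
  assumes "\<And>a. a \<in> W \<Longrightarrow> linear (L a)" "\<And>u. continuous_on W (\<lambda>a. L a u)"
  shows "continuous_on (W \<times> UNIV) (\<lambda>(a, u). L a u)"
proof -
  have "continuous_on (W \<times> UNIV) (\<lambda>x. \<Sum>i\<in>Basis. (snd x \<bullet> i) *\<^sub>R L (fst x) i)"
    by (intro continuous_intros continuous_on_compose2[OF assms(2) continuous_on_fst]) auto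
  then show ?thesis
    by (rule continuous_on_eq) (auto simp: euclidean_linear_expand[OF assms(1), symmetric])
qed

text \<open>Expanding \<open>u\<close> in the basis turns the partial derivatives in
  \<open>a\<close> into a total derivative. Linearity of \<open>L'\<close> in its second argument
  comes from the uniqueness of derivatives.\<close>

lemma linear_family_has_derivative:
  fixes L :: "'c::real_normed_vector \<Rightarrow> 'u::euclidean_space \<Rightarrow> 'b::real_normed_vector"
  assumes W: "open W" and lin: "\<And>a. a \<in> W \<Longrightarrow> linear (L a)"
    and der: "\<And>u. ((\<lambda>b. L b u) has_derivative (\<lambda>h. L' h u)) (at a)" and a: "a \<in> W"
  shows "((\<lambda>(b, u). L b u) has_derivative (\<lambda>(h, k). L' h u + L a k)) (at (a, u))" "linear (L' h)"
proof -
  have lin': "linear (L' h)" for h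
  proof (rule linearI)
    fix u v
    have "((\<lambda>b. L b u + L b v) has_derivative (\<lambda>h. L' h u + L' h v)) (at a)"
      by (intro has_derivative_add der)
    then have "((\<lambda>b. L b (u + v)) has_derivative (\<lambda>h. L' h u + L' h v)) (at a)"
      by (rule has_derivative_transform_within_open[OF _ W a]) (simp add: linear_add lin)
    then show "L' h (u + v) = L' h u + L' h v"
      using has_derivative_unique[OF der[of "u + v"]] by metis
  next
    fix r :: real and u
    have "((\<lambda>b. r *\<^sub>R L b u) has_derivative (\<lambda>h. r *\<^sub>R L' h u)) (at a)"
      by (intro has_derivative_scaleR_right der)
    then have "((\<lambda>b. L b (r *\<^sub>R u)) has_derivative (\<lambda>h. r *\<^sub>R L' h u)) (at a)"
      by (rule has_derivative_transform_within_open[OF _ W a]) (simp add: linear_scale lin)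
    then show "L' h (r *\<^sub>R u) = r *\<^sub>R L' h u"
      using has_derivative_unique[OF der[of "r *\<^sub>R u"]] by metis
  qed
  then show "linear (L' h)" .
  have der': "((\<lambda>x. L (fst x) i) has_derivative (\<lambda>x. L' (fst x) i)) (at (a, u))" for i
    by (rule has_derivative_compose[where f = fst and g = "\<lambda>b. L b i"])
      (use der[of i] in \<open>auto intro: derivative_eq_intros\<close>)
  have "((\<lambda>x. \<Sum>i\<in>Basis. (snd x \<bullet> i) *\<^sub>R L (fst x) i) has_derivative
      (\<lambda>x. \<Sum>i\<in>Basis. (u \<bullet> i) *\<^sub>R L' (fst x) i + (snd x \<bullet> i) *\<^sub>R L a i)) (at (a, u))"
    by (rule derivative_eq_intros der' refl | simp)+
  then have "((\<lambda>x. \<Sum>i\<in>Basis. (snd x \<bullet> i) *\<^sub>R L (fst x) i) has_derivative (\<lambda>(h, k). L' h u + L a k)) (at (a, u))"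
    by (rule has_derivative_eq_rhs)
      (auto simp: fun_eq_iff sum.distrib euclidean_linear_expand[OF lin', symmetric]
        euclidean_linear_expand[OF lin[OF a], symmetric])
  then show "((\<lambda>(b, u). L b u) has_derivative (\<lambda>(h, k). L' h u + L a k)) (at (a, u))"
    by (rule has_derivative_transform_within_open[OF _ open_Times[OF W open_UNIV]])
      (use a in \<open>auto simp: euclidean_linear_expand[OF lin, symmetric]\<close>)
qed

text \<open>Induction over time for properties that travel inside a neighbourhood of each
  \<open>T\<close>, typically a chart. The step jumps from some \<open>s\<close> just before
  \<open>T\<close> to times after \<open>T\<close>, so no separate passage to the limit at
  \<open>T\<close> is required: the supremum of the good times is approached by good times, and one
  jump passes it.\<close>

lemma forward_induct:
  fixes P :: "real \<Rightarrow> bool"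
  assumes P0: "P 0"
    and step: "\<And>T. 0 \<le> T \<Longrightarrow> \<exists>\<delta>>0. \<forall>s t. 0 \<le> s \<longrightarrow> T - \<delta> < s \<longrightarrow> s \<le> T \<longrightarrow> s \<le> t \<longrightarrow> t < T + \<delta> \<longrightarrow> P s \<longrightarrow> P t"
    and t: "0 \<le> t"
  shows "P t"
proof (rule ccontr)
  assume neg: "\<not> P t"
  define S where "S = {t. 0 \<le> t \<and> (\<forall>s\<in>{0..t}. P s)}"
  have "0 \<in> S" using P0 by (auto simp: S_def)
  have bd: "s \<le> t" if "s \<in> S" for s using that neg t by (auto simp: S_def not_le[symmetric])
  then have bdd: "bdd_above S" by (auto simp: bdd_above_def)
  define T where "T = Sup S"
  have "0 \<le> T" using cSup_upper[OF \<open>0 \<in> S\<close> bdd] by (simp add: T_def)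
  obtain \<delta> where \<delta>: "0 < \<delta>"
    "\<And>s t. \<lbrakk>0 \<le> s; T - \<delta> < s; s \<le> T; s \<le> t; t < T + \<delta>; P s\<rbrakk> \<Longrightarrow> P t"
    using step[OF \<open>0 \<le> T\<close>] by blast
  obtain s where s: "s \<in> S" "T - \<delta> < s"
    using less_cSup_iff[of S "T - \<delta>"] \<open>0 \<in> S\<close> bdd \<delta>(1) by (auto simp: T_def)
  have "s \<le> T" using cSup_upper[OF s(1) bdd] by (simp add: T_def)
  have "T + \<delta> / 2 \<in> S"
  proof -
    have "P r" if "r \<in> {0..T + \<delta> / 2}" for r
      using that s \<open>s \<le> T\<close> \<delta> by (cases "r \<le> s") (auto simp: S_def)
    then show ?thesis using \<open>0 \<le> T\<close> \<delta>(1) by (auto simp: S_def)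
  qed
  then have "T + \<delta> / 2 \<le> T" unfolding T_def by (rule cSup_upper[OF _ bdd])
  then show False using \<delta>(1) by simp
qed

text \<open>Adding \<open>c\<^sup>2\<close> to \<open>\<bar>e\<bar>\<^sup>2\<close> turns the inhomogeneous inequality into a homogeneous one.\<close>

lemma gronwall:
  fixes e :: "real \<Rightarrow> 'a::euclidean_space"
  assumes st: "s \<le> t" and L: "0 \<le> L" and c: "0 \<le> c"
    and der: "\<And>\<tau>. \<tau> \<in> {s..t} \<Longrightarrow> (e has_vector_derivative e' \<tau>) (at \<tau> within {s..t})"
    and bd: "\<And>\<tau>. \<tau> \<in> {s..t} \<Longrightarrow> norm (e' \<tau>) \<le> L * norm (e \<tau>) + c"
  shows "norm (e t) \<le> exp ((L + 1) * (t - s)) * (norm (e s) + c)"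
proof -
  \<comment> \<open>Twice \<open>L + 1\<close>, so that the square root at the end leaves the rate
    \<open>L + 1\<close>.\<close>
  define K where "K = 2 * L + 2"
  define q where "q \<tau> = (e \<tau> \<bullet> e \<tau> + c\<^sup>2) * exp (- K * \<tau>)" for \<tau>
  define q' where "q' \<tau> = (2 * (e \<tau> \<bullet> e' \<tau>) - K * (e \<tau> \<bullet> e \<tau> + c\<^sup>2)) * exp (- K * \<tau>)" for \<tau>
  have dq: "(q has_real_derivative q' \<tau>) (at \<tau> within {s..t})" if "\<tau> \<in> {s..t}" for \<tau>
  proof -
    have "((\<lambda>\<tau>. e \<tau> \<bullet> e \<tau>) has_real_derivative 2 * (e \<tau> \<bullet> e' \<tau>)) (at \<tau> within {s..t})"
      using bounded_bilinear.has_vector_derivative[OF bounded_bilinear_inner der[OF that] der[OF that]]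
      by (simp add: has_real_derivative_iff_has_vector_derivative inner_commute)
    note 1 = this
    have 2: "((\<lambda>\<tau>. exp (- K * \<tau>)) has_real_derivative - K * exp (- K * \<tau>)) (at \<tau> within {s..t})"
      by (auto intro!: derivative_eq_intros)
    show ?thesis
      unfolding q_def q'_def
      by (rule DERIV_cong[OF DERIV_mult[OF DERIV_add[OF 1 DERIV_const] 2]]) (simp add: algebra_simps)
  qed
  have neg: "q' \<tau> \<le> 0" if "\<tau> \<in> {s..t}" for \<tau>
  proof -
    have "e \<tau> \<bullet> e' \<tau> \<le> norm (e \<tau>) * (L * norm (e \<tau>) + c)"
      using norm_cauchy_schwarz[of "e \<tau>" "e' \<tau>"] bd[OF that]
      by (meson mult_left_mono norm_ge_zero order_trans)
    then have "2 * (e \<tau> \<bullet> e' \<tau>) \<le> 2 * (norm (e \<tau>) * (L * norm (e \<tau>) + c))" by simp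
    also have "\<dots> = 2 * L * (norm (e \<tau>))\<^sup>2 + 2 * norm (e \<tau>) * c"
      by (simp add: power2_eq_square algebra_simps)
    also have "\<dots> \<le> 2 * L * (norm (e \<tau>))\<^sup>2 + ((norm (e \<tau>))\<^sup>2 + c\<^sup>2)"
      using sum_squares_bound[of "norm (e \<tau>)" c] by simp
    also have "\<dots> \<le> 2 * L * (norm (e \<tau>))\<^sup>2 + 2 * L * c\<^sup>2 + 2 * ((norm (e \<tau>))\<^sup>2 + c\<^sup>2)"
      using L by simp
    also have "\<dots> = K * ((norm (e \<tau>))\<^sup>2 + c\<^sup>2)" by (simp add: K_def algebra_simps)
    finally have "2 * (e \<tau> \<bullet> e' \<tau>) - K * (e \<tau> \<bullet> e \<tau> + c\<^sup>2) \<le> 0"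
      by (simp add: dot_square_norm)
    then show ?thesis unfolding q'_def by (simp add: mult_nonpos_nonneg)
  qed
  have "q t \<le> q s"
  proof (rule DERIV_nonpos_imp_decreasing_open[OF st])
    fix \<tau> assume \<tau>: "s < \<tau>" "\<tau> < t"
    then show "\<exists>y. DERIV q \<tau> :> y \<and> y \<le> 0"
      using dq[of \<tau>] neg[of \<tau>] by (auto simp: at_within_Icc_at)
  next
    show "continuous_on {s..t} q"
      by (rule DERIV_continuous_on[OF dq])
  qed
  then have "q t * exp (K * t) \<le> q s * exp (K * t)" by simp
  moreover have "q t * exp (K * t) = e t \<bullet> e t + c\<^sup>2"
    by (simp add: q_def mult.assoc exp_add[symmetric])
  moreover have "q s * exp (K * t) = (e s \<bullet> e s + c\<^sup>2) * exp (K * (t - s))"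
    by (simp add: q_def mult.assoc exp_add[symmetric] right_diff_distrib)
  ultimately have "(norm (e t))\<^sup>2 + c\<^sup>2 \<le> ((norm (e s))\<^sup>2 + c\<^sup>2) * exp (K * (t - s))"
    by (simp add: dot_square_norm)
  then have "(norm (e t))\<^sup>2 \<le> ((norm (e s))\<^sup>2 + c\<^sup>2) * exp (K * (t - s))"
    using zero_le_power2[of c] by linarith
  also have "\<dots> \<le> (norm (e s) + c)\<^sup>2 * exp (K * (t - s))"
    using c by (intro mult_right_mono) (auto simp: power2_sum)
  also have "\<dots> = (norm (e s) + c)\<^sup>2 * (exp ((L + 1) * (t - s)))\<^sup>2"
    by (simp add: K_def exp_double[symmetric] algebra_simps)
  also have "\<dots> = (exp ((L + 1) * (t - s)) * (norm (e s) + c))\<^sup>2"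
    by (simp add: power_mult_distrib mult.commute)
  finally have "(norm (e t))\<^sup>2 \<le> (exp ((L + 1) * (t - s)) * (norm (e s) + c))\<^sup>2" .
  then show ?thesis
    by (rule power2_le_imp_le) (use c in simp)
qed

section \<open>Dependence of solutions on parameters\<close>

text \<open>In contrast to \<open>forward_induct\<close>, closing up at \<open>T\<close> from the
  left and continuing to the right of \<open>T\<close> are separate obligations; this suits
  bootstrap arguments and the continuation of lifts.\<close>

lemma real_induct:
  fixes P :: "real \<Rightarrow> bool"
  assumes base: "P a"
    and left: "\<And>T. \<lbrakk>a < T; T \<le> b; \<And>\<tau>. \<tau> \<in> {a..<T} \<Longrightarrow> P \<tau>\<rbrakk> \<Longrightarrow> P T"
    and right: "\<And>T. \<lbrakk>a \<le> T; T < b; \<And>\<tau>. \<tau> \<in> {a..T} \<Longrightarrow> P \<tau>\<rbrakk> \<Longrightarrow> \<exists>\<delta>>0. \<forall>\<tau>\<in>{T<..<T + \<delta>}. P \<tau>"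
    and t: "t \<in> {a..b}"
  shows "P t"
proof (rule ccontr)
  assume neg: "\<not> P t"
  define S where "S = {\<tau> \<in> {a..b}. \<forall>\<sigma>\<in>{a..\<tau>}. P \<sigma>}"
  have aS: "a \<in> S" using base t by (auto simp: S_def)
  have ub: "\<tau> \<le> t" if "\<tau> \<in> S" for \<tau>
    using that neg t by (auto simp: S_def not_le[symmetric])
  then have bdd: "bdd_above S" by (auto simp: bdd_above_def)
  define T where "T = Sup S"
  have aT: "a \<le> T" unfolding T_def by (rule cSup_upper[OF aS bdd])
  have Tt: "T \<le> t" unfolding T_def using aS ub by (intro cSup_least) auto
  have below: "P \<tau>" if \<tau>: "\<tau> \<in> {a..<T}" for \<tau>
  proof -
    obtain \<sigma> where "\<sigma> \<in> S" "\<tau> < \<sigma>"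
      using less_cSup_iff[of S \<tau>] aS bdd \<tau> by (auto simp: T_def)
    then show ?thesis using \<tau> by (auto simp: S_def)
  qed
  have PT: "P T"
    using left[of T] below base aT Tt t by (cases "a = T") auto
  have all: "P \<tau>" if "\<tau> \<in> {a..T}" for \<tau>
    using below[of \<tau>] PT that by (cases "\<tau> = T") auto
  have "T < t" using neg PT Tt by (cases "T = t") auto
  then obtain \<delta> where \<delta>: "0 < \<delta>" "\<And>\<tau>. \<tau> \<in> {T<..<T + \<delta>} \<Longrightarrow> P \<tau>"
    using right[OF aT _ all] t by force
  define T' where "T' = min t (T + \<delta> / 2)"
  have "T < T'" using \<open>T < t\<close> \<delta>(1) by (simp add: T'_def)
  have "T' \<in> S"
  proof -
    have "P \<sigma>" if "\<sigma> \<in> {a..T'}" for \<sigma>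
      using that all[of \<sigma>] \<delta> by (cases "\<sigma> \<le> T") (auto simp: T'_def)
    then show ?thesis using aT \<open>T < T'\<close> t by (auto simp: S_def T'_def)
  qed
  then have "T' \<le> T" unfolding T_def by (rule cSup_upper[OF _ bdd])
  then show False using \<open>T < T'\<close> by simp
qed

text \<open>The predicate \<open>P\<close> marks the times at which the curve \<open>y\<close> is meaningful, in the application the
  times at which a curve on a manifold lies in the domain of a fixed chart.\<close>

definition partial_sol ::
  "'a::euclidean_space set \<Rightarrow> ('a \<Rightarrow> 'a) \<Rightarrow> (real \<Rightarrow> bool) \<Rightarrow> (real \<Rightarrow> 'a) \<Rightarrow> bool" where
  "partial_sol W F P y \<longleftrightarrow>
     (\<forall>\<tau>. P \<tau> \<longrightarrow> y \<tau> \<in> W \<and> (y has_vector_derivative F (y \<tau>)) (at \<tau>)) \<and>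
     open {\<tau>. P \<tau>} \<and>
     (\<forall>s t K. compact K \<and> K \<subseteq> W \<and> s < t \<and> (\<forall>\<tau>\<in>{s..<t}. P \<tau> \<and> y \<tau> \<in> K) \<longrightarrow> P t)"

lemma partial_solD:
  assumes "partial_sol W F P y"
  shows "P \<tau> \<Longrightarrow> y \<tau> \<in> W" "P \<tau> \<Longrightarrow> (y has_vector_derivative F (y \<tau>)) (at \<tau>)" "open {\<tau>. P \<tau>}"
    "\<lbrakk>compact K; K \<subseteq> W; s < t; \<And>\<tau>. \<tau> \<in> {s..<t} \<Longrightarrow> P \<tau> \<and> y \<tau> \<in> K\<rbrakk> \<Longrightarrow> P t"
  using assms unfolding partial_sol_def by blast+

lemma partial_sol_continuous_on:
  assumes "partial_sol W F P y" "\<And>\<tau>. \<tau> \<in> I \<Longrightarrow> P \<tau>"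
  shows "continuous_on I y"
  by (intro continuous_at_imp_continuous_on ballI has_vector_derivative_continuous[OF partial_solD(2)[OF assms(1)]]
      assms(2))

text \<open>A bootstrap: as long as \<open>y\<close> stays in a tube around the trace of
  \<open>z\<close>, the field is Lipschitz there and Gronwall keeps \<open>y\<close> well inside the
  tube. The bound includes that \<open>y\<close> remains meaningful, since it cannot lose
  \<open>P\<close> while its values stay in a compact part of \<open>W\<close>.\<close>

lemma partial_sol_tube:
  fixes F :: "'a::euclidean_space \<Rightarrow> 'a"
  assumes C: "C1_on W F F'" and z: "partial_sol W F P0 z" and P0: "\<And>\<tau>. \<tau> \<in> {s..t} \<Longrightarrow> P0 \<tau>"
    and st: "s \<le> t"
  obtains \<rho> E where "0 < \<rho>" "0 < E"
    "\<And>P y \<tau>. \<lbrakk>partial_sol W F P y; P s; norm (y s - z s) < \<rho>; \<tau> \<in> {s..t}\<rbrakk>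
       \<Longrightarrow> P \<tau> \<and> norm (y \<tau> - z \<tau>) \<le> E * norm (y s - z s)"
proof -
  define K0 where "K0 = z ` {s..t}"
  have contz: "continuous_on {s..t} z" by (rule partial_sol_continuous_on[OF z P0])
  have K0: "compact K0" "K0 \<subseteq> W"
    using compact_continuous_image[OF contz] partial_solD(1)[OF z] P0 by (auto simp: K0_def)
  obtain r1 where r1: "0 < r1" "\<And>x y y'. \<lbrakk>x \<in> K0; y \<in> ball x r1; y' \<in> ball x r1\<rbrakk>
      \<Longrightarrow> norm (F y' - F y - F' x (y' - y)) \<le> 1 * norm (y' - y)"
    using C1_on_unif[OF C K0 zero_less_one] by metis
  obtain r2 where r2: "0 < r2" "compact (\<Union>x\<in>K0. cball x r2)" "(\<Union>x\<in>K0. cball x r2) \<subseteq> W"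
    using compact_in_open_tube[OF K0(1) C1_onD(1)[OF C] K0(2)] by metis
  obtain L where L: "0 < L" "\<And>x h. x \<in> K0 \<Longrightarrow> norm (F' x h) \<le> L * norm h"
    using C1_on_bound[OF C K0] by metis
  \<comment> \<open>Below \<open>r1\<close>, so that closed \<open>r\<close>-balls lie in the region
    of the Lipschitz estimate; at most \<open>r2\<close>, so that the tube stays in a compact subset
    of \<open>W\<close>.\<close>
  define r where "r = min (r1 / 2) r2"
  have r: "0 < r" "r < r1" "r \<le> r2" using r1(1) r2(1) by (auto simp: r_def)
  define E where "E = exp ((L + 2) * (t - s))"
  have E: "1 \<le> E" using L st by (simp add: E_def)
  \<comment> \<open>With this initial distance the Gronwall bound stays strictly below
    \<open>r\<close>; the strictness is what lets the induction continue.\<close>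
  define \<rho> where "\<rho> = r / E"
  have \<rho>: "0 < \<rho>" using r E by (simp add: \<rho>_def)
  have "\<rho> \<le> r" using r E by (simp add: \<rho>_def field_simps mult_le_cancel_left1)
  have main: "P \<tau> \<and> norm (y \<tau> - z \<tau>) < r" "norm (y \<tau> - z \<tau>) \<le> E * norm (y s - z s)"
    if y: "partial_sol W F P y" and Ps: "P s" and near: "norm (y s - z s) < \<rho>" and \<tau>: "\<tau> \<in> {s..t}"
    for P y \<tau>
  proof -
    have gr: "norm (y T - z T) \<le> E * norm (y s - z s)"
      if T: "s \<le> T" "T \<le> t" and all: "\<And>\<sigma>. \<sigma> \<in> {s..T} \<Longrightarrow> P \<sigma> \<and> norm (y \<sigma> - z \<sigma>) \<le> r" for T
    proof -
      have "norm (y T - z T) \<le> exp ((L + 1 + 1) * (T - s)) * (norm (y s - z s) + 0)"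
      proof (rule gronwall[where e' = "\<lambda>\<sigma>. F (y \<sigma>) - F (z \<sigma>)"])
        fix \<sigma> assume \<sigma>: "\<sigma> \<in> {s..T}"
        then have P: "P \<sigma>" "P0 \<sigma>" using all P0 T by auto
        show "((\<lambda>\<tau>. y \<tau> - z \<tau>) has_vector_derivative F (y \<sigma>) - F (z \<sigma>)) (at \<sigma> within {s..T})"
          by (intro has_vector_derivative_diff has_vector_derivative_at_within[OF partial_solD(2)[OF y P(1)]]
              has_vector_derivative_at_within[OF partial_solD(2)[OF z P(2)]])
        have zK: "z \<sigma> \<in> K0" using \<sigma> T by (auto simp: K0_def)
        have "norm (F (y \<sigma>) - F (z \<sigma>))
            \<le> norm (F (y \<sigma>) - F (z \<sigma>) - F' (z \<sigma>) (y \<sigma> - z \<sigma>)) + norm (F' (z \<sigma>) (y \<sigma> - z \<sigma>))"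
          by (metis diff_add_cancel norm_triangle_ineq)
        also have "\<dots> \<le> 1 * norm (y \<sigma> - z \<sigma>) + L * norm (y \<sigma> - z \<sigma>)"
          using all[OF \<sigma>] r r1(1)
          by (intro add_mono r1(2)[OF zK] L(2)[OF zK]) (auto simp: dist_norm norm_minus_commute)
        finally show "norm (F (y \<sigma>) - F (z \<sigma>)) \<le> (L + 1) * norm (y \<sigma> - z \<sigma>) + 0"
          by (simp add: algebra_simps)
      qed (use T L in auto)
      also have "\<dots> \<le> E * norm (y s - z s)"
        using T L by (auto simp: E_def intro!: mult_right_mono mult_mono)
      finally show ?thesis .
    qed
    have small: "E * norm (y s - z s) < r"
      using near E by (simp add: \<rho>_def field_simps)
    have all: "P \<tau> \<and> norm (y \<tau> - z \<tau>) < r" if "\<tau> \<in> {s..t}" for \<tau>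
      using _ _ _ that
    proof (rule real_induct[where P = "\<lambda>\<tau>. P \<tau> \<and> norm (y \<tau> - z \<tau>) < r"])
      show "P s \<and> norm (y s - z s) < r" using Ps near \<open>\<rho> \<le> r\<close> by simp
    next
      fix T assume T: "s < T" "T \<le> t" and IH: "\<And>\<tau>. \<tau> \<in> {s..<T} \<Longrightarrow> P \<tau> \<and> norm (y \<tau> - z \<tau>) < r"
      have PT: "P T"
      proof (rule partial_solD(4)[OF y r2(2,3) T(1)])
        fix \<tau> assume "\<tau> \<in> {s..<T}"
        then show "P \<tau> \<and> y \<tau> \<in> (\<Union>x\<in>K0. cball x r2)"
          using IH[of \<tau>] r T by (force simp: K0_def dist_norm norm_minus_commute)
      qed
      have "continuous_on {s..T} (\<lambda>\<tau>. norm (y \<tau> - z \<tau>))"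
        by (intro continuous_intros partial_sol_continuous_on[OF y] partial_sol_continuous_on[OF z])
          (use IH PT P0 T in \<open>force simp: less_le\<close>)+
      then have "continuous_on (closure {s..<T}) (\<lambda>\<tau>. norm (y \<tau> - z \<tau>))" using T by simp
      then have "norm (y T - z T) \<le> r"
        by (rule continuous_le_on_closure) (use IH T in \<open>auto intro: less_imp_le\<close>)
      \<comment> \<open>Passing to the limit has weakened the bound to a non-strict one; Gronwall
        restores the strict one.\<close>
      then have "norm (y T - z T) \<le> E * norm (y s - z s)"
        using IH PT T by (intro gr) (force simp: less_le)+
      then show "P T \<and> norm (y T - z T) < r" using PT small by simp
    next
      fix T assume T: "s \<le> T" "T < t" and IH: "\<And>\<tau>. \<tau> \<in> {s..T} \<Longrightarrow> P \<tau> \<and> norm (y \<tau> - z \<tau>) < r"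
      have PT: "P T" "P0 T" "norm (y T - z T) < r" using IH[of T] P0[of T] T by auto
      have "isCont (\<lambda>\<tau>. norm (y \<tau> - z \<tau>)) T"
        by (intro continuous_intros has_vector_derivative_continuous[OF partial_solD(2)[OF y PT(1)]]
            has_vector_derivative_continuous[OF partial_solD(2)[OF z PT(2)]])
      then have "\<forall>\<^sub>F \<tau> in at T. norm (y \<tau> - z \<tau>) < r"
        using PT(3) by (simp add: isCont_def order_tendstoD(2))
      moreover have "\<forall>\<^sub>F \<tau> in at T. P \<tau>"
        using partial_solD(3)[OF y] PT(1) by (auto simp: eventually_at_topological)
      ultimately have "\<forall>\<^sub>F \<tau> in at T. P \<tau> \<and> norm (y \<tau> - z \<tau>) < r" by eventually_elim simp
      then obtain d where "0 < d" "\<And>\<tau>. \<lbrakk>\<tau> \<noteq> T; dist \<tau> T < d\<rbrakk> \<Longrightarrow> P \<tau> \<and> norm (y \<tau> - z \<tau>) < r"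
        unfolding eventually_at by auto
      then show "\<exists>\<delta>>0. \<forall>\<tau>\<in>{T<..<T + \<delta>}. P \<tau> \<and> norm (y \<tau> - z \<tau>) < r"
        by (intro exI[of _ d]) (auto simp: dist_real_def)
    qed
    show "P \<tau> \<and> norm (y \<tau> - z \<tau>) < r" by (rule all[OF \<tau>])
    show "norm (y \<tau> - z \<tau>) \<le> E * norm (y s - z s)"
      using \<tau> all by (intro gr) force+
  qed
  show thesis using that[OF \<rho>, of E] E main by fastforce
qed

text \<open>Approximate solutions with errors tending to 0 form a uniform Cauchy sequence by
  Gronwall, and their derivatives converge uniformly as well, so the limit solves the equation. In
  \<open>strict_deriv_flow\<close> the approximations are difference quotients.\<close>

lemma linear_ode_limit:
  fixes A :: "real \<Rightarrow> 'a::euclidean_space \<Rightarrow> 'a"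
  assumes st: "s \<le> t" and L: "0 \<le> L"
    and lin: "\<And>\<tau>. \<tau> \<in> {s..t} \<Longrightarrow> linear (A \<tau>)"
    and bd: "\<And>\<tau> x. \<tau> \<in> {s..t} \<Longrightarrow> norm (A \<tau> x) \<le> L * norm x"
    and q: "\<And>n \<tau>. \<tau> \<in> {s..t} \<Longrightarrow> (q n has_vector_derivative q' n \<tau>) (at \<tau> within {s..t})"
    and err: "\<And>n \<tau>. \<tau> \<in> {s..t} \<Longrightarrow> norm (q' n \<tau> - A \<tau> (q n \<tau>)) \<le> \<eta> n"
    and init: "\<And>n. norm (q n s - j0) \<le> \<eta> n"
    and \<eta>: "\<eta> \<longlonglongrightarrow> 0"
  obtains J where "J s = j0" "\<And>\<tau>. \<tau> \<in> {s..t} \<Longrightarrow> (J has_vector_derivative A \<tau> (J \<tau>)) (at \<tau> within {s..t})"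
proof -
  define E where "E = exp ((L + 1) * (t - s))"
  have \<eta>0: "0 \<le> \<eta> n" for n using init[of n] norm_ge_zero order_trans by blast
  have cauchy: "norm (q m \<tau> - q n \<tau>) \<le> E * (2 * (\<eta> m + \<eta> n))" if \<tau>: "\<tau> \<in> {s..t}" for m n \<tau>
  proof -
    have "norm (q m \<tau> - q n \<tau>)
        \<le> exp ((L + 1) * (\<tau> - s)) * (norm (q m s - q n s) + (\<eta> m + \<eta> n))"
    proof (rule gronwall[where e' = "\<lambda>\<sigma>. q' m \<sigma> - q' n \<sigma>"])
      fix \<sigma> assume "\<sigma> \<in> {s..\<tau>}"
      then have \<sigma>: "\<sigma> \<in> {s..t}" using \<tau> by auto
      show "((\<lambda>\<tau>. q m \<tau> - q n \<tau>) has_vector_derivative q' m \<sigma> - q' n \<sigma>) (at \<sigma> within {s..\<tau>})"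
        by (rule has_vector_derivative_within_subset[OF has_vector_derivative_diff[OF q[OF \<sigma>] q[OF \<sigma>]]])
          (use \<tau> in auto)
      have "q' m \<sigma> - q' n \<sigma> = A \<sigma> (q m \<sigma> - q n \<sigma>) + (q' m \<sigma> - A \<sigma> (q m \<sigma>)) - (q' n \<sigma> - A \<sigma> (q n \<sigma>))"
        by (simp add: linear_diff[OF lin[OF \<sigma>]])
      also have "norm \<dots> \<le> norm (A \<sigma> (q m \<sigma> - q n \<sigma>)) + norm (q' m \<sigma> - A \<sigma> (q m \<sigma>))
          + norm (q' n \<sigma> - A \<sigma> (q n \<sigma>))"
        by (meson add_mono norm_triangle_ineq norm_triangle_ineq4 order_trans order_refl)
      also have "\<dots> \<le> L * norm (q m \<sigma> - q n \<sigma>) + \<eta> m + \<eta> n"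
        by (intro add_mono bd err \<sigma>)
      finally show "norm (q' m \<sigma> - q' n \<sigma>) \<le> L * norm (q m \<sigma> - q n \<sigma>) + (\<eta> m + \<eta> n)" by simp
    qed (use \<tau> L \<eta>0 in auto)
    also have "\<dots> \<le> E * ((\<eta> m + \<eta> n) + (\<eta> m + \<eta> n))"
    proof (intro mult_mono add_mono order_refl)
      show "exp ((L + 1) * (\<tau> - s)) \<le> E" using \<tau> L by (auto simp: E_def intro!: mult_left_mono)
      have "norm (q m s - q n s) \<le> norm (q m s - j0) + norm (q n s - j0)"
        by (metis norm_triangle_sub norm_minus_commute dist_norm dist_triangle2)
      then show "norm (q m s - q n s) \<le> \<eta> m + \<eta> n" using init[of m] init[of n] by linarith
    qed (use \<eta>0 in \<open>auto simp: E_def add_nonneg_nonneg\<close>)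
    finally show ?thesis by simp
  qed
  have E0: "0 < E" by (simp add: E_def)
  have "\<exists>l. (\<lambda>n. q n \<tau>) \<longlonglongrightarrow> l" if \<tau>: "\<tau> \<in> {s..t}" for \<tau>
  proof -
    have "Cauchy (\<lambda>n. q n \<tau>)"
    proof (rule CauchyI)
      fix e :: real assume "0 < e"
      then have "0 < e / (4 * E)" using E0 by simp
      then obtain N where N: "\<And>n. n \<ge> N \<Longrightarrow> \<eta> n < e / (4 * E)"
        using order_tendstoD(2)[OF \<eta>] unfolding eventually_sequentially by blast
      have "norm (q m \<tau> - q n \<tau>) < e" if "m \<ge> N" "n \<ge> N" for m n
      proof -
        have "E * (2 * (\<eta> m + \<eta> n)) < E * (2 * (e / (4 * E) + e / (4 * E)))"
          using N[OF that(1)] N[OF that(2)] E0 by (intro mult_strict_left_mono) auto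
        then show ?thesis using cauchy[OF \<tau>, of m n] E0 by (simp add: field_simps)
      qed
      then show "\<exists>M. \<forall>m\<ge>M. \<forall>n\<ge>M. norm (q m \<tau> - q n \<tau>) < e" by blast
    qed
    then show ?thesis using Cauchy_convergent_iff convergent_def by blast
  qed
  then obtain J where J: "\<And>\<tau>. \<tau> \<in> {s..t} \<Longrightarrow> (\<lambda>n. q n \<tau>) \<longlonglongrightarrow> J \<tau>" by metis
  have unif: "norm (q m \<tau> - J \<tau>) \<le> E * (2 * \<eta> m)" if \<tau>: "\<tau> \<in> {s..t}" for m \<tau>
  proof -
    have "(\<lambda>n. norm (q m \<tau> - q n \<tau>)) \<longlonglongrightarrow> norm (q m \<tau> - J \<tau>)"
      by (intro tendsto_intros J \<tau>)
    moreover have "(\<lambda>n. E * (2 * (\<eta> m + \<eta> n))) \<longlonglongrightarrow> E * (2 * (\<eta> m + 0))"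
      by (intro tendsto_intros \<eta>)
    ultimately show ?thesis
      using LIMSEQ_le[of _ _ _ "E * (2 * (\<eta> m + 0))"] cauchy[OF \<tau>, of m] by auto
  qed
  have "\<exists>g. \<forall>\<tau>\<in>{s..t}. (\<lambda>n. q n \<tau>) \<longlonglongrightarrow> g \<tau> \<and>
      (g has_derivative (\<lambda>x. x *\<^sub>R A \<tau> (J \<tau>))) (at \<tau> within {s..t})"
  proof (rule has_derivative_sequence)
    show "(q n has_derivative (\<lambda>x. x *\<^sub>R q' n \<tau>)) (at \<tau> within {s..t})" if "\<tau> \<in> {s..t}" for n \<tau>
      using q[OF that] by (simp add: has_vector_derivative_def)
    show "s \<in> {s..t}" using st by simp
    then show "(\<lambda>n. q n s) \<longlonglongrightarrow> J s" by (rule J)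
    fix e :: real assume e: "0 < e"
    \<comment> \<open>The defect of the approximate solution contributes 1, its distance
      \<open>E * (2 * \<eta> n)\<close> from the limit is magnified by \<open>L\<close>.\<close>
    define D where "D = L * (E * 2) + 1"
    have D: "0 < D" using L E0 by (simp add: D_def add_nonneg_pos)
    then have "\<forall>\<^sub>F n in sequentially. \<eta> n < e / D" using order_tendstoD(2)[OF \<eta>] e by simp
    then show "\<forall>\<^sub>F n in sequentially. \<forall>\<tau>\<in>{s..t}. \<forall>h.
        norm (h *\<^sub>R q' n \<tau> - h *\<^sub>R A \<tau> (J \<tau>)) \<le> e * norm h"
    proof eventually_elim
      fix n assume n: "\<eta> n < e / D"
      show "\<forall>\<tau>\<in>{s..t}. \<forall>h. norm (h *\<^sub>R q' n \<tau> - h *\<^sub>R A \<tau> (J \<tau>)) \<le> e * norm h"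
      proof (intro ballI allI)
        fix \<tau> h assume \<tau>: "\<tau> \<in> {s..t}"
        have "norm (q' n \<tau> - A \<tau> (J \<tau>)) \<le> norm (q' n \<tau> - A \<tau> (q n \<tau>)) + norm (A \<tau> (q n \<tau> - J \<tau>))"
          using norm_triangle_ineq[of "q' n \<tau> - A \<tau> (q n \<tau>)" "A \<tau> (q n \<tau> - J \<tau>)"]
          by (simp add: linear_diff[OF lin[OF \<tau>]])
        also have "\<dots> \<le> \<eta> n + L * (E * (2 * \<eta> n))"
          using bd[OF \<tau>, of "q n \<tau> - J \<tau>"] unif[OF \<tau>, of n] L
          by (intro add_mono err \<tau>) (meson mult_left_mono order_trans)
        also have "\<dots> = D * \<eta> n" by (simp add: D_def algebra_simps)
        also have "\<dots> \<le> e" using n D by (simp add: field_simps)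
        finally show "norm (h *\<^sub>R q' n \<tau> - h *\<^sub>R A \<tau> (J \<tau>)) \<le> e * norm h"
          using mult_left_mono[of "norm (q' n \<tau> - A \<tau> (J \<tau>))" e "\<bar>h\<bar>"]
          by (simp add: scaleR_diff_right[symmetric] mult.commute)
      qed
    qed
  qed simp
  then obtain g where g: "\<And>\<tau>. \<tau> \<in> {s..t} \<Longrightarrow> (\<lambda>n. q n \<tau>) \<longlonglongrightarrow> g \<tau>"
    "\<And>\<tau>. \<tau> \<in> {s..t} \<Longrightarrow> (g has_derivative (\<lambda>x. x *\<^sub>R A \<tau> (J \<tau>))) (at \<tau> within {s..t})" by blast
  have gJ: "g \<tau> = J \<tau>" if "\<tau> \<in> {s..t}" for \<tau>
    using LIMSEQ_unique[OF g(1)[OF that] J[OF that]] .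
  have "(\<lambda>n. norm (q n s - j0)) \<longlonglongrightarrow> norm (g s - j0)"
    using st by (intro tendsto_intros g) simp
  then have "norm (g s - j0) \<le> 0" using LIMSEQ_le[OF _ \<eta>] init by blast
  then have "g s = j0" by simp
  then show thesis
    using that[of g] g(2) gJ by (simp add: has_vector_derivative_def)
qed

text \<open>Solutions depend strictly differentiably on a parameter, and the derivative solves the
  linearized equation. An arbitrary derivative \<open>A0\<close> at time \<open>s\<close> is
  allowed, so that the statement can be iterated from chart to chart. Nearby solutions are Lipschitz
  in the parameter by Gronwall; hence difference quotients nearly solve the linearized equation, and
  a last use of Gronwall compares the true increments with its solutions.\<close>

lemma strict_deriv_flow:
  fixes F :: "'a::euclidean_space \<Rightarrow> 'a" and y :: "'p::euclidean_space \<Rightarrow> real \<Rightarrow> 'a"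
  assumes C: "C1_on W F F'" and sol: "\<And>w. partial_sol W F (P w) (y w)"
    and Pv: "\<And>\<tau>. \<tau> \<in> {s..t} \<Longrightarrow> P v \<tau>" and st: "s \<le> t"
    and evP: "\<forall>\<^sub>F w in nhds v. P w s" and A0: "strict_deriv (\<lambda>w. y w s) A0 v"
  shows "\<exists>A. A s = A0 \<and> (\<forall>\<tau>\<in>{s..t}. (\<forall>\<^sub>F w in nhds v. P w \<tau>) \<and>
    strict_deriv (\<lambda>w. y w \<tau>) (A \<tau>) v \<and>
    (\<forall>h. ((\<lambda>\<tau>. A \<tau> h) has_vector_derivative F' (y v \<tau>) (A \<tau> h)) (at \<tau> within {s..t})))"
proof -
  define K0 where "K0 = y v ` {s..t}"
  have K0: "compact K0" "K0 \<subseteq> W"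
    using compact_continuous_image[OF partial_sol_continuous_on[OF sol Pv] compact_Icc]
      partial_solD(1)[OF sol Pv]
    by (auto simp: K0_def)
  obtain L where L: "0 < L" "\<And>x h. x \<in> K0 \<Longrightarrow> norm (F' x h) \<le> L * norm h"
    using C1_on_bound[OF C K0] by metis
  have yK: "y v \<tau> \<in> K0" if "\<tau> \<in> {s..t}" for \<tau> using that by (simp add: K0_def)
  have linF: "linear (F' (y v \<tau>))" if "\<tau> \<in> {s..t}" for \<tau>
    using C1_onD(4)[OF C] yK[OF that] K0 bounded_linear.linear by blast
  obtain \<rho> E where \<rho>: "0 < \<rho>" "0 < E" and tube:
    "\<And>P' y' \<tau>. \<lbrakk>partial_sol W F P' y'; P' s; norm (y' s - y v s) < \<rho>; \<tau> \<in> {s..t}\<rbrakk>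
       \<Longrightarrow> P' \<tau> \<and> norm (y' \<tau> - y v \<tau>) \<le> E * norm (y' s - y v s)"
    using partial_sol_tube[OF C sol Pv st] by metis
  obtain d1 C1 where d1: "0 < d1" and C1: "0 < C1" and lip:
    "\<And>w w'. \<lbrakk>w \<in> ball v d1; w' \<in> ball v d1\<rbrakk> \<Longrightarrow> norm (y w' s - y w s) \<le> C1 * norm (w' - w)"
    using strict_deriv_Lipschitz[OF A0] by metis
  obtain d2 where d2: "0 < d2" "\<And>w. w \<in> ball v d2 \<Longrightarrow> P w s"
    using evP unfolding eventually_nhds_metric by (metis dist_commute mem_ball)
  define d where "d = min (min d1 d2) (\<rho> / C1)"
  have d: "0 < d" using d1 d2(1) \<rho>(1) C1 by (simp add: d_def)
  have st1: "P w \<tau> \<and> norm (y w \<tau> - y v \<tau>) \<le> E * (C1 * norm (w - v))"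
    if w: "w \<in> ball v d" and \<tau>: "\<tau> \<in> {s..t}" for w \<tau>
  proof -
    have 1: "norm (y w s - y v s) \<le> C1 * norm (w - v)" using lip[of v w] w d1 by (simp add: d_def)
    also have "\<dots> < C1 * (\<rho> / C1)" using w C1
      by (intro mult_strict_left_mono) (auto simp: d_def dist_norm norm_minus_commute)
    finally have "norm (y w s - y v s) < \<rho>" using C1 by simp
    then have "P w \<tau> \<and> norm (y w \<tau> - y v \<tau>) \<le> E * norm (y w s - y v s)"
      using d2(2)[of w] w by (intro tube sol \<tau>) (auto simp: d_def)
    moreover have "E * norm (y w s - y v s) \<le> E * (C1 * norm (w - v))"
      using 1 \<rho>(2) by (intro mult_left_mono) auto
    ultimately show ?thesis by linarith
  qed
  \<comment> \<open>The linearization of \<open>F\<close> along the reference solution, with an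
    error uniform in time because the trace \<open>K0\<close> is compact.\<close>
  have lin: "\<exists>\<delta>>0. \<delta> \<le> d \<and> (\<forall>w\<in>ball v \<delta>. \<forall>w'\<in>ball v \<delta>. \<forall>\<tau>\<in>{s..t}.
      norm (F (y w' \<tau>) - F (y w \<tau>) - F' (y v \<tau>) (y w' \<tau> - y w \<tau>)) \<le> \<eta> * norm (y w' \<tau> - y w \<tau>))"
    if "0 < \<eta>" for \<eta>
  proof -
    obtain r where r: "0 < r" "\<And>x y y'. \<lbrakk>x \<in> K0; y \<in> ball x r; y' \<in> ball x r\<rbrakk>
        \<Longrightarrow> norm (F y' - F y - F' x (y' - y)) \<le> \<eta> * norm (y' - y)"
      using C1_on_unif[OF C K0 \<open>0 < \<eta>\<close>] by metis
    define \<delta> where "\<delta> = min d (r / (E * C1))"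
    have near: "y w \<tau> \<in> ball (y v \<tau>) r" if w: "w \<in> ball v \<delta>" and \<tau>: "\<tau> \<in> {s..t}" for w \<tau>
    proof -
      have "norm (y w \<tau> - y v \<tau>) \<le> E * C1 * norm (w - v)"
        using st1[of w \<tau>] w \<tau> by (simp add: \<delta>_def mult.assoc)
      also have "\<dots> < E * C1 * (r / (E * C1))" using w C1 \<rho>(2)
        by (intro mult_strict_left_mono) (auto simp: \<delta>_def dist_norm norm_minus_commute)
      finally show ?thesis using C1 \<rho>(2) by (simp add: dist_norm norm_minus_commute)
    qed
    show ?thesis
      by (rule exI[of _ \<delta>]) (use d r(1) C1 \<rho>(2) in \<open>auto simp: \<delta>_def intro!: r(2) yK near[unfolded \<delta>_def]\<close>)
  qed
  have dery: "((\<lambda>\<tau>. y w \<tau>) has_vector_derivative F (y w \<tau>)) (at \<tau> within S)"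
    if "w \<in> ball v d" "\<tau> \<in> {s..t}" for w \<tau> S
    using partial_solD(2)[OF sol] st1[OF that] has_vector_derivative_at_within by blast
  define E2 where "E2 = exp ((L + 2) * (t - s))"
  obtain d3 where d3: "0 < d3" "d3 \<le> d" and lip3: "\<And>w w' \<tau>. \<lbrakk>w \<in> ball v d3; w' \<in> ball v d3; \<tau> \<in> {s..t}\<rbrakk> \<Longrightarrow>
      norm (F (y w' \<tau>) - F (y w \<tau>) - F' (y v \<tau>) (y w' \<tau> - y w \<tau>)) \<le> 1 * norm (y w' \<tau> - y w \<tau>)"
    using lin[OF zero_less_one] by blast
  define C2 where "C2 = E2 * C1"
  have C2: "0 < C2" using C1 by (simp add: C2_def E2_def)
  have lipy: "norm (y w' \<tau> - y w \<tau>) \<le> C2 * norm (w' - w)"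
    if w: "w \<in> ball v d3" and w': "w' \<in> ball v d3" and \<tau>: "\<tau> \<in> {s..t}" for w w' \<tau>
  proof -
    have "norm (y w' \<tau> - y w \<tau>) \<le> exp ((L + 1 + 1) * (\<tau> - s)) * (norm (y w' s - y w s) + 0)"
    proof (rule gronwall[where e' = "\<lambda>\<sigma>. F (y w' \<sigma>) - F (y w \<sigma>)"])
      fix \<sigma> assume "\<sigma> \<in> {s..\<tau>}"
      then have \<sigma>: "\<sigma> \<in> {s..t}" using \<tau> by auto
      show "((\<lambda>\<tau>. y w' \<tau> - y w \<tau>) has_vector_derivative F (y w' \<sigma>) - F (y w \<sigma>)) (at \<sigma> within {s..\<tau>})"
        using w w' d3(2) by (intro has_vector_derivative_diff dery \<sigma>) auto
      have "norm (F (y w' \<sigma>) - F (y w \<sigma>))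
          \<le> norm (F (y w' \<sigma>) - F (y w \<sigma>) - F' (y v \<sigma>) (y w' \<sigma> - y w \<sigma>))
            + norm (F' (y v \<sigma>) (y w' \<sigma> - y w \<sigma>))"
        by (metis diff_add_cancel norm_triangle_ineq)
      also have "\<dots> \<le> 1 * norm (y w' \<sigma> - y w \<sigma>) + L * norm (y w' \<sigma> - y w \<sigma>)"
        by (intro add_mono lip3 L(2) yK w w' \<sigma>)
      finally show "norm (F (y w' \<sigma>) - F (y w \<sigma>)) \<le> (L + 1) * norm (y w' \<sigma> - y w \<sigma>) + 0"
        by (simp add: algebra_simps)
    qed (use \<tau> L in auto)
    also have "\<dots> \<le> E2 * (C1 * norm (w' - w))"
      using \<tau> L w w' d3(2) by (intro mult_mono) (auto simp: E2_def d_def intro!: mult_mono lip)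
    finally show ?thesis by (simp add: C2_def mult.assoc)
  qed
  have bA0: "bounded_linear A0" using A0 by (rule strict_deriv_bounded_linear)
  have linA0: "linear A0" using bA0 by (rule bounded_linear.linear)
  have "\<exists>J. J s = A0 h \<and> (\<forall>\<tau>\<in>{s..t}. (J has_vector_derivative F' (y v \<tau>) (J \<tau>)) (at \<tau> within {s..t}))" for h
  proof -
    have "\<exists>q q'. (\<forall>\<tau>\<in>{s..t}. (q has_vector_derivative q' \<tau>) (at \<tau> within {s..t})
        \<and> norm (q' \<tau> - F' (y v \<tau>) (q \<tau>)) \<le> \<eta>) \<and> norm (q s - A0 h) \<le> \<eta>" if \<eta>: "0 < \<eta>" for \<eta> :: real
    proof -
      define \<eta>' where "\<eta>' = \<eta> / (C2 * norm h + norm h + 1)"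
      have den: "0 < C2 * norm h + norm h + 1"
        using C2 by (simp add: add_nonneg_pos)
      have \<eta>': "0 < \<eta>'" using \<eta> den by (simp add: \<eta>'_def)
      have \<eta>'1: "\<eta>' * (C2 * norm h) \<le> \<eta>" "\<eta>' * norm h \<le> \<eta>"
        using \<eta> den C2 by (auto simp: \<eta>'_def field_simps)
      obtain \<delta>1 where \<delta>1: "0 < \<delta>1" and l1: "\<And>w w' \<tau>. \<lbrakk>w \<in> ball v \<delta>1; w' \<in> ball v \<delta>1; \<tau> \<in> {s..t}\<rbrakk> \<Longrightarrow>
          norm (F (y w' \<tau>) - F (y w \<tau>) - F' (y v \<tau>) (y w' \<tau> - y w \<tau>)) \<le> \<eta>' * norm (y w' \<tau> - y w \<tau>)"
        using lin[OF \<eta>'] by blast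
      obtain \<delta>2 where \<delta>2: "0 < \<delta>2" and l2: "\<And>w w'. \<lbrakk>w \<in> ball v \<delta>2; w' \<in> ball v \<delta>2\<rbrakk> \<Longrightarrow>
          norm (y w' s - y w s - A0 (w' - w)) \<le> \<eta>' * norm (w' - w)"
        using strict_derivD[OF A0 \<eta>'] by metis
      define \<delta> where "\<delta> = min d3 (min \<delta>1 \<delta>2)"
      have \<delta>: "0 < \<delta>" using d3 \<delta>1 \<delta>2 by (simp add: \<delta>_def)
      \<comment> \<open>Scales \<open>h\<close> into the ball around \<open>v\<close>; the summand 1
        takes care of \<open>h = 0\<close>.\<close>
      define c where "c = \<delta> / (norm h + 1)"
      have c: "0 < c" using \<delta> by (simp add: c_def add_nonneg_pos)
      have "0 < norm h + 1" by (simp add: add_nonneg_pos)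
      then have "c * norm h < \<delta>" using \<delta> by (simp add: c_def pos_divide_less_eq distrib_left)
      then have w: "v + c *\<^sub>R h \<in> ball v \<delta>" "v \<in> ball v \<delta>"
        using c \<delta> by (simp_all add: dist_norm)
      define q where "q \<tau> = (1 / c) *\<^sub>R (y (v + c *\<^sub>R h) \<tau> - y v \<tau>)" for \<tau>
      define q' where "q' \<tau> = (1 / c) *\<^sub>R (F (y (v + c *\<^sub>R h) \<tau>) - F (y v \<tau>))" for \<tau>
      have "(q has_vector_derivative q' \<tau>) (at \<tau> within {s..t})" if \<tau>: "\<tau> \<in> {s..t}" for \<tau>
        unfolding q_def q'_def
        using w d3(2)
        by (intro bounded_linear.has_vector_derivative[OF bounded_linear_scaleR_right]
            has_vector_derivative_diff dery \<tau>) (auto simp: \<delta>_def)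
      moreover have "norm (q' \<tau> - F' (y v \<tau>) (q \<tau>)) \<le> \<eta>" if \<tau>: "\<tau> \<in> {s..t}" for \<tau>
      proof -
        have "q' \<tau> - F' (y v \<tau>) (q \<tau>) = (1 / c) *\<^sub>R (F (y (v + c *\<^sub>R h) \<tau>) - F (y v \<tau>)
            - F' (y v \<tau>) (y (v + c *\<^sub>R h) \<tau> - y v \<tau>))"
          by (simp add: q_def q'_def linear_scale[OF linF[OF \<tau>]] linear_diff[OF linF[OF \<tau>]] scaleR_diff_right)
        also have "norm \<dots> \<le> (1 / c) * (\<eta>' * norm (y (v + c *\<^sub>R h) \<tau> - y v \<tau>))"
          using l1[of v "v + c *\<^sub>R h" \<tau>] w \<tau> c by (simp add: \<delta>_def mult_left_mono divide_right_mono)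
        also have "\<dots> \<le> (1 / c) * (\<eta>' * (C2 * norm (v + c *\<^sub>R h - v)))"
          using w c \<eta>' by (intro mult_left_mono lipy \<tau>) (auto simp: \<delta>_def)
        also have "\<dots> = \<eta>' * (C2 * norm h)" using c by simp
        finally show ?thesis using \<eta>'1 by linarith
      qed
      moreover have "norm (q s - A0 h) \<le> \<eta>"
      proof -
        have "q s - A0 h = (1 / c) *\<^sub>R (y (v + c *\<^sub>R h) s - y v s - A0 (v + c *\<^sub>R h - v))"
          using c by (simp add: q_def linear_scale[OF linA0] scaleR_diff_right)
        also have "norm \<dots> \<le> (1 / c) * (\<eta>' * norm (v + c *\<^sub>R h - v))"
          using l2[of v "v + c *\<^sub>R h"] w c by (simp add: \<delta>_def divide_simps mult.commute mult.left_commute)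
        also have "\<dots> = \<eta>' * norm h" using c by simp
        finally show ?thesis using \<eta>'1 by linarith
      qed
      ultimately show ?thesis by blast
    qed
    then have "\<forall>n. \<exists>q q'. (\<forall>\<tau>\<in>{s..t}. (q has_vector_derivative q' \<tau>) (at \<tau> within {s..t})
        \<and> norm (q' \<tau> - F' (y v \<tau>) (q \<tau>)) \<le> inverse (real (Suc n)))
        \<and> norm (q s - A0 h) \<le> inverse (real (Suc n))"
      by simp
    then obtain q q' where q: "\<And>n \<tau>. \<tau> \<in> {s..t} \<Longrightarrow> (q n has_vector_derivative q' n \<tau>) (at \<tau> within {s..t})"
      "\<And>n \<tau>. \<tau> \<in> {s..t} \<Longrightarrow> norm (q' n \<tau> - F' (y v \<tau>) (q n \<tau>)) \<le> inverse (real (Suc n))"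
      "\<And>n. norm (q n s - A0 h) \<le> inverse (real (Suc n))"
      by metis
    show ?thesis
      using linear_ode_limit[OF st less_imp_le[OF L(1)] linF L(2)[OF yK] q LIMSEQ_inverse_real_of_nat]
      by metis
  qed
  then obtain J where J: "\<And>h. J h s = A0 h"
    "\<And>h \<tau>. \<tau> \<in> {s..t} \<Longrightarrow> (J h has_vector_derivative F' (y v \<tau>) (J h \<tau>)) (at \<tau> within {s..t})"
    by metis
  \<comment> \<open>The solutions \<open>J h\<close> were chosen separately for each
    \<open>h\<close>, so their linearity in \<open>h\<close> has to come from uniqueness.\<close>
  have zero: "k \<tau> = 0" if k: "k s = 0"
    "\<And>\<tau>. \<tau> \<in> {s..t} \<Longrightarrow> (k has_vector_derivative F' (y v \<tau>) (k \<tau>)) (at \<tau> within {s..t})" and \<tau>: "\<tau> \<in> {s..t}"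
    for k \<tau>
  proof -
    have "norm (k \<tau>) \<le> exp ((L + 1) * (\<tau> - s)) * (norm (k s) + 0)"
    proof (rule gronwall)
      fix \<sigma> assume "\<sigma> \<in> {s..\<tau>}"
      then have \<sigma>: "\<sigma> \<in> {s..t}" using \<tau> by auto
      show "(k has_vector_derivative F' (y v \<sigma>) (k \<sigma>)) (at \<sigma> within {s..\<tau>})"
        by (rule has_vector_derivative_within_subset[OF k(2)[OF \<sigma>]]) (use \<tau> in auto)
      show "norm (F' (y v \<sigma>) (k \<sigma>)) \<le> L * norm (k \<sigma>) + 0" using L(2)[OF yK[OF \<sigma>]] by simp
    qed (use \<tau> L in auto)
    then show ?thesis using k(1) by simp
  qed
  have add: "J (g + h) \<tau> = J g \<tau> + J h \<tau>" if \<tau>: "\<tau> \<in> {s..t}" for g h \<tau>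
  proof -
    have "(\<lambda>\<tau>. J (g + h) \<tau> - (J g \<tau> + J h \<tau>)) \<tau> = 0"
    proof (rule zero[OF _ _ \<tau>])
      show "((\<lambda>\<tau>. J (g + h) \<tau> - (J g \<tau> + J h \<tau>)) has_vector_derivative
          F' (y v \<sigma>) (J (g + h) \<sigma> - (J g \<sigma> + J h \<sigma>))) (at \<sigma> within {s..t})" if \<sigma>: "\<sigma> \<in> {s..t}" for \<sigma>
        unfolding linear_diff[OF linF[OF \<sigma>]] linear_add[OF linF[OF \<sigma>]]
        by (intro has_vector_derivative_diff has_vector_derivative_add J \<sigma>)
    qed (simp add: J linear_add[OF linA0])
    then show ?thesis by simp
  qed
  have scale: "J (r *\<^sub>R h) \<tau> = r *\<^sub>R J h \<tau>" if \<tau>: "\<tau> \<in> {s..t}" for r h \<tau>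
  proof -
    have "(\<lambda>\<tau>. J (r *\<^sub>R h) \<tau> - r *\<^sub>R J h \<tau>) \<tau> = 0"
    proof (rule zero[OF _ _ \<tau>])
      show "((\<lambda>\<tau>. J (r *\<^sub>R h) \<tau> - r *\<^sub>R J h \<tau>) has_vector_derivative
          F' (y v \<sigma>) (J (r *\<^sub>R h) \<sigma> - r *\<^sub>R J h \<sigma>)) (at \<sigma> within {s..t})" if \<sigma>: "\<sigma> \<in> {s..t}" for \<sigma>
        unfolding linear_diff[OF linF[OF \<sigma>]] linear_scale[OF linF[OF \<sigma>]]
        by (intro has_vector_derivative_diff J \<sigma>
            bounded_linear.has_vector_derivative[OF bounded_linear_scaleR_right])
    qed (simp add: J linear_scale[OF linA0])
    then show ?thesis by simp
  qed
  have strict: "strict_deriv (\<lambda>w. y w \<tau>) (\<lambda>h. J h \<tau>) v" if \<tau>: "\<tau> \<in> {s..t}" for \<tau>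
    unfolding strict_deriv_def
  proof (intro conjI allI impI)
    show "bounded_linear (\<lambda>h. J h \<tau>)"
      by (rule linear_conv_bounded_linear[THEN iffD1]) (intro linearI add[OF \<tau>] scale[OF \<tau>])
    fix \<epsilon> :: real assume \<epsilon>: "0 < \<epsilon>"
    define E1 where "E1 = exp ((L + 1) * (t - s))"
    \<comment> \<open>Initial error \<open>\<eta>\<close> and accumulated error
      \<open>\<eta> * C2\<close>, magnified by the Gronwall factor \<open>E1\<close>, then add up to
      \<epsilon>.\<close>
    define \<eta> where "\<eta> = \<epsilon> / (E1 * (1 + C2))"
    have E1: "0 < E1" by (simp add: E1_def)
    have \<eta>: "0 < \<eta>" using \<epsilon> E1 C2 by (simp add: \<eta>_def)
    obtain \<delta>1 where \<delta>1: "0 < \<delta>1" and l1: "\<And>w w' \<tau>. \<lbrakk>w \<in> ball v \<delta>1; w' \<in> ball v \<delta>1; \<tau> \<in> {s..t}\<rbrakk> \<Longrightarrow>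
        norm (F (y w' \<tau>) - F (y w \<tau>) - F' (y v \<tau>) (y w' \<tau> - y w \<tau>)) \<le> \<eta> * norm (y w' \<tau> - y w \<tau>)"
      using lin[OF \<eta>] by blast
    obtain \<delta>2 where \<delta>2: "0 < \<delta>2" and l2: "\<And>w w'. \<lbrakk>w \<in> ball v \<delta>2; w' \<in> ball v \<delta>2\<rbrakk> \<Longrightarrow>
        norm (y w' s - y w s - A0 (w' - w)) \<le> \<eta> * norm (w' - w)"
      using strict_derivD[OF A0 \<eta>] by metis
    define \<delta> where "\<delta> = min d3 (min \<delta>1 \<delta>2)"
    have \<delta>: "0 < \<delta>" using d3 \<delta>1 \<delta>2 by (simp add: \<delta>_def)
    have "norm (y w' \<tau> - y w \<tau> - J (w' - w) \<tau>) \<le> \<epsilon> * norm (w' - w)"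
      if w: "w \<in> ball v \<delta>" "w' \<in> ball v \<delta>" for w w'
    proof -
      have "norm (y w' \<tau> - y w \<tau> - J (w' - w) \<tau>)
          \<le> exp ((L + 1) * (\<tau> - s)) * (norm (y w' s - y w s - J (w' - w) s) + \<eta> * (C2 * norm (w' - w)))"
      proof (rule gronwall[where e' = "\<lambda>\<sigma>. F (y w' \<sigma>) - F (y w \<sigma>) - F' (y v \<sigma>) (J (w' - w) \<sigma>)"])
        fix \<sigma> assume "\<sigma> \<in> {s..\<tau>}"
        then have \<sigma>: "\<sigma> \<in> {s..t}" using \<tau> by auto
        show "((\<lambda>\<tau>. y w' \<tau> - y w \<tau> - J (w' - w) \<tau>) has_vector_derivative
            F (y w' \<sigma>) - F (y w \<sigma>) - F' (y v \<sigma>) (J (w' - w) \<sigma>)) (at \<sigma> within {s..\<tau>})"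
          using w d3(2) \<tau>
          by (intro has_vector_derivative_diff dery \<sigma> has_vector_derivative_within_subset[OF J(2)[OF \<sigma>]])
            (auto simp: \<delta>_def)
        have "F (y w' \<sigma>) - F (y w \<sigma>) - F' (y v \<sigma>) (J (w' - w) \<sigma>)
            = (F (y w' \<sigma>) - F (y w \<sigma>) - F' (y v \<sigma>) (y w' \<sigma> - y w \<sigma>))
              + F' (y v \<sigma>) (y w' \<sigma> - y w \<sigma> - J (w' - w) \<sigma>)"
          by (simp add: linear_diff[OF linF[OF \<sigma>]])
        also have "norm \<dots> \<le> \<eta> * norm (y w' \<sigma> - y w \<sigma>) + L * norm (y w' \<sigma> - y w \<sigma> - J (w' - w) \<sigma>)"
          using w by (intro order_trans[OF norm_triangle_ineq] add_mono l1 \<sigma> L(2) yK) (auto simp: \<delta>_def)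
        also have "\<dots> \<le> \<eta> * (C2 * norm (w' - w)) + L * norm (y w' \<sigma> - y w \<sigma> - J (w' - w) \<sigma>)"
          using w \<eta> by (intro add_right_mono mult_left_mono lipy \<sigma>) (auto simp: \<delta>_def)
        finally show "norm (F (y w' \<sigma>) - F (y w \<sigma>) - F' (y v \<sigma>) (J (w' - w) \<sigma>))
            \<le> L * norm (y w' \<sigma> - y w \<sigma> - J (w' - w) \<sigma>) + \<eta> * (C2 * norm (w' - w))" by simp
      qed (use \<tau> L \<eta> C2 in auto)
      also have "\<dots> \<le> E1 * (\<eta> * norm (w' - w) + \<eta> * (C2 * norm (w' - w)))"
        using \<tau> L w l2[of w w'] \<eta> C2
        by (intro mult_mono add_mono) (auto simp: E1_def \<delta>_def J intro!: mult_left_mono add_nonneg_nonneg)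
      also have "\<dots> = \<epsilon> * norm (w' - w)"
      proof -
        have "E1 * (\<eta> * n + \<eta> * (C2 * n)) = \<eta> * (E1 * (1 + C2)) * n" for n by (simp add: algebra_simps)
        moreover have "\<eta> * (E1 * (1 + C2)) = \<epsilon>" using E1 C2 by (simp add: \<eta>_def)
        ultimately show ?thesis by simp
      qed
      finally show ?thesis .
    qed
    then show "\<exists>\<delta>>0. \<forall>w\<in>ball v \<delta>. \<forall>w'\<in>ball v \<delta>.
        norm (y w' \<tau> - y w \<tau> - J (w' - w) \<tau>) \<le> \<epsilon> * norm (w' - w)"
      using \<delta> by blast
  qed
  have ev: "\<forall>\<^sub>F w in nhds v. P w \<tau>" if "\<tau> \<in> {s..t}" for \<tau>
    using st1[OF _ that] d unfolding eventually_nhds_metric by (auto simp: dist_commute)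
  show ?thesis
    by (rule exI[of _ "\<lambda>\<tau> h. J h \<tau>"]) (use J ev strict in auto)
qed

section \<open>The Levi-Civita connection in a coordinate patch\<close>

lemma smooth_on_imp_Ck_on: "smooth_on S f \<Longrightarrow> Ck_on k S f"
  by (simp add: smooth_on_def)

section \<open>Smooth functions and families of bilinear maps\<close>

lemma smooth_on_has_derivative:
  assumes "smooth_on S f" "x \<in> S"
  shows "(f has_derivative frechet_derivative f (at x)) (at x)"
  using smooth_on_imp_Ck_on[OF assms(1), of "Suc 0"] assms(2)
  by (auto simp: frechet_derivative_works)

lemma smooth_on_frechet_derivative:
  "smooth_on S f \<Longrightarrow> smooth_on S (\<lambda>x. frechet_derivative f (at x) v)"
  unfolding smooth_on_def using Ck_on.simps(2) by blast

lemma smooth_on_continuous_on: "smooth_on S f \<Longrightarrow> continuous_on S f"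
  using smooth_on_imp_Ck_on[of S f 0] by simp

lemma bilinear_family_continuous_on:
  fixes B :: "'c::topological_space \<Rightarrow> 'u::euclidean_space \<Rightarrow> 'v::euclidean_space \<Rightarrow> 'b::real_normed_vector"
  assumes "\<And>a. a \<in> W \<Longrightarrow> bilinear (B a)" "\<And>u v. continuous_on W (\<lambda>a. B a u v)"
    and "continuous_on S f" "continuous_on S g" "continuous_on S h" "f ` S \<subseteq> W"
  shows "continuous_on S (\<lambda>x. B (f x) (g x) (h x))"
proof -
  have 1: "continuous_on (W \<times> UNIV) (\<lambda>(a, u). B a u v)" for v
    by (rule linear_family_continuous_on) (use assms in \<open>auto simp: bilinear_def\<close>)
  have "continuous_on ((W \<times> UNIV) \<times> UNIV) (\<lambda>(c, v). (\<lambda>(a, u). B a u v) c)"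
    using linear_family_continuous_on[where L = "\<lambda>c v. (\<lambda>(a, u). B a u v) c", OF _ 1] assms(1)
    by (auto simp: bilinear_def)
  moreover have "continuous_on S (\<lambda>x. ((f x, g x), h x))" by (intro continuous_intros assms)
  moreover have "(\<lambda>x. ((f x, g x), h x)) ` S \<subseteq> (W \<times> UNIV) \<times> UNIV" using assms(6) by auto
  ultimately have "continuous_on S (\<lambda>x. (\<lambda>(c, v). (\<lambda>(a, u). B a u v) c) ((f x, g x), h x))"
    by (rule continuous_on_compose2)
  then show ?thesis by simp
qed

text \<open>The rule for linear families applied twice, the second time with the pair
  \<open>(b, u)\<close> as parameter.\<close>

lemma bilinear_family_has_derivative:
  fixes B :: "'c::real_normed_vector \<Rightarrow> 'u::euclidean_space \<Rightarrow> 'v::euclidean_space \<Rightarrow> 'b::real_normed_vector"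
  assumes W: "open W" and bil: "\<And>a. a \<in> W \<Longrightarrow> bilinear (B a)"
    and der: "\<And>u v. ((\<lambda>b. B b u v) has_derivative (\<lambda>h. B' h u v)) (at a)" and a: "a \<in> W"
  shows "((\<lambda>((b, u), v). B b u v) has_derivative (\<lambda>((h, k), l). B' h u v + B a k v + B a u l)) (at ((a, u), v))"
    "bilinear (B' h)"
proof -
  have lin: "linear (\<lambda>u. B b u v)" "linear (B b u)" if "b \<in> W" for b u v
    using bil[OF that] by (auto simp: bilinear_def)
  have 1: "((\<lambda>(b, u). B b u v) has_derivative (\<lambda>(h, k). B' h u v + B a k v)) (at (a, u))" for u v
    by (rule linear_family_has_derivative(1)[OF W lin(1) der a])
  have "linear (\<lambda>u. B' h u v)" "linear (B' h u)" for u v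
    using linear_family_has_derivative(2)[OF W lin(1) der a] linear_family_has_derivative(2)[OF W lin(2) der a]
    by auto
  then show "bilinear (B' h)" by (auto simp: bilinear_def)
  have "((\<lambda>(c, v). (\<lambda>(b, u). B b u v) c) has_derivative
      (\<lambda>(x, l). (\<lambda>(h, k). B' h u v + B a k v) x + (\<lambda>(b, u). B b u l) (a, u))) (at ((a, u), v))"
    by (rule linear_family_has_derivative(1)[where L' = "\<lambda>x v. (\<lambda>(h, k). B' h u v + B a k v) x",
          OF open_Times[OF W open_UNIV]])
      (use lin 1 a in auto)
  then show "((\<lambda>((b, u), v). B b u v) has_derivative (\<lambda>((h, k), l). B' h u v + B a k v + B a u l)) (at ((a, u), v))"
    by (simp add: case_prod_unfold)
qed

lemma bilinear_family_has_vector_derivative: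
  fixes B :: "'c::real_normed_vector \<Rightarrow> 'u::euclidean_space \<Rightarrow> 'v::euclidean_space \<Rightarrow> 'b::real_normed_vector"
  assumes W: "open W" and bil: "\<And>a. a \<in> W \<Longrightarrow> bilinear (B a)"
    and der: "\<And>u v. ((\<lambda>b. B b u v) has_derivative (\<lambda>h. B' h u v)) (at (c t))" and a: "c t \<in> W"
    and c: "(c has_vector_derivative c') (at t within S)"
    and X: "(X has_vector_derivative X') (at t within S)"
    and Y: "(Y has_vector_derivative Y') (at t within S)"
  shows "((\<lambda>t. B (c t) (X t) (Y t)) has_vector_derivative
      B' c' (X t) (Y t) + B (c t) X' (Y t) + B (c t) (X t) Y') (at t within S)"
proof -
  have lin: "linear (\<lambda>u. B (c t) u v)" "linear (B (c t) u)" for u v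
    using bil[OF a] by (auto simp: bilinear_def)
  have linB: "linear (\<lambda>h. B' h u v)" for u v
    using has_derivative_linear[OF der] .
  have "((\<lambda>t. ((c t, X t), Y t)) has_derivative (\<lambda>x. ((x *\<^sub>R c', x *\<^sub>R X'), x *\<^sub>R Y'))) (at t within S)"
    using c X Y unfolding has_vector_derivative_def by (intro has_derivative_Pair)
  moreover have "((\<lambda>((b, u), v). B b u v) has_derivative
      (\<lambda>((h, k), l). B' h (X t) (Y t) + B (c t) k (Y t) + B (c t) (X t) l)) (at ((c t, X t), Y t))"
    by (rule bilinear_family_has_derivative(1)[OF W bil der a])
  ultimately have "((\<lambda>t. (\<lambda>((b, u), v). B b u v) ((c t, X t), Y t)) has_derivative
      (\<lambda>x. (\<lambda>((h, k), l). B' h (X t) (Y t) + B (c t) k (Y t) + B (c t) (X t) l)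
        ((x *\<^sub>R c', x *\<^sub>R X'), x *\<^sub>R Y'))) (at t within S)"
    by (rule has_derivative_compose)
  then have "((\<lambda>t. B (c t) (X t) (Y t)) has_derivative
      (\<lambda>x. B' (x *\<^sub>R c') (X t) (Y t) + B (c t) (x *\<^sub>R X') (Y t) + B (c t) (X t) (x *\<^sub>R Y'))) (at t within S)"
    by simp
  then show ?thesis
    unfolding has_vector_derivative_def
    by (rule has_derivative_eq_rhs)
      (auto simp: fun_eq_iff linear_scale[OF linB] linear_scale[OF lin(1)] linear_scale[OF lin(2)]
        scaleR_add_right)
qed

lemma bilinear_bound_Basis:
  fixes B :: "'u::euclidean_space \<Rightarrow> 'v::euclidean_space \<Rightarrow> real"
  assumes "bilinear B"
  shows "\<bar>B u v\<bar> \<le> (\<Sum>i\<in>Basis. \<Sum>j\<in>Basis. \<bar>B i j\<bar>) * norm u * norm v"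
proof -
  have lin: "linear (\<lambda>u. B u v)" "linear (B u)" for u v using assms by (auto simp: bilinear_def)
  have "B u v = (\<Sum>i\<in>Basis. \<Sum>j\<in>Basis. (u \<bullet> i) * ((v \<bullet> j) * B i j))"
    by (subst euclidean_linear_expand[OF lin(1)], subst euclidean_linear_expand[OF lin(2)])
      (simp add: sum_distrib_left)
  also have "\<bar>\<dots>\<bar> \<le> (\<Sum>i\<in>Basis. \<Sum>j\<in>Basis. \<bar>(u \<bullet> i) * ((v \<bullet> j) * B i j)\<bar>)"
    by (rule order_trans[OF sum_abs sum_mono[OF sum_abs]])
  also have "\<dots> \<le> (\<Sum>i\<in>Basis. \<Sum>j\<in>Basis. norm u * (norm v * \<bar>B i j\<bar>))"
    unfolding abs_mult by (intro sum_mono mult_mono Basis_le_norm mult_nonneg_nonneg) auto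
  also have "\<dots> = (\<Sum>i\<in>Basis. \<Sum>j\<in>Basis. \<bar>B i j\<bar>) * norm u * norm v"
    by (simp add: sum_distrib_left sum_distrib_right mult_ac)
  finally show ?thesis .
qed

text \<open>A product rule for a factor \<open>c\<close> that is merely continuous: in the increment
  of the product, its variation is multiplied by \<open>g\<close>, which is of first order near the
  zero \<open>a\<close>. It is applied with the coordinates of an unknown vector field as
  \<open>c\<close>.\<close>

lemma has_derivative_mult_zero:
  fixes g c :: "'a::real_normed_vector \<Rightarrow> real"
  assumes g: "(g has_derivative g') (at a)" and g0: "g a = 0" and c: "isCont c a"
  shows "((\<lambda>b. c b * g b) has_derivative (\<lambda>h. c a * g' h)) (at a)"
  unfolding has_derivative_at_alt
proof (intro conjI allI impI)
  have bl: "bounded_linear g'" using g by (rule has_derivative_bounded_linear)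
  then show "bounded_linear (\<lambda>h. c a * g' h)" by (rule bounded_linear_const_mult)
  fix e :: real assume e: "0 < e"
  obtain K where K: "0 < K" "\<And>h. norm (g' h) \<le> norm h * K"
    using bounded_linear.pos_bounded[OF bl] by metis
  define e1 where "e1 = e / (2 * (\<bar>c a\<bar> + 1))"
  have e1: "0 < e1" "\<bar>c a\<bar> * e1 \<le> e / 2"
    using e by (auto simp: e1_def field_simps add_pos_nonneg)
  define e2 where "e2 = e / (2 * (K + e1))"
  have e2: "0 < e2" using e e1 K by (simp add: e2_def)
  obtain d1 where d1: "0 < d1" "\<And>y. norm (y - a) < d1 \<Longrightarrow> norm (g y - g a - g' (y - a)) \<le> e1 * norm (y - a)"
    using g e1 unfolding has_derivative_at_alt by blast
  obtain d2 where d2: "0 < d2" "\<And>y. dist y a < d2 \<Longrightarrow> dist (c y) (c a) < e2"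
    using c e2 unfolding continuous_at_eps_delta by blast
  show "\<exists>d>0. \<forall>y. norm (y - a) < d \<longrightarrow> norm (c y * g y - c a * g a - c a * g' (y - a)) \<le> e * norm (y - a)"
  proof (intro exI[of _ "min d1 d2"] conjI allI impI)
    fix y assume y: "norm (y - a) < min d1 d2"
    have 1: "\<bar>g y - g' (y - a)\<bar> \<le> e1 * norm (y - a)" using d1(2)[of y] y g0 by simp
    have 2: "\<bar>g y\<bar> \<le> (K + e1) * norm (y - a)"
      using 1 K(2)[of "y - a"] by (simp add: algebra_simps abs_le_iff)
    have "\<bar>c y - c a\<bar> * \<bar>g y\<bar> \<le> e2 * ((K + e1) * norm (y - a))"
      using d2(2)[of y] y e2 by (intro mult_mono 2) (auto simp: dist_norm)
    also have "\<dots> = e2 * (K + e1) * norm (y - a)" by simp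
    also have "e2 * (K + e1) = e / 2"
    proof -
      have "e / (2 * k) * k = e / 2" if "0 < k" for k :: real using that by simp
      then show ?thesis unfolding e2_def using K(1) e1 by (meson add_pos_pos)
    qed
    finally have 3: "\<bar>(c y - c a) * g y\<bar> \<le> e / 2 * norm (y - a)" by (simp add: abs_mult)
    have "\<bar>c a * (g y - g' (y - a))\<bar> \<le> \<bar>c a\<bar> * (e1 * norm (y - a))"
      unfolding abs_mult by (intro mult_left_mono 1) simp
    also have "\<dots> \<le> e / 2 * norm (y - a)"
      using mult_right_mono[OF e1(2), of "norm (y - a)"] by (simp add: mult.assoc)
    finally have 4: "\<bar>c a * (g y - g' (y - a))\<bar> \<le> e / 2 * norm (y - a)" .
    have "c y * g y - c a * g a - c a * g' (y - a) = (c y - c a) * g y + c a * (g y - g' (y - a))"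
      using g0 by (simp add: algebra_simps)
    then show "norm (c y * g y - c a * g a - c a * g' (y - a)) \<le> e * norm (y - a)"
      using 3 4 by simp
  qed (use d1 d2 in simp)
qed

text \<open>Separates the calculus of a metric in coordinates from the manifold; every chart of the
  maximal atlas gives an instance.\<close>

locale metric_patch =
  fixes W :: "'e::euclidean_space set" and G :: "'e \<Rightarrow> 'e \<Rightarrow> 'e \<Rightarrow> real"
  assumes open_W: "open W"
    and bil: "a \<in> W \<Longrightarrow> bilinear (G a)"
    and sym: "a \<in> W \<Longrightarrow> G a u v = G a v u"
    and pos: "a \<in> W \<Longrightarrow> v \<noteq> 0 \<Longrightarrow> 0 < G a v v"
    and smooth: "smooth_on W (\<lambda>a. G a u v)"
begin

lemma lin: assumes "a \<in> W" shows "linear (\<lambda>u. G a u v)" "linear (G a u)"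
  using bil[OF assms] by (auto simp: bilinear_def)

lemmas G_simps = linear_add[OF lin(1)] linear_add[OF lin(2)] linear_diff[OF lin(1)] linear_diff[OF lin(2)]
  linear_scale[OF lin(1)] linear_scale[OF lin(2)] linear_0[OF lin(1)] linear_0[OF lin(2)]
  linear_neg[OF lin(1)] linear_neg[OF lin(2)]

lemma nonneg: "a \<in> W \<Longrightarrow> 0 \<le> G a v v"
  using pos[of a v] by (cases "v = 0") (auto simp: G_simps)

lemma Cauchy_Schwarz:
  assumes a: "a \<in> W"
  shows "(G a u v)\<^sup>2 \<le> G a u u * G a v v"
proof (cases "v = 0")
  case True then show ?thesis using a by (simp add: G_simps)
next
  case False
  \<comment> \<open>The component of \<open>u\<close> orthogonal to \<open>v\<close>, multiplied by
    \<open>G a v v\<close> to avoid a division; its squared length contains the Gram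
    determinant.\<close>
  define w where "w = G a v v *\<^sub>R u - G a u v *\<^sub>R v"
  have "G a w w = G a v v * (G a u u * G a v v - (G a u v)\<^sup>2)"
    using a by (simp add: w_def G_simps sym[OF a, of v u] power2_eq_square algebra_simps)
  then have "0 \<le> G a v v * (G a u u * G a v v - (G a u v)\<^sup>2)" using nonneg[OF a, of w] by simp
  then show ?thesis using pos[OF a False] by (simp add: zero_le_mult_iff)
qed

text \<open>Gives the positive denominator of the sectional curvature.\<close>

lemma Cauchy_Schwarz_strict:
  assumes a: "a \<in> W" and v: "v \<noteq> 0" and u: "u \<notin> span {v}"
  shows "(G a u v)\<^sup>2 < G a u u * G a v v"
proof -
  define w where "w = G a v v *\<^sub>R u - G a u v *\<^sub>R v"
  have "w \<noteq> 0"
  proof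
    assume "w = 0"
    then have "u = (G a u v / G a v v) *\<^sub>R v"
      using pos[OF a v] by (simp add: w_def field_simps eq_vector_fraction_iff)
    then show False using u by (metis span_base span_scale singletonI)
  qed
  have "G a w w = G a v v * (G a u u * G a v v - (G a u v)\<^sup>2)"
    using a by (simp add: w_def G_simps sym[OF a, of v u] power2_eq_square algebra_simps)
  then have "0 < G a v v * (G a u u * G a v v - (G a u v)\<^sup>2)" using pos[OF a \<open>w \<noteq> 0\<close>] by simp
  then show ?thesis using pos[OF a v] by (simp add: zero_less_mult_iff)
qed

text \<open>The quadratic form has a positive minimum on the compact Euclidean unit sphere;
  homogeneity extends the bound to all vectors.\<close>

lemma coercive:
  assumes a: "a \<in> W"
  obtains c where "0 < c" "\<And>v. c * (norm v)\<^sup>2 \<le> G a v v"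
proof -
  have cont: "continuous_on (sphere 0 1) (\<lambda>v. G a v v)"
    using bilinear_family_continuous_on[where W = "{a}" and B = G and f = "\<lambda>_. a" and S = "sphere 0 1"
        and g = "\<lambda>x. x" and h = "\<lambda>x. x"] bil[OF a]
    by (auto intro: continuous_intros)
  obtain b :: 'e where b: "b \<in> Basis" by (metis nonempty_Basis ex_in_conv)
  then have "b \<in> sphere 0 1" by simp
  then obtain x where x: "x \<in> sphere 0 1" "\<And>y. y \<in> sphere 0 1 \<Longrightarrow> G a x x \<le> G a y y"
    using continuous_attains_inf[OF compact_sphere _ cont] by blast
  have "x \<noteq> 0" using x(1) by auto
  then have "0 < G a x x" by (rule pos[OF a])
  moreover have "G a x x * (norm v)\<^sup>2 \<le> G a v v" for v
  proof (cases "v = 0")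
    case False
    then have "G a x x \<le> G a (v /\<^sub>R norm v) (v /\<^sub>R norm v)" by (intro x(2)) simp
    also have "\<dots> = G a v v / (norm v)\<^sup>2" using a by (simp add: G_simps power2_eq_square divide_inverse)
    finally show ?thesis using False by (simp add: field_simps)
  qed (use a in \<open>simp add: G_simps\<close>)
  ultimately show thesis using that by blast
qed

text \<open>The musical isomorphism, with covectors written as Euclidean vectors. Its injectivity
  makes it bijective, which is the content of \<open>riesz\<close>.\<close>

definition "flat a w = (\<Sum>i\<in>Basis. G a w i *\<^sub>R i)"

lemma linear_flat: "a \<in> W \<Longrightarrow> linear (flat a)"
  by (rule linearI) (simp_all add: flat_def G_simps sum.distrib scaleR_add_left scaleR_sum_right)

lemma inj_flat:
  assumes a: "a \<in> W" shows "inj (flat a)"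
  unfolding linear_injective_0[OF linear_flat[OF a]]
proof (intro allI impI)
  fix w assume w: "flat a w = 0"
  have "G a w i = 0" if "i \<in> Basis" for i
    using arg_cong[OF w, of "\<lambda>x. x \<bullet> i"] that by (simp add: flat_def)
  then have "G a w w = 0" by (subst euclidean_linear_expand[OF lin(2)[OF a]]) simp
  then show "w = 0" using pos[OF a, of w] by auto
qed

lemma riesz:
  assumes a: "a \<in> W" and l: "linear l"
  shows "\<exists>w. \<forall>z. G a w z = l z"
proof -
  obtain w where w: "flat a w = (\<Sum>i\<in>Basis. l i *\<^sub>R i)"
    using linear_injective_imp_surjective[OF linear_flat[OF a] inj_flat[OF a]] by (metis surjD)
  have wi: "G a w i = l i" if "i \<in> Basis" for i
    using arg_cong[OF w, of "\<lambda>x. x \<bullet> i"] that by (simp add: flat_def)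
  have "G a w z = l z" for z
    using euclidean_linear_expand[OF lin(2)[OF a], of w z] euclidean_linear_expand[OF l, of z] by (simp add: wi)
  then show ?thesis by blast
qed

lemma G_unique:
  assumes a: "a \<in> W" and "\<And>z. G a w z = G a w' z"
  shows "w = w'"
proof -
  have "G a (w - w') (w - w') = 0" using a assms(2) by (simp add: G_simps)
  then show ?thesis using pos[OF a, of "w - w'"] by auto
qed

definition "dG a h u v = frechet_derivative (\<lambda>b. G b u v) (at a) h"
definition "ddG a k h u v = frechet_derivative (\<lambda>b. dG b h u v) (at a) k"

lemma smooth_dG: "smooth_on W (\<lambda>a. dG a h u v)"
  unfolding dG_def by (rule smooth_on_frechet_derivative[OF smooth])

lemma G_der: "a \<in> W \<Longrightarrow> ((\<lambda>b. G b u v) has_derivative (\<lambda>h. dG a h u v)) (at a)"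
  using smooth_on_has_derivative[OF smooth] by (simp add: dG_def[abs_def])

lemma dG_der: "a \<in> W \<Longrightarrow> ((\<lambda>b. dG b h u v) has_derivative (\<lambda>k. ddG a k h u v)) (at a)"
  using smooth_on_has_derivative[OF smooth_dG] by (simp add: ddG_def[abs_def])

lemma cont_G: "continuous_on W (\<lambda>a. G a u v)"
  by (rule smooth_on_continuous_on[OF smooth])

lemma cont_dG: "continuous_on W (\<lambda>a. dG a h u v)"
  by (rule smooth_on_continuous_on[OF smooth_dG])

lemma cont_ddG: "continuous_on W (\<lambda>a. ddG a k h u v)"
  unfolding ddG_def by (rule smooth_on_continuous_on[OF smooth_on_frechet_derivative[OF smooth_dG]])

lemma bil_dG: assumes a: "a \<in> W" shows "bilinear (dG a h)"
  by (rule bilinear_family_has_derivative(2)[OF open_W bil G_der[OF a] a])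

lemma lin_dG: "a \<in> W \<Longrightarrow> linear (\<lambda>h. dG a h u v)"
  using has_derivative_linear[OF G_der] .

lemma bil_ddG: assumes a: "a \<in> W" shows "bilinear (ddG a k h)"
  by (rule bilinear_family_has_derivative(2)[OF open_W bil_dG dG_der[OF a] a])

lemma lin_ddG: assumes a: "a \<in> W" shows "linear (\<lambda>h. ddG a k h u v)"
  by (rule linear_family_has_derivative(2)[where L = "\<lambda>a h. dG a h u v", OF open_W lin_dG dG_der[OF a] a])

lemma dG_sym: "a \<in> W \<Longrightarrow> dG a h u v = dG a h v u"
  using has_derivative_unique[OF G_der[of a u v]
      has_derivative_transform_within_open[OF G_der[of a v u] open_W _ sym]]
  by metis

text \<open>Continuity of the solution of a linear system without inverting its matrix: the
  equations at \<open>a\<close> and \<open>b\<close> are subtracted and tested with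
  \<open>z = y b - y a\<close>, and coercivity at \<open>a\<close> bounds the difference. Applied to
  the Christoffel symbols and to their derivatives.\<close>

lemma solution_continuous:
  assumes eq: "\<And>a z. a \<in> W \<Longrightarrow> G a (y a) z = \<beta> a z" and cont: "\<And>z. continuous_on W (\<lambda>a. \<beta> a z)"
  shows "continuous_on W y"
proof (rule continuous_at_imp_continuous_on, rule ballI)
  fix a assume a: "a \<in> W"
  obtain c where c: "0 < c" "\<And>v. c * (norm v)\<^sup>2 \<le> G a v v" using coercive[OF a] by metis
  define \<eta>1 where "\<eta>1 b = (\<Sum>i\<in>Basis. \<bar>\<beta> b i - \<beta> a i\<bar>)" for b
  define \<eta>2 where "\<eta>2 b = (\<Sum>i\<in>Basis. \<Sum>j\<in>Basis. \<bar>G b i j - G a i j\<bar>)" for b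
  have icG: "isCont (\<lambda>b. G b i j) a" for i j using cont_G open_W a by (simp add: continuous_on_eq_continuous_at)
  have ic\<beta>: "isCont (\<lambda>b. \<beta> b i) a" for i using cont open_W a by (simp add: continuous_on_eq_continuous_at)
  have "isCont \<eta>1 a" unfolding \<eta>1_def by (intro continuous_intros ic\<beta>)
  then have t1: "(\<eta>1 \<longlongrightarrow> 0) (at a)" by (simp add: isCont_def \<eta>1_def)
  have "isCont \<eta>2 a" unfolding \<eta>2_def by (intro continuous_intros icG)
  then have t2: "(\<eta>2 \<longlongrightarrow> 0) (at a)" by (simp add: isCont_def \<eta>2_def)
  \<comment> \<open>The smallness of \<open>\<eta>2 b\<close> allows half of the coercive term to
    absorb the part of \<open>norm (y b)\<close> that comes from the difference itself.\<close>
  have est: "norm (y b - y a) \<le> 2 / c * (\<eta>1 b + \<eta>2 b * norm (y a))" if b: "b \<in> W" and small: "\<eta>2 b < c / 2" for b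
  proof -
    define d where "d = y b - y a"
    have lin\<beta>: "linear (\<lambda>z. \<beta> b z - \<beta> a z)"
      using linear_compose_sub[OF lin(2)[OF b, of "y b"] lin(2)[OF a, of "y a"]] by (simp add: eq a b)
    have "\<beta> b d - \<beta> a d = (\<Sum>i\<in>Basis. (d \<bullet> i) *\<^sub>R (\<beta> b i - \<beta> a i))"
      by (rule euclidean_linear_expand[OF lin\<beta>])
    also have "\<bar>\<dots>\<bar> \<le> (\<Sum>i\<in>Basis. norm d * \<bar>\<beta> b i - \<beta> a i\<bar>)"
      by (intro order_trans[OF sum_abs] sum_mono) (auto simp: abs_mult intro!: mult_right_mono Basis_le_norm)
    finally have 1: "\<bar>\<beta> b d - \<beta> a d\<bar> \<le> \<eta>1 b * norm d"
      by (simp add: \<eta>1_def sum_distrib_left[symmetric] mult.commute)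
    have bil': "bilinear (\<lambda>u v. G b u v - G a u v)"
      using a b by (auto simp: bilinear_def G_simps algebra_simps intro!: linearI)
    have 2: "\<bar>G b (y b) d - G a (y b) d\<bar> \<le> \<eta>2 b * norm (y b) * norm d"
      using bilinear_bound_Basis[OF bil', of "y b" d] by (simp add: \<eta>2_def)
    have "c * (norm d)\<^sup>2 \<le> G a d d" by (rule c(2))
    also have "G a d d = (\<beta> b d - \<beta> a d) - (G b (y b) d - G a (y b) d)"
      using a b by (simp add: eq[symmetric]) (simp add: d_def G_simps)
    also have "\<dots> \<le> \<eta>1 b * norm d + \<eta>2 b * norm (y b) * norm d" using 1 2 by linarith
    finally have "c * norm d * norm d \<le> (\<eta>1 b + \<eta>2 b * norm (y b)) * norm d"
      by (simp add: power2_eq_square algebra_simps)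
    then have 3: "c * norm d \<le> \<eta>1 b + \<eta>2 b * norm (y b)"
      using sum_nonneg[of Basis "\<lambda>i. \<bar>\<beta> b i - \<beta> a i\<bar>"]
      by (cases "d = 0") (auto simp: \<eta>1_def \<eta>2_def intro!: add_nonneg_nonneg mult_nonneg_nonneg sum_nonneg)
    have "0 \<le> \<eta>2 b" by (simp add: \<eta>2_def sum_nonneg)
    then have "\<eta>2 b * norm (y b) \<le> \<eta>2 b * (norm d + norm (y a))"
      unfolding d_def by (intro mult_left_mono) (metis norm_triangle_sub add.commute)
    moreover have "\<eta>2 b * norm d \<le> c / 2 * norm d" using small by (intro mult_right_mono) auto
    ultimately have "c / 2 * norm d \<le> \<eta>1 b + \<eta>2 b * norm (y a)" using 3 by (simp add: algebra_simps)
    then show ?thesis using c(1) by (simp add: d_def field_simps)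
  qed
  have "((\<lambda>b. y b - y a) \<longlongrightarrow> 0) (at a)"
  proof (rule Lim_null_comparison)
    have "\<forall>\<^sub>F b in at a. b \<in> W" using open_W a by (auto simp: eventually_at_topological)
    moreover have "\<forall>\<^sub>F b in at a. \<eta>2 b < c / 2" using order_tendstoD(2)[OF t2, of "c / 2"] c(1) by linarith
    ultimately show "\<forall>\<^sub>F b in at a. norm (y b - y a) \<le> 2 / c * (\<eta>1 b + \<eta>2 b * norm (y a))"
      by eventually_elim (rule est)
    have "((\<lambda>b. 2 / c * (\<eta>1 b + \<eta>2 b * norm (y a))) \<longlongrightarrow> 2 / c * (0 + 0 * norm (y a))) (at a)"
      by (intro tendsto_intros t1 t2)
    then show "((\<lambda>b. 2 / c * (\<eta>1 b + \<eta>2 b * norm (y a))) \<longlongrightarrow> 0) (at a)" by simp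
  qed
  then show "isCont y a" unfolding isCont_def using LIM_zero_cancel by blast
qed

text \<open>Differentiating the defining equation of \<open>y\<close> needs only the continuity of \<open>y\<close>, because
  \<open>G b - G a\<close> vanishes at \<open>b = a\<close>.\<close>

lemma solution_has_derivative:
  assumes eq: "\<And>a z. a \<in> W \<Longrightarrow> G a (y a) z = \<beta> a z" and a: "a \<in> W" and cont: "isCont y a"
    and der: "\<And>z. ((\<lambda>b. \<beta> b z) has_derivative (\<lambda>h. \<beta>' h z)) (at a)"
    and eq': "\<And>h z. G a (y' h) z = \<beta>' h z - dG a h (y a) z"
  shows "(y has_derivative y') (at a)"
proof -
  obtain \<Psi> where \<Psi>: "linear \<Psi>" "\<And>x. \<Psi> (flat a x) = x"
    using linear_injective_isomorphism[OF linear_flat[OF a] inj_flat[OF a]] by blast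
  have d: "((\<lambda>b. G a (y b) z) has_derivative (\<lambda>h. G a (y' h) z)) (at a)" for z
  proof -
    have "((\<lambda>b. \<beta> b z - (\<Sum>i\<in>Basis. (y b \<bullet> i) * (G b i z - G a i z))) has_derivative
        (\<lambda>h. \<beta>' h z - (\<Sum>i\<in>Basis. (y a \<bullet> i) * (dG a h i z - 0)))) (at a)"
      by (intro has_derivative_diff has_derivative_sum der has_derivative_mult_zero G_der[OF a]
          has_derivative_const) (use cont in \<open>auto intro!: continuous_intros\<close>)
    moreover have "\<beta>' h z - (\<Sum>i\<in>Basis. (y a \<bullet> i) * (dG a h i z - 0)) = G a (y' h) z" for h
    proof -
      have "linear (\<lambda>u. dG a h u z)" using bil_dG[OF a] by (simp add: bilinear_def)
      from euclidean_linear_expand[OF this, of "y a"] show ?thesis by (simp add: eq')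
    qed
    ultimately have "((\<lambda>b. \<beta> b z - (\<Sum>i\<in>Basis. (y b \<bullet> i) * (G b i z - G a i z))) has_derivative
        (\<lambda>h. G a (y' h) z)) (at a)" by simp
    then show ?thesis
    proof (rule has_derivative_transform_within_open[OF _ open_W a])
      fix b assume b: "b \<in> W"
      have "linear (\<lambda>u. G b u z - G a u z)"
        by (rule linear_compose_sub[OF lin(1)[OF b] lin(1)[OF a]])
      from euclidean_linear_expand[OF this, of "y b"]
      show "\<beta> b z - (\<Sum>i\<in>Basis. (y b \<bullet> i) * (G b i z - G a i z)) = G a (y b) z"
        by (simp add: eq[OF b, symmetric])
    qed
  qed
  \<comment> \<open>The coordinates of \<open>flat a (y b)\<close> are differentiable, and the
    linear left inverse \<open>\<Psi>\<close> of \<open>flat a\<close> transfers this to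
    \<open>y\<close>.\<close>
  have "((\<lambda>b. flat a (y b)) has_derivative (\<lambda>h. flat a (y' h))) (at a)"
    unfolding flat_def by (intro has_derivative_sum has_derivative_scaleR_left d)
  from has_derivative_compose[OF this, of \<Psi> \<Psi>]
  have "((\<lambda>b. \<Psi> (flat a (y b))) has_derivative (\<lambda>h. \<Psi> (flat a (y' h)))) (at a)"
    using \<Psi>(1) by (simp add: linear_imp_has_derivative)
  then show ?thesis by (simp add: \<Psi>(2))
qed

section \<open>Christoffel symbols, the geodesic equation and Jacobi fields in coordinates\<close>

abbreviation "\<Gamma> \<equiv> christoffel G"

lemma koszul_linear:
  assumes a: "a \<in> W"
  shows "linear (\<lambda>z. (dG a u v z + dG a v u z - dG a z u v) / 2)"
proof -
  have l: "linear (\<lambda>z. dG a u v z)" "linear (\<lambda>z. dG a v u z)" "linear (\<lambda>z. dG a z u v)"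
    using bil_dG[OF a, of u] bil_dG[OF a, of v] lin_dG[OF a, of u v] by (auto simp: bilinear_def)
  show ?thesis
    by (rule linearI) (simp_all add: l[THEN linear_add] l[THEN linear_scale] field_simps)
qed

text \<open>Shows that the \<open>THE\<close> in \<open>christoffel\<close> denotes: the Koszul
  expression is linear in \<open>z\<close>, so \<open>riesz\<close> gives existence, and
  \<open>G_unique\<close> gives uniqueness.\<close>

lemma christoffel_eq:
  assumes a: "a \<in> W"
  shows "G a (\<Gamma> a u v) z = (dG a u v z + dG a v u z - dG a z u v) / 2"
proof -
  obtain w where w: "\<And>z. G a w z = (dG a u v z + dG a v u z - dG a z u v) / 2"
    using riesz[OF a koszul_linear[OF a]] by blast
  have "\<Gamma> a u v = w"
    unfolding christoffel_def dG_def[symmetric]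
  proof (rule the_equality)
    show "\<forall>z. 2 * G a w z = dG a u v z + dG a v u z - dG a z u v" by (simp add: w)
    fix w' assume "\<forall>z. 2 * G a w' z = dG a u v z + dG a v u z - dG a z u v"
    then have "G a w' z = G a w z" for z by (simp add: w eq_divide_eq mult.commute)
    then show "w' = w" by (rule G_unique[OF a])
  qed
  then show ?thesis by (simp add: w)
qed

lemma christoffel_sym: "a \<in> W \<Longrightarrow> \<Gamma> a u v = \<Gamma> a v u"
  by (rule G_unique) (auto simp: christoffel_eq dG_sym[of a _ u v])

lemma bil_christoffel: assumes a: "a \<in> W" shows "bilinear (\<Gamma> a)"
proof -
  have l: "linear (\<lambda>u. \<Gamma> a u v)" for v
  proof (rule linearI)
    fix x y r
    have l: "linear (\<lambda>h. dG a h u v)" "linear (\<lambda>u. dG a h u v)" "linear (\<lambda>v. dG a h u v)" for h u v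
      using bil_dG[OF a] lin_dG[OF a] by (auto simp: bilinear_def)
    show "\<Gamma> a (x + y) v = \<Gamma> a x v + \<Gamma> a y v" "\<Gamma> a (r *\<^sub>R x) v = r *\<^sub>R \<Gamma> a x v"
      using a by (auto intro!: G_unique[OF a] simp: christoffel_eq G_simps l[THEN linear_add]
          l[THEN linear_scale] field_simps)
  qed
  moreover have "linear (\<Gamma> a u)" for u
    using l[of u] by (simp add: christoffel_sym[OF a, of _ u])
  ultimately show ?thesis by (simp add: bilinear_def)
qed

text \<open>In the sum of the two Koszul expressions everything cancels except two halves of
  \<open>dG a h u v\<close>.\<close>

lemma metric_compatible:
  assumes a: "a \<in> W"
  shows "dG a h u v = G a (\<Gamma> a h u) v + G a u (\<Gamma> a h v)"
  using a dG_sym[OF a] by (simp add: sym[OF a, of u] christoffel_eq field_simps)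

lemma cont_christoffel: "continuous_on W (\<lambda>a. \<Gamma> a u v)"
  by (rule solution_continuous[where \<beta> = "\<lambda>a z. (dG a u v z + dG a v u z - dG a z u v) / 2"])
    (auto simp: christoffel_eq intro!: continuous_intros cont_dG)

definition "d\<Gamma> a h u v = frechet_derivative (\<lambda>b. \<Gamma> b u v) (at a) h"

text \<open>The Koszul formula is differentiated: its derivative is linear in \<open>z\<close>,
  hence represented by a vector, and this vector is the derivative of the Christoffel symbol by
  \<open>solution_has_derivative\<close>.\<close>

lemma christoffel_der:
  assumes a: "a \<in> W"
  shows "((\<lambda>b. \<Gamma> b u v) has_derivative (\<lambda>h. d\<Gamma> a h u v)) (at a)"
    "G a (d\<Gamma> a h u v) z = (ddG a h u v z + ddG a h v u z - ddG a h z u v) / 2 - dG a h (\<Gamma> a u v) z"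
proof -
  have "linear (\<lambda>z. (ddG a h u v z + ddG a h v u z - ddG a h z u v) / 2 - dG a h (\<Gamma> a u v) z)" for h
  proof -
    have l: "linear (\<lambda>z. ddG a h u v z)" "linear (\<lambda>z. ddG a h v u z)" "linear (\<lambda>z. ddG a h z u v)"
      "linear (\<lambda>z. dG a h (\<Gamma> a u v) z)"
      using bil_ddG[OF a, of h u] bil_ddG[OF a, of h v] lin_ddG[OF a, of h u v] bil_dG[OF a, of h]
      by (auto simp: bilinear_def)
    show ?thesis
      by (rule linearI) (simp_all add: l[THEN linear_add] l[THEN linear_scale] field_simps)
  qed
  from riesz[OF a this] have "\<exists>w. \<forall>z. G a w z = (ddG a h u v z + ddG a h v u z - ddG a h z u v) / 2 - dG a h (\<Gamma> a u v) z" for h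
    .
  then obtain y' where y': "\<And>h z. G a (y' h) z
      = (ddG a h u v z + ddG a h v u z - ddG a h z u v) / 2 - dG a h (\<Gamma> a u v) z"
    by metis
  have "((\<lambda>b. \<Gamma> b u v) has_derivative y') (at a)"
  proof (rule solution_has_derivative[where \<beta> = "\<lambda>a z. (dG a u v z + dG a v u z - dG a z u v) / 2"])
    show "isCont (\<lambda>b. \<Gamma> b u v) a" using cont_christoffel open_W a by (simp add: continuous_on_eq_continuous_at)
    show "((\<lambda>b. (dG b u v z + dG b v u z - dG b z u v) / 2) has_derivative
        (\<lambda>h. (ddG a h u v z + ddG a h v u z - ddG a h z u v) / 2)) (at a)" for z
      by (intro bounded_linear.has_derivative[OF bounded_linear_divide] has_derivative_diff has_derivative_add dG_der a)
  qed (use a christoffel_eq y' in auto)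
  then show "((\<lambda>b. \<Gamma> b u v) has_derivative (\<lambda>h. d\<Gamma> a h u v)) (at a)"
    "G a (d\<Gamma> a h u v) z = (ddG a h u v z + ddG a h v u z - ddG a h z u v) / 2 - dG a h (\<Gamma> a u v) z"
    using frechet_derivative_at[of _ y' a] y' unfolding d\<Gamma>_def by metis+
qed

lemma cont_d\<Gamma>: "continuous_on W (\<lambda>a. d\<Gamma> a h u v)"
proof (rule solution_continuous[where \<beta> = "\<lambda>a z. (ddG a h u v z + ddG a h v u z - ddG a h z u v) / 2
    - dG a h (\<Gamma> a u v) z"])
  fix z
  have "continuous_on W (\<lambda>a. dG a h (\<Gamma> a u v) z)"
    by (rule bilinear_family_continuous_on[OF bil_dG cont_dG continuous_on_id cont_christoffel]) auto
  then show "continuous_on W (\<lambda>a. (ddG a h u v z + ddG a h v u z - ddG a h z u v) / 2 - dG a h (\<Gamma> a u v) z)"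
    by (intro continuous_intros cont_ddG) auto
qed (rule christoffel_der(2))

lemma bil_d\<Gamma>: assumes a: "a \<in> W" shows "bilinear (d\<Gamma> a h)"
  by (rule bilinear_family_has_derivative(2)[OF open_W bil_christoffel christoffel_der(1)[OF a] a])

lemma lin_d\<Gamma>: "a \<in> W \<Longrightarrow> linear (\<lambda>h. d\<Gamma> a h u v)"
  using has_derivative_linear[OF christoffel_der(1)] .

text \<open>The geodesic equation as a first order system for position and velocity. Its derivative
  \<open>geo_field'\<close> is the Jacobi equation in coordinates; the factor 2 merges the two
  velocity terms by the symmetry of \<open>\<Gamma>\<close>.\<close>

definition "geo_field x = (snd x, - \<Gamma> (fst x) (snd x) (snd x))"
definition "geo_field' x k = (snd k, - (d\<Gamma> (fst x) (fst k) (snd x) (snd x) + 2 *\<^sub>R \<Gamma> (fst x) (snd x) (snd k)))"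

lemma C1_geo_field: "C1_on (W \<times> UNIV) geo_field geo_field'"
  unfolding C1_on_def
proof (intro conjI ballI allI)
  show "open (W \<times> (UNIV :: 'e set))" using open_W by (intro open_Times) auto
  fix x :: "'e \<times> 'e" assume "x \<in> W \<times> UNIV"
  then obtain a u where x: "x = (a, u)" and a: "a \<in> W" by auto
  have 1: "((\<lambda>x. ((fst x, snd x), snd x)) has_derivative (\<lambda>k. ((fst k, snd k), snd k))) (at (a, u))"
    by (auto intro!: derivative_eq_intros)
  have "((\<lambda>x. \<Gamma> (fst x) (snd x) (snd x)) has_derivative
      (\<lambda>k. d\<Gamma> a (fst k) u u + \<Gamma> a (snd k) u + \<Gamma> a u (snd k))) (at (a, u))"
  proof -
    have "((\<lambda>((b, u), v). \<Gamma> b u v) has_derivative (\<lambda>((h, k), l). d\<Gamma> a h u u + \<Gamma> a k u + \<Gamma> a u l))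
        (at ((fst (a, u), snd (a, u)), snd (a, u)))"
      unfolding fst_conv snd_conv
      by (rule bilinear_family_has_derivative(1)[OF open_W bil_christoffel christoffel_der(1)[OF a] a])
    from has_derivative_compose[OF 1 this] show ?thesis by (simp add: case_prod_unfold)
  qed
  then have "((\<lambda>x. (snd x, - \<Gamma> (fst x) (snd x) (snd x))) has_derivative
      (\<lambda>k. (snd k, - (d\<Gamma> a (fst k) u u + \<Gamma> a (snd k) u + \<Gamma> a u (snd k))))) (at (a, u))"
    by (intro has_derivative_Pair has_derivative_minus has_derivative_snd has_derivative_ident)
  then show "(geo_field has_derivative geo_field' x) (at x)"
    by (simp add: geo_field_def[abs_def] geo_field'_def[abs_def] x christoffel_sym[OF a, of _ u] scaleR_2
        add.assoc)
next
  fix h :: "'e \<times> 'e"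
  have "continuous_on (W \<times> UNIV) (\<lambda>x. d\<Gamma> (fst x) (fst h) (snd x) (snd x))"
    by (rule bilinear_family_continuous_on[OF bil_d\<Gamma> cont_d\<Gamma>]) (auto intro!: continuous_intros)
  moreover have "continuous_on (W \<times> UNIV) (\<lambda>x. \<Gamma> (fst x) (snd x) (snd h))"
    by (rule bilinear_family_continuous_on[OF bil_christoffel cont_christoffel]) (auto intro!: continuous_intros)
  ultimately show "continuous_on (W \<times> UNIV) (\<lambda>x. geo_field' x h)"
    unfolding geo_field'_def by (intro continuous_intros)
qed

lemma curvature_eq:
  "curvature G a u v w = d\<Gamma> a u v w - d\<Gamma> a v u w + \<Gamma> a u (\<Gamma> a v w) - \<Gamma> a v (\<Gamma> a u w)"
  by (simp add: curvature_def d\<Gamma>_def)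

text \<open>Extends the sign from independent pairs, where sectional curvature is meaningful, to all
  pairs: for dependent vectors the curvature term vanishes by antisymmetry.\<close>

lemma curvature_nonpos:
  assumes a: "a \<in> W"
    and sec: "\<And>u v. u \<noteq> v \<Longrightarrow> independent {u, v} \<Longrightarrow> sectional_curvature G a u v \<le> 0"
  shows "G a (curvature G a u v v) u \<le> 0"
proof (cases "u \<in> span {v}")
  case True
  then obtain r where r: "u = r *\<^sub>R v" by (auto simp: span_singleton)
  have "curvature G a u v v = 0"
    using bil_d\<Gamma>[OF a] lin_d\<Gamma>[OF a] bil_christoffel[OF a]
    by (simp add: curvature_eq r bilinear_def linear_iff)
  then show ?thesis using a by (simp add: G_simps)
next
  case u: False
  show ?thesis
  proof (cases "v = 0")
    case True
    have "curvature G a u v v = 0"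
      using bil_d\<Gamma>[OF a] lin_d\<Gamma>[OF a] bil_christoffel[OF a]
      by (simp add: curvature_eq True bilinear_def linear_0)
    then show ?thesis using a by (simp add: G_simps)
  next
    case False
    have "u \<noteq> v" using u by (auto simp: span_base)
    moreover have "independent {u, v}" using u False by (simp add: independent_insert)
    ultimately have "sectional_curvature G a u v \<le> 0" by (rule sec)
    moreover have "0 < G a u u * G a v v - (G a u v)\<^sup>2" using Cauchy_Schwarz_strict[OF a False u] by simp
    ultimately show ?thesis by (simp add: sectional_curvature_def divide_le_0_iff)
  qed
qed

text \<open>For a Jacobi field with squared length \<open>f\<close> and covariant derivative
  \<open>P\<close>, one has f' = 2 G(J, P) and f'' = 2 (G(P, P) - G(R(J, u)u, J)), which is at least
  2 G(P, P) for nonpositive curvature. Cauchy-Schwarz then gives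
  \<open>f'^2 \<le> 2 * f * f''\<close>, which says that \<open>sqrt f\<close> is convex wherever
  \<open>f\<close> is positive.\<close>

lemma jacobi_energy:
  assumes a: "c t \<in> W"
    and curv: "\<And>u v. G (c t) (curvature G (c t) u v v) u \<le> 0"
    and c: "(c has_vector_derivative u t) (at t)"
    and u: "(u has_vector_derivative - \<Gamma> (c t) (u t) (u t)) (at t)"
    and J: "(J has_vector_derivative K t) (at t)"
    and K: "(K has_vector_derivative - (d\<Gamma> (c t) (J t) (u t) (u t) + 2 *\<^sub>R \<Gamma> (c t) (u t) (K t))) (at t)"
  defines "f \<equiv> \<lambda>t. G (c t) (J t) (J t)"
    and "g \<equiv> \<lambda>t. 2 * G (c t) (J t) (K t + \<Gamma> (c t) (u t) (J t))"
  shows "(f has_real_derivative g t) (at t)"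
    "\<exists>q\<ge>0. (g has_real_derivative q) (at t) \<and> (g t)\<^sup>2 \<le> 2 * f t * q"
proof -
  note lin\<Gamma> = bil_christoffel[OF a, unfolded bilinear_def]
  note \<Gamma>_simps = linear_add[OF lin\<Gamma>[THEN conjunct1, rule_format]] linear_add[OF lin\<Gamma>[THEN conjunct2, rule_format]]
    linear_diff[OF lin\<Gamma>[THEN conjunct1, rule_format]] linear_diff[OF lin\<Gamma>[THEN conjunct2, rule_format]]
    linear_neg[OF lin\<Gamma>[THEN conjunct1, rule_format]] linear_neg[OF lin\<Gamma>[THEN conjunct2, rule_format]]
    linear_scale[OF lin\<Gamma>[THEN conjunct2, rule_format]]
  have compat: "((\<lambda>t. G (c t) (X t) (Y t)) has_vector_derivative
      G (c t) (X' + \<Gamma> (c t) (u t) (X t)) (Y t) + G (c t) (X t) (Y' + \<Gamma> (c t) (u t) (Y t))) (at t)"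
    if "(X has_vector_derivative X') (at t)" "(Y has_vector_derivative Y') (at t)" for X Y X' Y'
    using bilinear_family_has_vector_derivative[OF open_W bil G_der[OF a] a c that]
    by (simp add: metric_compatible[OF a] G_simps a algebra_simps)
  define P where "P t = K t + \<Gamma> (c t) (u t) (J t)" for t
  have f': "(f has_vector_derivative 2 * G (c t) (J t) (P t)) (at t)"
    using compat[OF J J] by (simp add: f_def P_def sym[OF a, of _ "J t"])
  then show "(f has_real_derivative g t) (at t)"
    by (simp add: g_def P_def has_real_derivative_iff_has_vector_derivative)
  define P' where "P' = - (d\<Gamma> (c t) (J t) (u t) (u t) + 2 *\<^sub>R \<Gamma> (c t) (u t) (K t))
      + (d\<Gamma> (c t) (u t) (u t) (J t) + \<Gamma> (c t) (- \<Gamma> (c t) (u t) (u t)) (J t) + \<Gamma> (c t) (u t) (K t))"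
  have P: "(P has_vector_derivative P') (at t)"
    unfolding P_def P'_def
    by (intro has_vector_derivative_add K
        bilinear_family_has_vector_derivative[OF open_W bil_christoffel christoffel_der(1)[OF a] a c u J])
  have "d\<Gamma> (c t) (u t) (u t) (J t) = d\<Gamma> (c t) (u t) (J t) (u t)"
    using has_derivative_unique[OF christoffel_der(1)[OF a, of "u t" "J t"]
        has_derivative_transform_within_open[OF christoffel_der(1)[OF a, of "J t" "u t"] open_W a christoffel_sym]]
    by metis
  \<comment> \<open>The second order Jacobi equation in covariant form; the derivative terms of the
    Christoffel symbols assemble to the curvature.\<close>
  then have cov: "P' + \<Gamma> (c t) (u t) (P t) = - curvature G (c t) (J t) (u t) (u t)"
    by (simp add: P'_def P_def curvature_eq \<Gamma>_simps scaleR_2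
        christoffel_sym[OF a, of "J t" "u t"] christoffel_sym[OF a, of "J t" "\<Gamma> (c t) (u t) (u t)"])
  define q where "q = 2 * (G (c t) (P t) (P t) - G (c t) (curvature G (c t) (J t) (u t) (u t)) (J t))"
  have "((\<lambda>t. G (c t) (J t) (P t)) has_vector_derivative q / 2) (at t)"
    using compat[OF J P] unfolding cov
    by (simp add: q_def P_def[symmetric] G_simps a diff_divide_distrib sym[OF a, of "J t" "curvature G (c t) (J t) (u t) (u t)"])
  then have "(g has_real_derivative q) (at t)"
    unfolding g_def P_def[symmetric] has_real_derivative_iff_has_vector_derivative
    using bounded_linear.has_vector_derivative[OF bounded_linear_mult_right[of 2]] by fastforce
  moreover have PP: "2 * G (c t) (P t) (P t) \<le> q" using curv by (simp add: q_def)
  moreover have "0 \<le> q" using PP nonneg[OF a, of "P t"] by linarith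
  moreover have "(g t)\<^sup>2 \<le> 2 * f t * q"
  proof -
    have "(g t)\<^sup>2 = 4 * (G (c t) (J t) (P t))\<^sup>2" by (simp add: g_def P_def power_mult_distrib)
    also have "\<dots> \<le> 4 * (G (c t) (J t) (J t) * G (c t) (P t) (P t))"
      using Cauchy_Schwarz[OF a, of "J t" "P t"] by simp
    also have "\<dots> = 2 * f t * (2 * G (c t) (P t) (P t))" by (simp add: f_def)
    also have "\<dots> \<le> 2 * f t * q" using PP nonneg[OF a, of "J t"] by (intro mult_left_mono) (auto simp: f_def)
    finally show ?thesis .
  qed
  ultimately show "\<exists>q\<ge>0. (g has_real_derivative q) (at t) \<and> (g t)\<^sup>2 \<le> 2 * f t * q" by blast
qed

end

section \<open>Charts, geodesics and their uniqueness\<close>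

lemma (in metric_patch) geodesic_speed:
  assumes a: "c t \<in> W" and c: "(c has_vector_derivative u t) (at t)"
    and u: "(u has_vector_derivative - \<Gamma> (c t) (u t) (u t)) (at t)"
  shows "((\<lambda>t. G (c t) (u t) (u t)) has_real_derivative 0) (at t)"
  using bilinear_family_has_vector_derivative[OF open_W bil G_der[OF a] a c u u]
  by (simp add: metric_compatible[OF a] G_simps a has_real_derivative_iff_has_vector_derivative)

lemma is_chartD:
  assumes "is_chart k"
  shows "open (fst k)" "open (chart_image k)" "continuous_on (fst k) (snd k)"
    "continuous_on (chart_image k) (chart_inv k)"
    "\<And>y. y \<in> fst k \<Longrightarrow> chart_inv k (snd k y) = y" "\<And>a. a \<in> chart_image k \<Longrightarrow> snd k (chart_inv k a) = a"
    "\<And>a. a \<in> chart_image k \<Longrightarrow> chart_inv k a \<in> fst k" "\<And>y. y \<in> fst k \<Longrightarrow> snd k y \<in> chart_image k"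
  using assms unfolding is_chart_def homeomorphism_def by auto

definition "transition k d = snd d \<circ> chart_inv k"
definition "Dtransition k d a = frechet_derivative (transition k d) (at a)"

definition coord_velocity ::
  "('m, 'e::euclidean_space) chart \<Rightarrow> (real \<Rightarrow> 'm) \<Rightarrow> real \<Rightarrow> 'e" where
  "coord_velocity k c t = vector_derivative (\<lambda>s. snd k (c s)) (at t)"

locale rmanifold =
  fixes M :: "('m::{t2_space, second_countable_topology}, 'e::euclidean_space) riemannian"
  assumes riemannian: "riemannian_manifold M"
begin

lemma smooth_manifold: "smooth_manifold M"
  using riemannian by (simp add: riemannian_manifold_def)

lemma atlas_maximal: "k \<in> atlas M \<Longrightarrow> k \<in> maximal_atlas M"
  using smooth_manifold by (auto simp: smooth_manifold_def maximal_atlas_def)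

lemma maximal_is_chart: "k \<in> maximal_atlas M \<Longrightarrow> is_chart k"
  by (simp add: maximal_atlas_def)

lemmas chartD = is_chartD[OF maximal_is_chart]

lemma chart_at: "chart_at M y \<in> atlas M" "y \<in> fst (chart_at M y)"
proof -
  have "\<exists>c. c \<in> atlas M \<and> y \<in> fst c"
    using smooth_manifold unfolding smooth_manifold_def by (metis UNIV_I UN_E)
  from someI_ex[OF this] show "chart_at M y \<in> atlas M" "y \<in> fst (chart_at M y)"
    by (auto simp: chart_at_def)
qed

lemma chart_at_maximal: "chart_at M y \<in> maximal_atlas M"
  by (rule atlas_maximal[OF chart_at(1)])

text \<open>The definition of \<open>maximal_atlas\<close> directly gives smooth transitions only to
  and from charts of \<open>atlas\<close>, so one of the two charts is required to lie
  there.\<close>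

definition "overlapping k d \<longleftrightarrow>
  k \<in> maximal_atlas M \<and> d \<in> maximal_atlas M \<and> (k \<in> atlas M \<or> d \<in> atlas M)"

lemma overlapping_sym: "overlapping k d \<Longrightarrow> overlapping d k"
  by (auto simp: overlapping_def)

lemma overlapping_atlas: "k \<in> maximal_atlas M \<Longrightarrow> d \<in> atlas M \<Longrightarrow> overlapping k d"
  by (auto simp: overlapping_def atlas_maximal)

lemma transition_smooth: "overlapping k d \<Longrightarrow> smooth_on (snd k ` (fst k \<inter> fst d)) (transition k d)"
  by (auto simp: overlapping_def maximal_atlas_def compatible_charts_def transition_def Int_commute)

lemma open_overlap:
  assumes "overlapping k d" shows "open (snd k ` (fst k \<inter> fst d))"
proof -
  have k: "k \<in> maximal_atlas M" and d: "d \<in> maximal_atlas M" using assms by (auto simp: overlapping_def)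
  have "snd k ` (fst k \<inter> fst d) = chart_image k \<inter> chart_inv k -` fst d"
    using chartD(5-8)[OF k] by (force simp: image_iff)
  then show ?thesis
    using continuous_open_preimage[OF chartD(4)[OF k] chartD(2)[OF k] chartD(1)[OF d]] by simp
qed

lemma transition_has_derivative:
  assumes "overlapping k d" "y \<in> fst k" "y \<in> fst d"
  shows "(transition k d has_derivative Dtransition k d (snd k y)) (at (snd k y))"
  unfolding Dtransition_def using smooth_on_has_derivative[OF transition_smooth[OF assms(1)]] assms by blast

lemma transition_apply: "k \<in> maximal_atlas M \<Longrightarrow> y \<in> fst k \<Longrightarrow> transition k d (snd k y) = snd d y"
  by (simp add: transition_def chartD)

lemma Dtransition_linear: "overlapping k d \<Longrightarrow> y \<in> fst k \<Longrightarrow> y \<in> fst d \<Longrightarrow> linear (Dtransition k d (snd k y))"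
  by (rule has_derivative_linear[OF transition_has_derivative])

lemma Dtransition_compose:
  assumes o: "overlapping k d" "overlapping d j" "overlapping k j"
    and y: "y \<in> fst k" "y \<in> fst d" "y \<in> fst j"
  shows "Dtransition d j (snd d y) (Dtransition k d (snd k y) h) = Dtransition k j (snd k y) h"
proof -
  have k: "k \<in> maximal_atlas M" and d: "d \<in> maximal_atlas M" using o by (auto simp: overlapping_def)
  have "(transition d j has_derivative Dtransition d j (snd d y)) (at (transition k d (snd k y)))"
    unfolding transition_apply[OF k y(1)] by (rule transition_has_derivative[OF o(2) y(2,3)])
  from has_derivative_compose[OF transition_has_derivative[OF o(1) y(1,2)] this]
  have "((\<lambda>a. transition d j (transition k d a)) has_derivative (\<lambda>h. Dtransition d j (snd d y) (Dtransition k d (snd k y) h))) (at (snd k y))" .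
  then have "(transition k j has_derivative (\<lambda>h. Dtransition d j (snd d y) (Dtransition k d (snd k y) h))) (at (snd k y))"
  proof (rule has_derivative_transform_within_open[OF _ open_overlap[OF o(1)]])
    show "snd k y \<in> snd k ` (fst k \<inter> fst d)" using y by auto
    show "transition d j (transition k d a) = transition k j a" if "a \<in> snd k ` (fst k \<inter> fst d)" for a
      using that k d by (auto simp: transition_def chartD)
  qed
  from has_derivative_unique[OF this transition_has_derivative[OF o(3) y(1,3)]] show ?thesis by metis
qed

lemma Dtransition_inverse:
  assumes o: "overlapping k d" and y: "y \<in> fst k" "y \<in> fst d"
  shows "Dtransition d k (snd d y) (Dtransition k d (snd k y) h) = h"
proof -
  have k: "k \<in> maximal_atlas M" and d: "d \<in> maximal_atlas M" using o by (auto simp: overlapping_def)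
  have "(transition d k has_derivative Dtransition d k (snd d y)) (at (transition k d (snd k y)))"
    unfolding transition_apply[OF k y(1)] by (rule transition_has_derivative[OF overlapping_sym[OF o] y(2,1)])
  from has_derivative_compose[OF transition_has_derivative[OF o y] this]
  have "((\<lambda>a. transition d k (transition k d a)) has_derivative (\<lambda>h. Dtransition d k (snd d y) (Dtransition k d (snd k y) h))) (at (snd k y))" .
  then have "((\<lambda>a. a) has_derivative (\<lambda>h. Dtransition d k (snd d y) (Dtransition k d (snd k y) h))) (at (snd k y))"
  proof (rule has_derivative_transform_within_open[OF _ open_overlap[OF o]])
    show "snd k y \<in> snd k ` (fst k \<inter> fst d)" using y by auto
    show "transition d k (transition k d a) = a" if "a \<in> snd k ` (fst k \<inter> fst d)" for a
      using that k d by (auto simp: transition_def chartD)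
  qed
  from has_derivative_unique[OF this has_derivative_ident] show ?thesis by metis
qed

text \<open>A change of charts on positions together with velocities. Strict derivatives of the
  geodesic flow are carried from one chart to the next by composition with it.\<close>

lemma C1_tangent_transition:
  assumes o: "overlapping k d"
  shows "\<exists>\<Psi>'. C1_on ((snd k ` (fst k \<inter> fst d)) \<times> UNIV) (\<lambda>x. (transition k d (fst x), Dtransition k d (fst x) (snd x))) \<Psi>'"
proof -
  define S where "S = snd k ` (fst k \<inter> fst d)"
  have S: "open S" unfolding S_def by (rule open_overlap[OF o])
  have sm: "smooth_on S (transition k d)" unfolding S_def by (rule transition_smooth[OF o])
  have d1: "(transition k d has_derivative Dtransition k d a) (at a)" if "a \<in> S" for a
    unfolding Dtransition_def by (rule smooth_on_has_derivative[OF sm that])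
  have sm1: "smooth_on S (\<lambda>a. Dtransition k d a u)" for u
    unfolding Dtransition_def by (rule smooth_on_frechet_derivative[OF sm])
  define D2 where "D2 a h u = frechet_derivative (\<lambda>a. Dtransition k d a u) (at a) h" for a h u
  have d2: "((\<lambda>a. Dtransition k d a u) has_derivative (\<lambda>h. D2 a h u)) (at a)" if "a \<in> S" for a u
    using smooth_on_has_derivative[OF sm1 that] by (simp add: D2_def[abs_def])
  have c2: "continuous_on S (\<lambda>a. D2 a h u)" for h u
    unfolding D2_def by (rule smooth_on_continuous_on[OF smooth_on_frechet_derivative[OF sm1]])
  have lin1: "linear (Dtransition k d a)" if "a \<in> S" for a by (rule has_derivative_linear[OF d1[OF that]])
  have lin2: "linear (D2 a h)" if "a \<in> S" for a h
    by (rule linear_family_has_derivative(2)[OF S lin1 d2[OF that] that])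
  have "C1_on (S \<times> UNIV) (\<lambda>x. (transition k d (fst x), Dtransition k d (fst x) (snd x)))
      (\<lambda>x h. (Dtransition k d (fst x) (fst h), D2 (fst x) (fst h) (snd x) + Dtransition k d (fst x) (snd h)))"
    unfolding C1_on_def
  proof (intro conjI ballI allI)
    show "open (S \<times> (UNIV :: 'e set))" using S by (intro open_Times) auto
    fix x :: "'e \<times> 'e" assume "x \<in> S \<times> UNIV"
    then obtain a u where x: "x = (a, u)" and a: "a \<in> S" by auto
    have "((\<lambda>(b, u). Dtransition k d b u) has_derivative (\<lambda>(h, l). D2 a h u + Dtransition k d a l)) (at (a, u))"
      by (rule linear_family_has_derivative(1)[OF S lin1 d2[OF a] a])
    moreover have "((\<lambda>x. transition k d (fst x)) has_derivative (\<lambda>h. Dtransition k d a (fst h))) (at (a, u))"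
      by (rule has_derivative_compose[where f = fst and g = "transition k d"])
        (use d1[OF a] in \<open>auto intro: derivative_eq_intros\<close>)
    ultimately show "((\<lambda>x. (transition k d (fst x), Dtransition k d (fst x) (snd x))) has_derivative
        (\<lambda>h. (Dtransition k d (fst x) (fst h), D2 (fst x) (fst h) (snd x) + Dtransition k d (fst x) (snd h)))) (at x)"
      unfolding x by (intro has_derivative_Pair) (auto simp: case_prod_unfold)
  next
    fix h :: "'e \<times> 'e"
    have "continuous_on (S \<times> UNIV) (\<lambda>(a, u). D2 a (fst h) u)"
      by (rule linear_family_continuous_on[OF lin2 c2])
    then have "continuous_on (S \<times> UNIV) (\<lambda>x. D2 (fst x) (fst h) (snd x))" by (simp add: case_prod_unfold)
    moreover have "continuous_on (S \<times> UNIV) (\<lambda>x. Dtransition k d (fst x) l)" for l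
      by (rule continuous_on_compose2[OF smooth_on_continuous_on[OF sm1]]) (auto intro!: continuous_intros)
    ultimately show "continuous_on (S \<times> UNIV)
        (\<lambda>x. (Dtransition k d (fst x) (fst h), D2 (fst x) (fst h) (snd x) + Dtransition k d (fst x) (snd h)))"
      by (intro continuous_intros)
  qed
  then show ?thesis unfolding S_def by blast
qed

lemma from_chart_eq:
  "k \<in> maximal_atlas M \<Longrightarrow> y \<in> fst k \<Longrightarrow> from_chart M k (snd k y) = Dtransition k (chart_at M y) (snd k y)"
  by (simp add: from_chart_def[abs_def] Dtransition_def transition_def chartD)

lemma metric_coords_eq:
  assumes "k \<in> maximal_atlas M" "y \<in> fst k"
  shows "metric_coords M k (snd k y) u v
    = rmetric M y (Dtransition k (chart_at M y) (snd k y) u) (Dtransition k (chart_at M y) (snd k y) v)"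
  using assms by (simp add: metric_coords_def from_chart_eq chartD)

lemma metric_patch_chart:
  assumes k: "k \<in> maximal_atlas M"
  shows "metric_patch (chart_image k) (metric_coords M k)"
proof
  show "open (chart_image k)" by (rule chartD(2)[OF k])
  show "smooth_on (chart_image k) (\<lambda>a. metric_coords M k a u v)" for u v
    using riemannian k by (simp add: riemannian_manifold_def)
  fix a assume "a \<in> chart_image k"
  then obtain y where y: "y \<in> fst k" and a: "a = snd k y" by (auto simp: chart_image_def)
  define T where "T = Dtransition k (chart_at M y) (snd k y)"
  have o: "overlapping k (chart_at M y)" by (rule overlapping_atlas[OF k chart_at(1)])
  have T: "linear T" unfolding T_def by (rule Dtransition_linear[OF o y chart_at(2)])
  have eq: "metric_coords M k a u v = rmetric M y (T u) (T v)" for u v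
    by (simp add: a metric_coords_eq[OF k y] T_def)
  have bil: "bilinear (rmetric M y)" using riemannian by (simp add: riemannian_manifold_def)
  show "bilinear (metric_coords M k a)"
    unfolding bilinear_def eq using bil linear_compose[OF T]
    by (auto simp: bilinear_def o_def intro: linear_compose[OF T, unfolded o_def])
  show "metric_coords M k a u v = metric_coords M k a v u" for u v
    unfolding eq using riemannian by (simp add: riemannian_manifold_def)
  show "0 < metric_coords M k a v v" if "v \<noteq> 0" for v
  proof -
    have "T v \<noteq> 0"
      using Dtransition_inverse[OF o y chart_at(2), of v] that
        linear_0[OF Dtransition_linear[OF overlapping_sym[OF o] chart_at(2) y]] by (auto simp: T_def)
    then show ?thesis unfolding eq using riemannian by (simp add: riemannian_manifold_def)
  qed
qed

lemma metric_coords_invariant: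
  assumes o: "overlapping k d" and y: "y \<in> fst k" "y \<in> fst d"
  shows "metric_coords M d (snd d y) (Dtransition k d (snd k y) u) (Dtransition k d (snd k y) v) = metric_coords M k (snd k y) u v"
proof -
  have k: "k \<in> maximal_atlas M" and d: "d \<in> maximal_atlas M" using o by (auto simp: overlapping_def)
  have "Dtransition d (chart_at M y) (snd d y) (Dtransition k d (snd k y) h) = Dtransition k (chart_at M y) (snd k y) h" for h
    by (rule Dtransition_compose[OF o overlapping_atlas[OF d chart_at(1)] overlapping_atlas[OF k chart_at(1)] y chart_at(2)])
  then show ?thesis by (simp add: metric_coords_eq k d y)
qed

lemma coord_derivative_change:
  assumes o: "overlapping k d" and y: "c t \<in> fst k" "c t \<in> fst d"
    and cont: "continuous (at t within S) c" and t: "t \<in> S"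
    and D: "((\<lambda>s. snd k (c s)) has_vector_derivative D) (at t within S)"
  shows "((\<lambda>s. snd d (c s)) has_vector_derivative Dtransition k d (snd k (c t)) D) (at t within S)"
proof -
  have k: "k \<in> maximal_atlas M" using o by (auto simp: overlapping_def)
  have "((\<lambda>s. transition k d (snd k (c s))) has_derivative (\<lambda>x. Dtransition k d (snd k (c t)) (x *\<^sub>R D))) (at t within S)"
    by (rule has_derivative_compose[OF D[unfolded has_vector_derivative_def] transition_has_derivative[OF o y]])
  then have 1: "((\<lambda>s. transition k d (snd k (c s))) has_vector_derivative Dtransition k d (snd k (c t)) D) (at t within S)"
    by (simp add: has_vector_derivative_def linear_scale[OF Dtransition_linear[OF o y]])
  have "\<forall>\<^sub>F s in at t within S. c s \<in> fst k"
    using cont chartD(1)[OF k] y(1) by (auto simp: continuous_within tendsto_def)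
  then have ev: "\<forall>\<^sub>F s in at t within S. transition k d (snd k (c s)) = snd d (c s)"
    by eventually_elim (simp add: transition_apply[OF k])
  show ?thesis
    unfolding has_vector_derivative_def
    by (rule has_derivative_transform_eventually[OF 1[unfolded has_vector_derivative_def] ev])
      (auto simp: transition_apply[OF k y(1)] t)
qed

lemma velocity_eq:
  assumes k: "k \<in> maximal_atlas M" and y: "c t \<in> fst k" and cont: "isCont c t"
    and D: "((\<lambda>s. snd k (c s)) has_vector_derivative D) (at t)"
  shows "velocity M c t = Dtransition k (chart_at M (c t)) (snd k (c t)) D"
    "rmetric M (c t) (velocity M c t) (velocity M c t) = metric_coords M k (snd k (c t)) D D"
proof -
  have "((\<lambda>s. snd (chart_at M (c t)) (c s)) has_vector_derivative
      Dtransition k (chart_at M (c t)) (snd k (c t)) D) (at t)"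
    using coord_derivative_change[OF overlapping_atlas[OF k chart_at(1)] y chart_at(2) _ _ D] cont by simp
  then show 1: "velocity M c t = Dtransition k (chart_at M (c t)) (snd k (c t)) D"
    unfolding velocity_def by (rule vector_derivative_at)
  show "rmetric M (c t) (velocity M c t) (velocity M c t) = metric_coords M k (snd k (c t)) D D"
    by (simp add: 1 metric_coords_eq[OF k y])
qed

lemma geodesic_isCont: "geodesic M c \<Longrightarrow> isCont c t"
  by (simp add: geodesic_def continuous_on_eq_continuous_at)

lemma geodesic_open_preimage:
  assumes "geodesic M c" "k \<in> maximal_atlas M"
  shows "open {t. c t \<in> fst k}"
  using open_vimage[OF chartD(1)[OF assms(2)], of c] assms(1) by (simp add: geodesic_def vimage_def)

text \<open>The existential \<open>D\<close> of \<open>geodesic\<close> is forced to be the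
  coordinate velocity at all times spent in the chart; these form an open set, so the equation for
  \<open>D\<close> carries over.\<close>

lemma geodesic_coords:
  assumes c: "geodesic M c" and k: "k \<in> maximal_atlas M" and t: "c t \<in> fst k"
  shows "((\<lambda>s. snd k (c s)) has_vector_derivative coord_velocity k c t) (at t)"
    "(coord_velocity k c has_vector_derivative
       - christoffel (metric_coords M k) (snd k (c t)) (coord_velocity k c t) (coord_velocity k c t)) (at t)"
proof -
  obtain D where D: "\<And>t. c t \<in> fst k \<Longrightarrow> ((\<lambda>s. snd k (c s)) has_vector_derivative D t) (at t)"
    "\<And>t. c t \<in> fst k \<Longrightarrow> (D has_vector_derivative
       - christoffel (metric_coords M k) (snd k (c t)) (D t) (D t)) (at t)"
    using c k unfolding geodesic_def by metis
  have eq: "coord_velocity k c t = D t" if "c t \<in> fst k" for t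
    unfolding coord_velocity_def by (rule vector_derivative_at[OF D(1)[OF that]])
  show "((\<lambda>s. snd k (c s)) has_vector_derivative coord_velocity k c t) (at t)"
    using D(1)[OF t] by (simp add: eq[OF t])
  show "(coord_velocity k c has_vector_derivative
       - christoffel (metric_coords M k) (snd k (c t)) (coord_velocity k c t) (coord_velocity k c t)) (at t)"
    unfolding eq[OF t]
    by (rule has_vector_derivative_transform_within_open[OF D(2)[OF t] geodesic_open_preimage[OF c k]])
      (auto simp: t eq)
qed

lemma geodesicI:
  assumes "continuous_on UNIV c"
    and "\<And>k t. \<lbrakk>k \<in> maximal_atlas M; c t \<in> fst k\<rbrakk> \<Longrightarrow> ((\<lambda>s. snd k (c s)) has_vector_derivative D k t) (at t)"
    and "\<And>k t. \<lbrakk>k \<in> maximal_atlas M; c t \<in> fst k\<rbrakk> \<Longrightarrow> (D k has_vector_derivative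
       - christoffel (metric_coords M k) (snd k (c t)) (D k t) (D k t)) (at t)"
  shows "geodesic M c"
  unfolding geodesic_def using assms by blast

lemma geodesic_affine:
  assumes c: "geodesic M c"
  shows "geodesic M (\<lambda>t. c (a + b * t))"
proof (rule geodesicI[where D = "\<lambda>k t. b *\<^sub>R coord_velocity k c (a + b * t)"])
  have "continuous_on UNIV c" using c by (simp add: geodesic_def)
  then show "continuous_on UNIV (\<lambda>t. c (a + b * t))"
    by (rule continuous_on_compose2) (auto intro!: continuous_intros)
  fix k t assume k: "k \<in> maximal_atlas M" and t: "c (a + b * t) \<in> fst k"
  interpret P: metric_patch "chart_image k" "metric_coords M k" by (rule metric_patch_chart[OF k])
  have a: "snd k (c (a + b * t)) \<in> chart_image k" by (rule chartD(8)[OF k t])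
  have 1: "((\<lambda>t. a + b * t) has_vector_derivative b) (at t)"
    by (auto intro!: derivative_eq_intros simp: has_real_derivative_iff_has_vector_derivative[symmetric])
  show "((\<lambda>s. snd k (c (a + b * s))) has_vector_derivative b *\<^sub>R coord_velocity k c (a + b * t)) (at t)"
    using vector_diff_chain_at[OF 1 geodesic_coords(1)[OF c k t]] by (simp add: o_def)
  have "((\<lambda>s. coord_velocity k c (a + b * s)) has_vector_derivative b *\<^sub>R
      (- P.\<Gamma> (snd k (c (a + b * t))) (coord_velocity k c (a + b * t)) (coord_velocity k c (a + b * t)))) (at t)"
    using vector_diff_chain_at[OF 1 geodesic_coords(2)[OF c k t]] by (simp add: o_def)
  from bounded_linear.has_vector_derivative[OF bounded_linear_scaleR_right this, of b]
  show "((\<lambda>t. b *\<^sub>R coord_velocity k c (a + b * t)) has_vector_derivative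
      - P.\<Gamma> (snd k (c (a + b * t))) (b *\<^sub>R coord_velocity k c (a + b * t))
        (b *\<^sub>R coord_velocity k c (a + b * t))) (at t)"
    using P.bil_christoffel[OF a] by (simp add: bilinear_def linear_iff)
qed

lemma coord_velocity_affine:
  assumes c: "geodesic M c" and k: "k \<in> maximal_atlas M" and t: "c (a + b * t) \<in> fst k"
  shows "coord_velocity k (\<lambda>t. c (a + b * t)) t = b *\<^sub>R coord_velocity k c (a + b * t)"
proof -
  have 1: "((\<lambda>t. a + b * t) has_vector_derivative b) (at t)"
    by (auto intro!: derivative_eq_intros simp: has_real_derivative_iff_has_vector_derivative[symmetric])
  have "((\<lambda>s. snd k (c (a + b * s))) has_vector_derivative b *\<^sub>R coord_velocity k c (a + b * t)) (at t)"
    using vector_diff_chain_at[OF 1 geodesic_coords(1)[OF c k t]] by (simp add: o_def)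
  then show ?thesis unfolding coord_velocity_def by (rule vector_derivative_at)
qed

lemma velocity_coord_velocity: "velocity M c t = coord_velocity (chart_at M (c t)) c t"
  by (simp add: velocity_def coord_velocity_def)

lemma velocity_affine: "geodesic M c \<Longrightarrow> velocity M (\<lambda>t. c (a + b * t)) t = b *\<^sub>R velocity M c (a + b * t)"
  by (simp add: velocity_coord_velocity coord_velocity_affine chart_at_maximal chart_at(2))

lemma geodesic_velocity_eq:
  assumes "geodesic M c" "k \<in> maximal_atlas M" "c t \<in> fst k"
  shows "velocity M c t = Dtransition k (chart_at M (c t)) (snd k (c t)) (coord_velocity k c t)"
    "rmetric M (c t) (velocity M c t) (velocity M c t)
      = metric_coords M k (snd k (c t)) (coord_velocity k c t) (coord_velocity k c t)"
  using velocity_eq[OF assms(2,3) geodesic_isCont[OF assms(1)] geodesic_coords(1)[OF assms]] by auto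

abbreviation "phase k c t \<equiv> (snd k (c t), coord_velocity k c t)"

text \<open>The continuation condition uses the Hausdorff property: while the coordinates stay in a
  compact set, the curve stays in its image under the inverse chart, which is compact and hence
  closed, so the curve is still in the chart domain at the limit time.\<close>

lemma geodesic_partial_sol:
  assumes c: "geodesic M c" and k: "k \<in> maximal_atlas M"
  shows "partial_sol (chart_image k \<times> UNIV) (metric_patch.geo_field (metric_coords M k))
    (\<lambda>t. c t \<in> fst k) (phase k c)"
  unfolding partial_sol_def
proof (intro conjI allI impI)
  interpret P: metric_patch "chart_image k" "metric_coords M k" by (rule metric_patch_chart[OF k])
  fix t assume t: "c t \<in> fst k"
  then show "phase k c t \<in> chart_image k \<times> UNIV" by (simp add: chartD[OF k])
  show "(phase k c has_vector_derivative P.geo_field (phase k c t)) (at t)"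
    unfolding P.geo_field_def by (simp add: has_vector_derivative_Pair geodesic_coords[OF c k t])
next
  show "open {t. c t \<in> fst k}" by (rule geodesic_open_preimage[OF c k])
next
  fix s t :: real and K
  assume "compact K \<and> K \<subseteq> chart_image k \<times> UNIV \<and> s < t \<and>
    (\<forall>\<tau>\<in>{s..<t}. c \<tau> \<in> fst k \<and> phase k c \<tau> \<in> K)"
  then have K: "compact K" "K \<subseteq> chart_image k \<times> UNIV" and st: "s < t"
    and in_K: "\<And>\<tau>. \<tau> \<in> {s..<t} \<Longrightarrow> c \<tau> \<in> fst k \<and> phase k c \<tau> \<in> K" by blast+
  define C where "C = chart_inv k ` fst ` K"
  have sub: "fst ` K \<subseteq> chart_image k" using K by auto
  have "compact C"
    unfolding C_def
    by (intro compact_continuous_image continuous_on_subset[OF chartD(4)[OF k] sub] K(1)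
        continuous_on_fst continuous_on_id)
  then have "closed C" by (rule compact_imp_closed)
  then have "closed (c -` C)" using c by (auto simp: geodesic_def intro: closed_vimage)
  moreover have "{s..<t} \<subseteq> c -` C"
  proof
    fix \<tau> assume "\<tau> \<in> {s..<t}"
    from in_K[OF this] have "c \<tau> = chart_inv k (fst (phase k c \<tau>))" "phase k c \<tau> \<in> K"
      by (auto simp: chartD[OF k])
    then show "\<tau> \<in> c -` C" unfolding C_def by blast
  qed
  ultimately have "closure {s..<t} \<subseteq> c -` C" by (rule closure_minimal[rotated])
  then have "t \<in> c -` C" using st by (simp add: subset_iff)
  then have "c t \<in> C" by simp
  then show "c t \<in> fst k" using sub by (auto simp: C_def chartD[OF k])
qed

text \<open>Position and velocity agree together, and this agreement is propagated from chart to
  chart. Inside one chart it is \<open>partial_sol_tube\<close> with initial distance 0.\<close>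

lemma geodesic_unique:
  assumes c1: "geodesic M c1" and c2: "geodesic M c2"
    and eq: "c1 0 = c2 0" "velocity M c1 0 = velocity M c2 0"
  shows "c1 = c2"
proof -
  have forward: "c1 t = c2 t"
    if g: "geodesic M c1" "geodesic M c2" and eq: "c1 0 = c2 0" "velocity M c1 0 = velocity M c2 0"
      and t: "0 \<le> t" for c1 c2 :: "real \<Rightarrow> 'm" and t :: real
  proof -
    have "c1 t = c2 t \<and> velocity M c1 t = velocity M c2 t"
    proof (rule forward_induct[OF _ _ t, where P = "\<lambda>t. c1 t = c2 t \<and> velocity M c1 t = velocity M c2 t"])
      show "c1 0 = c2 0 \<and> velocity M c1 0 = velocity M c2 0" using eq by simp
      fix T :: real assume "0 \<le> T"
      define k where "k = chart_at M (c1 T)"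
      have k: "k \<in> atlas M" "k \<in> maximal_atlas M" "c1 T \<in> fst k"
        by (auto simp: k_def chart_at chart_at_maximal)
      interpret P: metric_patch "chart_image k" "metric_coords M k" by (rule metric_patch_chart[OF k(2)])
      obtain \<delta> where \<delta>: "0 < \<delta>" "\<And>t. dist t T < \<delta> \<Longrightarrow> c1 t \<in> fst k"
        using geodesic_open_preimage[OF g(1) k(2)] k(3) unfolding open_dist by blast
      have "c1 t = c2 t \<and> velocity M c1 t = velocity M c2 t"
        if st: "T - \<delta> < s" "s \<le> T" "s \<le> t" "t < T + \<delta>"
          and s: "c1 s = c2 s \<and> velocity M c1 s = velocity M c2 s" for s t
      proof -
        have in_k: "c1 \<tau> \<in> fst k" if "\<tau> \<in> {s..t}" for \<tau>
          using that st by (intro \<delta>(2)) (auto simp: dist_real_def)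
        have "overlapping k (chart_at M (c1 s))" by (rule overlapping_atlas[OF k(2) chart_at(1)])
        note inv = Dtransition_inverse[OF this in_k chart_at(2)]
        have sk: "s \<in> {s..t}" using st by simp
        have cs: "c1 s \<in> fst k" "c2 s \<in> fst k" using in_k[OF sk] s by auto
        have vs: "coord_velocity k c1 s = coord_velocity k c2 s"
          using inv[OF sk, of "coord_velocity k c1 s"] inv[OF sk, of "coord_velocity k c2 s"]
            geodesic_velocity_eq(1)[OF g(1) k(2) cs(1)] geodesic_velocity_eq(1)[OF g(2) k(2) cs(2)] s
          by simp
        obtain \<rho> E where "0 < \<rho>" and tube: "\<And>P y \<tau>. \<lbrakk>partial_sol (chart_image k \<times> UNIV) P.geo_field P y; P s;
            norm (y s - phase k c1 s) < \<rho>; \<tau> \<in> {s..t}\<rbrakk>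
            \<Longrightarrow> P \<tau> \<and> norm (y \<tau> - phase k c1 \<tau>) \<le> E * norm (y s - phase k c1 s)"
          using partial_sol_tube[OF P.C1_geo_field geodesic_partial_sol[OF g(1) k(2)] in_k st(3)] by metis
        \<comment> \<open>Besides equality of the phases, the tube keeps the second curve in the
          chart, which is not known beforehand.\<close>
        have "c2 t \<in> fst k \<and> norm (phase k c2 t - phase k c1 t) \<le> E * norm (phase k c2 s - phase k c1 s)"
          by (rule tube[OF geodesic_partial_sol[OF g(2) k(2)]]) (use cs s vs \<open>0 < \<rho>\<close> st in auto)
        then have c2t: "c2 t \<in> fst k" and ph: "phase k c2 t = phase k c1 t"
          using s vs by (auto simp: zero_prod_def)
        have c1t: "c1 t \<in> fst k" using in_k st by auto
        have "c1 t = c2 t"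
          using ph chartD(5)[OF k(2) c1t] chartD(5)[OF k(2) c2t] by (metis prod.inject)
        then show ?thesis
          using ph geodesic_velocity_eq(1)[OF g(1) k(2) c1t] geodesic_velocity_eq(1)[OF g(2) k(2) c2t] by simp
      qed
      then show "\<exists>\<delta>>0. \<forall>s t. 0 \<le> s \<longrightarrow> T - \<delta> < s \<longrightarrow> s \<le> T \<longrightarrow> s \<le> t \<longrightarrow> t < T + \<delta> \<longrightarrow>
          c1 s = c2 s \<and> velocity M c1 s = velocity M c2 s \<longrightarrow> c1 t = c2 t \<and> velocity M c1 t = velocity M c2 t"
        using \<delta>(1) by blast
    qed
    then show ?thesis by simp
  qed
  show ?thesis
  proof
    fix t :: real
    show "c1 t = c2 t"
    proof (cases "0 \<le> t")
      case True then show ?thesis by (rule forward[OF c1 c2 eq])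
    next
      case False
      \<comment> \<open>Negative times are positive times of the reversed geodesics.\<close>
      have "c1 (0 + (-1) * (- t)) = c2 (0 + (-1) * (- t))"
        by (rule forward[OF geodesic_affine[OF c1] geodesic_affine[OF c2]])
          (use eq False in \<open>auto simp: velocity_affine[OF c1, of 0 "-1", simplified] velocity_affine[OF c2, of 0 "-1", simplified]\<close>)
      then show ?thesis by simp
    qed
  qed
qed

lemma geodesic_constant_speed:
  assumes c: "geodesic M c"
  shows "tnorm M (c t) (velocity M c t) = tnorm M (c 0) (velocity M c 0)"
proof -
  have "((\<lambda>t. rmetric M (c t) (velocity M c t) (velocity M c t)) has_real_derivative 0) (at t)" for t
  proof -
    define k where "k = chart_at M (c t)"
    have k: "k \<in> maximal_atlas M" "c t \<in> fst k" by (auto simp: k_def chart_at chart_at_maximal)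
    interpret P: metric_patch "chart_image k" "metric_coords M k" by (rule metric_patch_chart[OF k(1)])
    have "((\<lambda>t. metric_coords M k (snd k (c t)) (coord_velocity k c t) (coord_velocity k c t)) has_real_derivative 0) (at t)"
      by (rule P.geodesic_speed[OF chartD(8)[OF k] geodesic_coords[OF c k]])
    then show ?thesis
      by (rule has_field_derivative_transform_within_open[OF _ geodesic_open_preimage[OF c k(1)]])
        (auto simp: k geodesic_velocity_eq(2)[OF c k(1)])
  qed
  then have "rmetric M (c t) (velocity M c t) (velocity M c t) = rmetric M (c 0) (velocity M c 0) (velocity M c 0)"
    by (rule DERIV_isconst_all[rule_format])
  then show ?thesis by (simp add: tnorm_def)
qed

end

section \<open>Geodesics of a complete manifold determined by their initial data\<close>

locale complete_rmanifold = rmanifold M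
  for M :: "('m::{t2_space, second_countable_topology}, 'e::euclidean_space) riemannian" +
  assumes complete: "geodesically_complete M"
begin

definition "geo x w = (THE c. geodesic M c \<and> c 0 = x \<and> velocity M c 0 = w)"

lemma geo: "geodesic M (geo x w)" "geo x w 0 = x" "velocity M (geo x w) 0 = w"
proof -
  have "\<exists>!c. geodesic M c \<and> c 0 = x \<and> velocity M c 0 = w"
    using complete geodesic_unique unfolding geodesically_complete_def by (metis (full_types))
  from theI'[OF this] show "geodesic M (geo x w)" "geo x w 0 = x" "velocity M (geo x w) 0 = w"
    by (auto simp: geo_def)
qed

lemma geo_eqI: "geodesic M c \<Longrightarrow> c 0 = x \<Longrightarrow> velocity M c 0 = w \<Longrightarrow> geo x w = c"
  by (rule geodesic_unique) (simp_all add: geo)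

lemma exp_map_eq: "exp_map M x w = geo x w 1"
  by (simp add: exp_map_def geo_def)

text \<open>By uniqueness, restarting a geodesic at time \<open>a\<close> with its velocity scaled
  by \<open>b\<close> only reparametrizes it; \<open>b = -1\<close> reverses it.\<close>

lemma geo_affine: "geo (geo x w a) (b *\<^sub>R velocity M (geo x w) a) t = geo x w (a + b * t)"
  using geo_eqI[OF geodesic_affine[OF geo(1)[of x w], of a b]] velocity_affine[OF geo(1)[of x w], of a b 0]
  by (auto dest: fun_cong)

lemma geo_scale: "geo x (b *\<^sub>R w) t = geo x w (b * t)"
  using geo_affine[of x w 0 b t] by (simp add: geo)

lemma geo_eq_exp_map: "geo x w t = exp_map M x (t *\<^sub>R w)"
  by (simp add: exp_map_eq geo_scale)

lemma exp_map_0: "exp_map M x 0 = x"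
  using geo_eq_exp_map[of x 0 0] by (simp add: geo)

lemma ray_eq: "ray M x u t = geo x u t"
  by (simp add: ray_def geo_eq_exp_map)

lemma geo_speed: "tnorm M (geo x w t) (velocity M (geo x w) t) = tnorm M x w"
  using geodesic_constant_speed[OF geo(1)[of x w], of t] by (simp add: geo)

end

section \<open>The exponential map does not contract lengths\<close>

lemma (in metric_patch) tendsto_G:
  assumes "(a \<longlongrightarrow> a0) F" "a0 \<in> W" "(X \<longlongrightarrow> X0) F" "(Y \<longlongrightarrow> Y0) F"
  shows "((\<lambda>t. G (a t) (X t) (Y t)) \<longlongrightarrow> G a0 X0 Y0) F"
proof -
  have "continuous_on (W \<times> UNIV \<times> UNIV) (\<lambda>x. G (fst x) (fst (snd x)) (snd (snd x)))"
    by (rule bilinear_family_continuous_on[OF bil cont_G]) (auto intro!: continuous_intros)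
  then have "isCont (\<lambda>x. G (fst x) (fst (snd x)) (snd (snd x))) (a0, X0, Y0)"
    using continuous_on_eq_continuous_at[OF open_Times[OF open_W open_Times[OF open_UNIV open_UNIV]]] assms(2)
    by blast
  from isCont_tendsto_compose[OF this tendsto_Pair[OF assms(1) tendsto_Pair[OF assms(3,4)]]]
  show ?thesis by simp
qed

text \<open>The hypotheses say that \<open>sqrt f\<close> is convex with \<open>sqrt f(t) \<sim> t sqrt c\<close> at \<open>0\<close>; adding \<open>\<delta>\<^sup>2\<close>
  keeps convexity and removes the singularity of the root at the zeros of \<open>f\<close>.\<close>

lemma rauch_real:
  fixes f g :: "real \<Rightarrow> real"
  assumes f: "\<And>t. 0 < t \<Longrightarrow> (f has_real_derivative g t) (at t)"
    and g: "\<And>t. 0 < t \<Longrightarrow> \<exists>q\<ge>0. (g has_real_derivative q) (at t) \<and> (g t)\<^sup>2 \<le> 2 * f t * q"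
    and nn: "\<And>t. 0 < t \<Longrightarrow> 0 \<le> f t"
    and lim: "((\<lambda>t. f t / t\<^sup>2) \<longlongrightarrow> c) (at_right 0)"
  shows "c \<le> f 1"
proof -
  obtain q where q: "\<And>t. 0 < t \<Longrightarrow> 0 \<le> q t" "\<And>t. 0 < t \<Longrightarrow> (g has_real_derivative q t) (at t)"
    "\<And>t. 0 < t \<Longrightarrow> (g t)\<^sup>2 \<le> 2 * f t * q t"
    using g by metis
  have f0: "(f \<longlongrightarrow> 0) (at_right 0)"
  proof -
    have "((\<lambda>t::real. f t / t\<^sup>2 * t\<^sup>2) \<longlongrightarrow> c * 0\<^sup>2) (at_right 0)"
      by (intro tendsto_intros lim)
    moreover have "\<forall>\<^sub>F t in at_right (0::real). f t / t\<^sup>2 * t\<^sup>2 = f t"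
      by (auto simp: eventually_at_filter)
    ultimately show ?thesis using tendsto_cong by force
  qed
  have est: "sqrt (f t) \<le> (1 - t) * \<delta> + t * sqrt (f 1 + \<delta>\<^sup>2)" if t: "0 < t" "t < 1" and \<delta>: "0 < \<delta>" for t \<delta>
  proof -
    define r where "r t = sqrt (f t + \<delta>\<^sup>2)" for t
    have pos: "0 < f t + \<delta>\<^sup>2" if "0 < t" for t using nn[OF that] \<delta> by (simp add: add_nonneg_pos)
    have rpos: "0 < r t" if "0 < t" for t using pos[OF that] by (simp add: r_def)
    have r2: "(r t)\<^sup>2 = f t + \<delta>\<^sup>2" if "0 < t" for t using pos[OF that] by (simp add: r_def)
    have dr: "(r has_real_derivative g t / (2 * r t)) (at t)" if "0 < t" for t
      unfolding r_def using pos[OF that]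
      by (auto intro!: derivative_eq_intros f that simp: field_simps)
    have ddr: "((\<lambda>t. g t / (2 * r t)) has_real_derivative
        (q t * (2 * r t) - g t * (2 * (g t / (2 * r t)))) / (2 * r t)\<^sup>2) (at t)" if "0 < t" for t
      using rpos[OF that] by (auto intro!: derivative_eq_intros q(2) dr that simp: power2_eq_square)
    have "convex_on {0<..} r"
    proof (rule f''_ge0_imp_convex[OF _ dr ddr])
      fix t :: real assume "t \<in> {0<..}"
      then have t: "0 < t" by simp
      have "(g t)\<^sup>2 \<le> 2 * f t * q t" by (rule q(3)[OF t])
      also have "\<dots> \<le> 2 * (r t)\<^sup>2 * q t"
        using q(1)[OF t] by (intro mult_right_mono) (auto simp: r2[OF t])
      finally have "g t * (2 * (g t / (2 * r t))) \<le> q t * (2 * r t)"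
        using rpos[OF t] by (simp add: field_simps power2_eq_square)
      then show "0 \<le> (q t * (2 * r t) - g t * (2 * (g t / (2 * r t)))) / (2 * r t)\<^sup>2" by simp
    qed auto
    \<comment> \<open>Convexity is known on the open half-line only, so the chord starts at
      \<epsilon> and the limit at 0 is taken afterwards. The weight expresses \<open>t\<close> as a
      convex combination of \<epsilon> and 1.\<close>
    have chord: "r t \<le> (1 - (t - \<epsilon>) / (1 - \<epsilon>)) * r \<epsilon> + (t - \<epsilon>) / (1 - \<epsilon>) * r 1" if e: "0 < \<epsilon>" "\<epsilon> < t" for \<epsilon>
    proof -
      define l where "l = (t - \<epsilon>) / (1 - \<epsilon>)"
      have l: "0 \<le> l" "l \<le> 1" using e t by (auto simp: l_def)
      have "(1 - l) *\<^sub>R \<epsilon> + l *\<^sub>R 1 = t"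
      proof -
        have "l * (1 - \<epsilon>) = t - \<epsilon>" using e t by (simp add: l_def)
        then show ?thesis by (simp add: algebra_simps)
      qed
      then show ?thesis
        using convex_onD[OF \<open>convex_on {0<..} r\<close> l, of \<epsilon> 1] e by (simp add: l_def)
    qed
    have "((\<lambda>\<epsilon>. (1 - (t - \<epsilon>) / (1 - \<epsilon>)) * r \<epsilon> + (t - \<epsilon>) / (1 - \<epsilon>) * r 1) \<longlongrightarrow>
        (1 - (t - 0) / (1 - 0)) * sqrt (0 + \<delta>\<^sup>2) + (t - 0) / (1 - 0) * r 1) (at_right 0)"
      unfolding r_def by (intro tendsto_intros f0) simp_all
    moreover have "\<forall>\<^sub>F \<epsilon> in at_right 0. r t \<le> (1 - (t - \<epsilon>) / (1 - \<epsilon>)) * r \<epsilon> + (t - \<epsilon>) / (1 - \<epsilon>) * r 1"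
      using chord t by (auto simp: eventually_at_right_field)
    ultimately have "r t \<le> (1 - (t - 0) / (1 - 0)) * sqrt (0 + \<delta>\<^sup>2) + (t - 0) / (1 - 0) * r 1"
      by (intro tendsto_lowerbound) auto
    then have "r t \<le> (1 - t) * \<delta> + t * sqrt (f 1 + \<delta>\<^sup>2)" using \<delta> by (simp add: r_def)
    moreover have "sqrt (f t) \<le> r t" by (simp add: r_def)
    ultimately show ?thesis by (rule order_trans[rotated])
  qed
  have "sqrt (f t) \<le> t * sqrt (f 1)" if t: "0 < t" "t < 1" for t
  proof -
    have "((\<lambda>\<delta>. (1 - t) * \<delta> + t * sqrt (f 1 + \<delta>\<^sup>2)) \<longlongrightarrow> (1 - t) * 0 + t * sqrt (f 1 + 0\<^sup>2)) (at_right 0)"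
      by (intro tendsto_intros)
    moreover have "\<forall>\<^sub>F \<delta> in at_right 0. sqrt (f t) \<le> (1 - t) * \<delta> + t * sqrt (f 1 + \<delta>\<^sup>2)"
      using est[OF t] by (auto simp: eventually_at_filter)
    ultimately have "sqrt (f t) \<le> (1 - t) * 0 + t * sqrt (f 1 + 0\<^sup>2)"
      by (intro tendsto_lowerbound) auto
    then show ?thesis by simp
  qed
  then have "f t / t\<^sup>2 \<le> f 1" if t: "0 < t" "t < 1" for t
  proof -
    have "(sqrt (f t))\<^sup>2 \<le> (t * sqrt (f 1))\<^sup>2"
      using \<open>\<And>t. 0 < t \<Longrightarrow> t < 1 \<Longrightarrow> sqrt (f t) \<le> t * sqrt (f 1)\<close>[OF t] nn[of t] t by (intro power_mono) auto
    then have "f t \<le> t\<^sup>2 * f 1" using nn[of t] nn[of 1] t by (simp add: power_mult_distrib)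
    then show ?thesis using t by (simp add: field_simps)
  qed
  \<comment> \<open>As \<open>t\<close> tends to 0 the left-hand side tends to
    \<open>c\<close>.\<close>
  then have "\<forall>\<^sub>F t in at_right 0. f t / t\<^sup>2 \<le> f 1"
    by (auto simp: eventually_at_right_field intro!: exI[of _ 1])
  then show ?thesis by (intro tendsto_upperbound[OF lim]) auto
qed

section \<open>Jacobi fields as derivatives of the geodesic flow\<close>

context complete_rmanifold
begin

lemma coord_velocity_change:
  assumes c: "geodesic M c" and o: "overlapping k d" and y: "c t \<in> fst k" "c t \<in> fst d"
  shows "Dtransition k d (snd k (c t)) (coord_velocity k c t) = coord_velocity d c t"
proof -
  have k: "k \<in> maximal_atlas M" using o by (auto simp: overlapping_def)
  have "((\<lambda>s. snd d (c s)) has_vector_derivative Dtransition k d (snd k (c t)) (coord_velocity k c t)) (at t)"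
    using coord_derivative_change[OF o y _ _ geodesic_coords(1)[OF c k y(1)]] geodesic_isCont[OF c] by simp
  then show ?thesis by (simp add: coord_velocity_def vector_derivative_at)
qed

text \<open>The parameter is the initial velocity. Position and velocity are differentiated
  together, because both are initial data for the next chart; nearby geodesics must lie in the chart
  as well for their coordinates to be meaningful.\<close>

definition "phase_strict x v t k A \<longleftrightarrow> geo x v t \<in> fst k \<and> (\<forall>\<^sub>F w in nhds v. geo x w t \<in> fst k) \<and>
  strict_deriv (\<lambda>w. phase k (geo x w) t) A v"

lemma phase_strict_change:
  assumes A: "phase_strict x v t k A" and k: "k \<in> atlas M" and d: "d \<in> atlas M" and y: "geo x v t \<in> fst d"
  shows "\<exists>B. phase_strict x v t d B"
proof -
  have o: "overlapping k d" using k d by (simp add: overlapping_atlas atlas_maximal)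
  define S where "S = snd k ` (fst k \<inter> fst d)"
  have in_k: "geo x v t \<in> fst k" and ev_k: "\<forall>\<^sub>F w in nhds v. geo x w t \<in> fst k"
    and sd: "strict_deriv (\<lambda>w. phase k (geo x w) t) A v"
    using A by (auto simp: phase_strict_def)
  have "isCont (\<lambda>w. fst (phase k (geo x w) t)) v"
    using strict_deriv_isCont[OF sd] by (rule isCont_fst)
  then have "isCont (\<lambda>w. snd k (geo x w t)) v" by simp
  moreover have "snd k (geo x v t) \<in> S" using in_k y by (auto simp: S_def)
  ultimately have "\<forall>\<^sub>F w in nhds v. snd k (geo x w t) \<in> S"
    using topological_tendstoD[OF _ open_overlap[OF o], of "\<lambda>w. snd k (geo x w t)" "snd k (geo x v t)" "at v"]
    by (auto simp: isCont_def S_def eventually_nhds_conv_at)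
  with ev_k have ev: "\<forall>\<^sub>F w in nhds v. geo x w t \<in> fst k \<and> geo x w t \<in> fst d"
  proof eventually_elim
    case (elim w)
    then obtain y where "y \<in> fst k" "y \<in> fst d" "snd k (geo x w t) = snd k y" by (auto simp: S_def)
    then have "geo x w t = y" using elim chartD(5)[OF atlas_maximal[OF k]] by metis
    then show ?case using elim \<open>y \<in> fst d\<close> by simp
  qed
  obtain \<Psi>' where \<Psi>: "C1_on (S \<times> UNIV) (\<lambda>x. (transition k d (fst x), Dtransition k d (fst x) (snd x))) \<Psi>'"
    using C1_tangent_transition[OF o] unfolding S_def by blast
  have "strict_deriv (\<lambda>x. (transition k d (fst x), Dtransition k d (fst x) (snd x))) (\<Psi>' (phase k (geo x v) t)) (phase k (geo x v) t)"
    by (rule C1_on_strict_deriv[OF \<Psi>]) (use in_k y in \<open>auto simp: S_def\<close>)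
  from strict_deriv_compose[OF sd this]
  have "strict_deriv (\<lambda>w. (transition k d (snd k (geo x w t)), Dtransition k d (snd k (geo x w t)) (coord_velocity k (geo x w) t)))
      (\<lambda>h. \<Psi>' (phase k (geo x v) t) (A h)) v" by simp
  then have "strict_deriv (\<lambda>w. phase d (geo x w) t) (\<lambda>h. \<Psi>' (phase k (geo x v) t) (A h)) v"
  proof (rule strict_deriv_cong_ev)
    show "\<forall>\<^sub>F w in nhds v. (transition k d (snd k (geo x w t)), Dtransition k d (snd k (geo x w t)) (coord_velocity k (geo x w) t))
        = phase d (geo x w) t"
      using ev
    proof eventually_elim
      case (elim w)
      then show ?case
        by (simp add: coord_velocity_change[OF geo(1) o] transition_apply[OF atlas_maximal[OF k]])
    qed
  qed
  moreover have "\<forall>\<^sub>F w in nhds v. geo x w t \<in> fst d" using ev by eventually_elim simp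
  ultimately show ?thesis using y unfolding phase_strict_def by blast
qed

lemma phase_strict_step:
  assumes k: "k \<in> maximal_atlas M" and in_k: "\<And>\<tau>. \<tau> \<in> {s..t} \<Longrightarrow> geo x v \<tau> \<in> fst k" and st: "s \<le> t"
    and A0: "phase_strict x v s k A0"
  shows "\<exists>A. \<forall>\<tau>\<in>{s..t}. phase_strict x v \<tau> k (A \<tau>) \<and> (\<forall>h. ((\<lambda>\<tau>. A \<tau> h) has_vector_derivative
    metric_patch.geo_field' (metric_coords M k) (phase k (geo x v) \<tau>) (A \<tau> h)) (at \<tau> within {s..t}))"
proof -
  interpret P: metric_patch "chart_image k" "metric_coords M k" by (rule metric_patch_chart[OF k])
  have ev: "\<forall>\<^sub>F w in nhds v. geo x w s \<in> fst k" and sd: "strict_deriv (\<lambda>w. phase k (geo x w) s) A0 v"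
    using A0 by (auto simp: phase_strict_def)
  obtain A where A: "\<forall>\<tau>\<in>{s..t}. (\<forall>\<^sub>F w in nhds v. geo x w \<tau> \<in> fst k) \<and>
    strict_deriv (\<lambda>w. phase k (geo x w) \<tau>) (A \<tau>) v \<and> (\<forall>h. ((\<lambda>\<tau>. A \<tau> h) has_vector_derivative
        P.geo_field' (phase k (geo x v) \<tau>) (A \<tau> h)) (at \<tau> within {s..t}))"
    using strict_deriv_flow[OF P.C1_geo_field geodesic_partial_sol[OF geo(1) k] in_k st ev sd] by blast
  show ?thesis by (rule exI[of _ A]) (use A in_k in \<open>auto simp: phase_strict_def\<close>)
qed

text \<open>Tangent vectors at \<open>x\<close> are coordinates in \<open>chart_at M x\<close>; in
  that chart the initial phase is \<open>(snd k x, w)\<close>, which is affine in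
  \<open>w\<close>.\<close>

lemma phase_strict_0:
  assumes k: "k = chart_at M x"
  shows "phase_strict x v 0 k (\<lambda>h. (0, h))"
proof -
  have cv: "coord_velocity k (geo x w) 0 = w" for w
    using velocity_coord_velocity[of "geo x w" 0, symmetric] by (simp only: k geo)
  have "bounded_linear (\<lambda>h. (0::'e, h))"
    by (intro bounded_linear_Pair bounded_linear_zero bounded_linear_ident)
  then have "strict_deriv (\<lambda>w. (snd k x, w)) (\<lambda>h. (0, h)) v"
    by (auto simp: strict_deriv_def intro!: exI[of _ 1] simp: zero_prod_def[symmetric])
  moreover have "x \<in> fst k" by (simp add: k chart_at)
  ultimately show ?thesis by (simp add: phase_strict_def cv geo)
qed

text \<open>The chart is existentially quantified because it has to change on the way: near each
  time the property is moved into a chart around the current point and continued there by the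
  flow.\<close>

lemma phase_strict_exists:
  assumes t: "0 \<le> t"
  shows "\<exists>k\<in>atlas M. \<exists>A. phase_strict x v t k A"
proof (rule forward_induct[OF _ _ t, where P = "\<lambda>t. \<exists>k\<in>atlas M. \<exists>A. phase_strict x v t k A"])
  show "\<exists>k\<in>atlas M. \<exists>A. phase_strict x v 0 k A" using phase_strict_0 chart_at by blast
  fix T :: real assume "0 \<le> T"
  define k where "k = chart_at M (geo x v T)"
  have k: "k \<in> atlas M" "k \<in> maximal_atlas M" "geo x v T \<in> fst k"
    by (auto simp: k_def chart_at chart_at_maximal)
  obtain \<delta> where \<delta>: "0 < \<delta>" "\<And>t. dist t T < \<delta> \<Longrightarrow> geo x v t \<in> fst k"
    using geodesic_open_preimage[OF geo(1) k(2)] k(3) unfolding open_dist by blast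
  have "\<exists>k\<in>atlas M. \<exists>A. phase_strict x v t k A"
    if st: "T - \<delta> < s" "s \<le> T" "s \<le> t" "t < T + \<delta>" and s: "\<exists>k\<in>atlas M. \<exists>A. phase_strict x v s k A" for s t
  proof -
    have in_k: "geo x v \<tau> \<in> fst k" if "\<tau> \<in> {s..t}" for \<tau>
      using that st by (intro \<delta>(2)) (auto simp: dist_real_def)
    obtain d A' where d: "d \<in> atlas M" "phase_strict x v s d A'" using s by blast
    have "geo x v s \<in> fst k" using in_k[of s] st by simp
    then obtain A0 where "phase_strict x v s k A0" using phase_strict_change[OF d(2,1) k(1)] by blast
    then obtain A where "\<forall>\<tau>\<in>{s..t}. phase_strict x v \<tau> k (A \<tau>)"
      using phase_strict_step[OF k(2) in_k st(3)] by blast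
    then show ?thesis using k(1) st(3) by fastforce
  qed
  then show "\<exists>\<delta>>0. \<forall>s t. 0 \<le> s \<longrightarrow> T - \<delta> < s \<longrightarrow> s \<le> T \<longrightarrow> s \<le> t \<longrightarrow> t < T + \<delta> \<longrightarrow>
      (\<exists>k\<in>atlas M. \<exists>A. phase_strict x v s k A) \<longrightarrow> (\<exists>k\<in>atlas M. \<exists>A. phase_strict x v t k A)"
    using \<delta>(1) by blast
qed

lemma phase_strict_chart:
  assumes "0 \<le> t" "k \<in> atlas M" "geo x v t \<in> fst k"
  shows "\<exists>A. phase_strict x v t k A"
  using phase_strict_exists[OF assms(1), of x v] phase_strict_change assms by blast

text \<open>In the chart \<open>k\<close>, the value and the coordinate derivative (not the
  covariant one) of the Jacobi field along \<open>geo x v\<close> with value 0 and derivative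
  \<open>h\<close> at time 0.\<close>

definition "jacobi k x v h t = frechet_derivative (\<lambda>w. phase k (geo x w) t) (at v) h"

lemma phase_strict_jacobi: "phase_strict x v t k A \<Longrightarrow> A h = jacobi k x v h t"
  unfolding phase_strict_def jacobi_def
  by (auto dest!: strict_deriv_has_derivative frechet_derivative_at dest: fun_cong)

lemma jacobi_phase_strict:
  assumes "0 \<le> t" "k \<in> atlas M" "geo x v t \<in> fst k"
  shows "phase_strict x v t k (\<lambda>h. jacobi k x v h t)"
proof -
  obtain A where A: "phase_strict x v t k A" using phase_strict_chart[OF assms] by blast
  then have "A = (\<lambda>h. jacobi k x v h t)" using phase_strict_jacobi[OF A] by auto
  with A show ?thesis by simp
qed

text \<open>The one-sided form includes the initial time 0, where the behaviour of the field is read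
  off.\<close>

lemma jacobi_ode_within:
  assumes k: "k \<in> atlas M" and s: "0 \<le> s" "s \<le> t" and in_k: "\<And>\<tau>. \<tau> \<in> {s..t} \<Longrightarrow> geo x v \<tau> \<in> fst k"
    and \<tau>: "\<tau> \<in> {s..t}"
  shows "(jacobi k x v h has_vector_derivative
    metric_patch.geo_field' (metric_coords M k) (phase k (geo x v) \<tau>) (jacobi k x v h \<tau>)) (at \<tau> within {s..t})"
proof -
  obtain A0 where A0: "phase_strict x v s k A0" using phase_strict_chart[OF s(1) k in_k] s by auto
  obtain A where *: "\<forall>\<tau>\<in>{s..t}. phase_strict x v \<tau> k (A \<tau>) \<and> (\<forall>h. ((\<lambda>\<tau>. A \<tau> h) has_vector_derivative
    metric_patch.geo_field' (metric_coords M k) (phase k (geo x v) \<tau>) (A \<tau> h)) (at \<tau> within {s..t}))"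
    using phase_strict_step[OF atlas_maximal[OF k] in_k s(2) A0] by blast
  then have A: "\<And>\<tau>. \<tau> \<in> {s..t} \<Longrightarrow> phase_strict x v \<tau> k (A \<tau>)"
    "\<And>\<tau> h. \<tau> \<in> {s..t} \<Longrightarrow> ((\<lambda>\<tau>. A \<tau> h) has_vector_derivative
        metric_patch.geo_field' (metric_coords M k) (phase k (geo x v) \<tau>) (A \<tau> h)) (at \<tau> within {s..t})"
    by blast+
  have eq: "jacobi k x v h \<sigma> = A \<sigma> h" if "\<sigma> \<in> {s..t}" for \<sigma>
    using phase_strict_jacobi[OF A(1)[OF that]] by simp
  show ?thesis
    unfolding eq[OF \<tau>] by (rule has_vector_derivative_transform[OF \<tau> eq A(2)[OF \<tau>]])
qed

lemma jacobi_ode: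
  assumes k: "k \<in> atlas M" and t: "0 < t" and in_k: "geo x v t \<in> fst k"
  shows "(jacobi k x v h has_vector_derivative
    metric_patch.geo_field' (metric_coords M k) (phase k (geo x v) t) (jacobi k x v h t)) (at t)"
proof -
  obtain \<delta> where \<delta>: "0 < \<delta>" "\<And>\<tau>. dist \<tau> t < \<delta> \<Longrightarrow> geo x v \<tau> \<in> fst k"
    using geodesic_open_preimage[OF geo(1) atlas_maximal[OF k]] in_k unfolding open_dist by blast
  define e where "e = min (\<delta> / 2) t"
  have e: "0 < e" "e < \<delta>" "e \<le> t" using \<delta>(1) t by (auto simp: e_def)
  have "(jacobi k x v h has_vector_derivative
    metric_patch.geo_field' (metric_coords M k) (phase k (geo x v) t) (jacobi k x v h t)) (at t within {t - e..t + e})"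
    using e by (intro jacobi_ode_within[OF k] \<delta>(2)) (auto simp: dist_real_def)
  then show ?thesis using e by (simp add: at_within_Icc_at)
qed

text \<open>Only the first component is a tangent vector; the coordinate derivative in the second
  would pick up second derivatives of the transition map.\<close>

lemma jacobi_change:
  assumes k: "k \<in> atlas M" and d: "d \<in> atlas M" and t: "0 \<le> t" and y: "geo x v t \<in> fst k" "geo x v t \<in> fst d"
  shows "fst (jacobi d x v h t) = Dtransition k d (snd k (geo x v t)) (fst (jacobi k x v h t))"
proof -
  have o: "overlapping k d" using k d by (simp add: overlapping_atlas atlas_maximal)
  have dk: "((\<lambda>w. snd k (geo x w t)) has_derivative (\<lambda>h. fst (jacobi k x v h t))) (at v)"
    and ev: "\<forall>\<^sub>F w in nhds v. geo x w t \<in> fst k"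
    using jacobi_phase_strict[OF t k y(1)] has_derivative_fst[OF strict_deriv_has_derivative]
    unfolding phase_strict_def by fastforce+
  have dd: "((\<lambda>w. snd d (geo x w t)) has_derivative (\<lambda>h. fst (jacobi d x v h t))) (at v)"
    using jacobi_phase_strict[OF t d y(2)] has_derivative_fst[OF strict_deriv_has_derivative]
    unfolding phase_strict_def by fastforce
  have "((\<lambda>w. transition k d (snd k (geo x w t))) has_derivative
      (\<lambda>h. Dtransition k d (snd k (geo x v t)) (fst (jacobi k x v h t)))) (at v)"
    by (rule has_derivative_compose[OF dk transition_has_derivative[OF o y]])
  moreover have "\<forall>\<^sub>F w in at v. transition k d (snd k (geo x w t)) = snd d (geo x w t)"
    using ev unfolding eventually_at_filter by eventually_elim (simp add: transition_apply[OF atlas_maximal[OF k]])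
  ultimately have "((\<lambda>w. snd d (geo x w t)) has_derivative
      (\<lambda>h. Dtransition k d (snd k (geo x v t)) (fst (jacobi k x v h t)))) (at v)"
    by (rule has_derivative_transform_eventually) (auto simp: transition_apply[OF atlas_maximal[OF k] y(1)])
  from has_derivative_unique[OF dd this] show ?thesis by metis
qed

end

section \<open>Growth of Jacobi fields in nonpositive curvature\<close>

locale hadamard =
  fixes M :: "('m::{t2_space, second_countable_topology}, 'e::euclidean_space) riemannian"
  assumes hadamard: "hadamard_manifold M"

sublocale hadamard \<subseteq> complete_rmanifold
  using hadamard by unfold_locales (auto simp: hadamard_manifold_def)

context hadamard
begin

lemma curvature_nonpos:
  assumes k: "k \<in> maximal_atlas M" and a: "a \<in> chart_image k"
  shows "metric_coords M k a (curvature (metric_coords M k) a u v v) u \<le> 0"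
proof -
  interpret P: metric_patch "chart_image k" "metric_coords M k" by (rule metric_patch_chart[OF k])
  show ?thesis
    using hadamard k a by (intro P.curvature_nonpos) (auto simp: hadamard_manifold_def nonpositive_curvature_def)
qed

text \<open>The squared length \<open>f\<close> of the Jacobi field satisfies
  \<open>rauch_real\<close>: convexity comes from \<open>jacobi_energy\<close>, and the limit of
  f(t)/t^2 at 0 is the squared length of \<open>h\<close>.\<close>

lemma jacobi_expanding:
  assumes k: "k \<in> atlas M" and y: "exp_map M x v \<in> fst k"
  shows "rmetric M x h h
    \<le> metric_coords M k (snd k (exp_map M x v)) (fst (jacobi k x v h 1)) (fst (jacobi k x v h 1))"
proof -
  define ch where "ch t = chart_at M (geo x v t)" for t
  define f where "f t = metric_coords M (ch t) (snd (ch t) (geo x v t)) (fst (jacobi (ch t) x v h t))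
    (fst (jacobi (ch t) x v h t))" for t
  have ch: "ch t \<in> atlas M" "geo x v t \<in> fst (ch t)" for t by (auto simp: ch_def chart_at)
  \<comment> \<open>The definition of \<open>f\<close> uses a chart that varies with
    \<open>t\<close>; invariance permits differentiation in one fixed chart around each
    time.\<close>
  have f_eq: "f t = metric_coords M d (snd d (geo x v t)) (fst (jacobi d x v h t)) (fst (jacobi d x v h t))"
    if "0 \<le> t" "d \<in> atlas M" "geo x v t \<in> fst d" for t d
    using metric_coords_invariant[OF overlapping_atlas[OF atlas_maximal[OF ch(1)[of t]] that(2)] ch(2) that(3)]
    by (simp add: f_def jacobi_change[OF ch(1) that(2,1) ch(2) that(3)])
  define g where "g = deriv f"
  have main: "(f has_real_derivative g t) (at t) \<and>
      (\<exists>q\<ge>0. (g has_real_derivative q) (at t) \<and> (g t)\<^sup>2 \<le> 2 * f t * q)" if t: "0 < t" for t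
  proof -
    define d where "d = ch t"
    have d: "d \<in> atlas M" "d \<in> maximal_atlas M" "geo x v t \<in> fst d" by (auto simp: d_def ch atlas_maximal)
    interpret P: metric_patch "chart_image d" "metric_coords M d" by (rule metric_patch_chart[OF d(2)])
    define J where "J t = fst (jacobi d x v h t)" for t
    define K where "K t = snd (jacobi d x v h t)" for t
    define S where "S = {t. geo x v t \<in> fst d} \<inter> {0<..}"
    have S: "open S" unfolding S_def
      by (intro open_Int geodesic_open_preimage[OF geo(1) d(2)] open_greaterThan)
    have tS: "t \<in> S" using t d(3) by (simp add: S_def)
    have JK: "(J has_vector_derivative K s) (at s) \<and> (K has_vector_derivative
        - (P.d\<Gamma> (snd d (geo x v s)) (J s) (coord_velocity d (geo x v) s) (coord_velocity d (geo x v) s)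
           + 2 *\<^sub>R P.\<Gamma> (snd d (geo x v s)) (coord_velocity d (geo x v) s) (K s))) (at s)" if s: "s \<in> S" for s
    proof -
      have der: "(jacobi d x v h has_vector_derivative
          P.geo_field' (phase d (geo x v) s) (jacobi d x v h s)) (at s)"
        using jacobi_ode[OF d(1)] s by (simp add: S_def)
      show ?thesis
        using has_derivative_fst[OF der[unfolded has_vector_derivative_def]]
          has_derivative_snd[OF der[unfolded has_vector_derivative_def]]
        by (simp add: has_vector_derivative_def P.geo_field'_def J_def[abs_def] K_def[abs_def])
    qed
    define f1 where "f1 t = metric_coords M d (snd d (geo x v t)) (J t) (J t)" for t
    define g1 where "g1 t = 2 * metric_coords M d (snd d (geo x v t)) (J t)
        (K t + P.\<Gamma> (snd d (geo x v t)) (coord_velocity d (geo x v) t) (J t))" for t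
    have f1: "(f1 has_real_derivative g1 s) (at s)"
      "\<exists>q\<ge>0. (g1 has_real_derivative q) (at s) \<and> (g1 s)\<^sup>2 \<le> 2 * f1 s * q" if s: "s \<in> S" for s
    proof -
      have in_d: "geo x v s \<in> fst d" using s by (simp add: S_def)
      have a: "snd d (geo x v s) \<in> chart_image d" by (rule chartD(8)[OF d(2) in_d])
      note * = P.jacobi_energy[where c = "\<lambda>t. snd d (geo x v t)", OF a curvature_nonpos[OF d(2) a]
          geodesic_coords[OF geo(1) d(2) in_d] JK[OF s, THEN conjunct1] JK[OF s, THEN conjunct2]]
      show "(f1 has_real_derivative g1 s) (at s)"
        "\<exists>q\<ge>0. (g1 has_real_derivative q) (at s) \<and> (g1 s)\<^sup>2 \<le> 2 * f1 s * q"
        using * unfolding f1_def g1_def by blast+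
    qed
    have ff: "f s = f1 s" if "s \<in> S" for s
      using that f_eq[of s d] d(1) by (simp add: S_def f1_def J_def)
    have df: "(f has_real_derivative g1 s) (at s)" if s: "s \<in> S" for s
      by (rule has_field_derivative_transform_within_open[OF f1(1)[OF s] S s]) (simp add: ff)
    have gg: "g s = g1 s" if "s \<in> S" for s
      unfolding g_def by (rule DERIV_imp_deriv[OF df[OF that]])
    have "(g has_real_derivative q) (at t)" if "(g1 has_real_derivative q) (at t)" for q
      by (rule has_field_derivative_transform_within_open[OF that S tS]) (simp add: gg)
    then show ?thesis using df[OF tS] f1(2)[OF tS] by (auto simp: gg[OF tS] ff[OF tS])
  qed
  have nn: "0 \<le> f t" for t
  proof -
    interpret P: metric_patch "chart_image (ch t)" "metric_coords M (ch t)"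
      by (rule metric_patch_chart[OF atlas_maximal[OF ch(1)]])
    show ?thesis unfolding f_def by (rule P.nonneg[OF chartD(8)[OF atlas_maximal[OF ch(1)] ch(2)]])
  qed
  have lim: "((\<lambda>t. f t / t\<^sup>2) \<longlongrightarrow> rmetric M x h h) (at_right 0)"
  proof -
    define d where "d = chart_at M x"
    have d: "d \<in> atlas M" "d \<in> maximal_atlas M" "x \<in> fst d" by (auto simp: d_def chart_at chart_at_maximal)
    interpret P: metric_patch "chart_image d" "metric_coords M d" by (rule metric_patch_chart[OF d(2)])
    obtain \<delta> where \<delta>: "0 < \<delta>" "\<And>t. dist t 0 < \<delta> \<Longrightarrow> geo x v t \<in> fst d"
    proof -
      have "0 \<in> {t. geo x v t \<in> fst d}" using d(3) by (simp add: geo)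
      then show thesis using geodesic_open_preimage[OF geo(1) d(2), of x v] that unfolding open_dist by blast
    qed
    have in_d: "geo x v t \<in> fst d" if "t \<in> {0..\<delta>/2}" for t
      using that \<delta>(1) by (intro \<delta>(2)) (auto simp: dist_real_def)
    have j0: "jacobi d x v h 0 = (0, h)"
      by (rule phase_strict_jacobi[OF phase_strict_0[OF d_def], symmetric])
    have der: "(jacobi d x v h has_vector_derivative
        P.geo_field' (phase d (geo x v) 0) (jacobi d x v h 0)) (at 0 within {0..\<delta>/2})"
      by (rule jacobi_ode_within[OF d(1)]) (use \<delta>(1) in_d in auto)
    \<comment> \<open>To first order the field is \<open>t\<close> times \<open>h\<close>: it starts
      at 0, and the first component of the linearized field at time 0 is \<open>h\<close>.\<close>
    have "((\<lambda>t. fst (jacobi d x v h t)) has_derivative (\<lambda>t. t *\<^sub>R h)) (at 0 within {0..\<delta>/2})"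
      using has_derivative_fst[OF der[unfolded has_vector_derivative_def]] by (simp add: P.geo_field'_def j0)
    then have "((\<lambda>t. (fst (jacobi d x v h t) - t *\<^sub>R h) /\<^sub>R norm t) \<longlongrightarrow> 0) (at 0 within {0..\<delta>/2})"
      by (simp add: has_derivative_within j0 inverse_eq_divide)
    moreover have "at 0 within {0..\<delta>/2} = at_right 0"
      using \<delta>(1) by (simp add: at_within_Icc_at_right)
    ultimately have "((\<lambda>t. (fst (jacobi d x v h t) - t *\<^sub>R h) /\<^sub>R norm t) \<longlongrightarrow> 0) (at_right 0)" by simp
    moreover have "\<forall>\<^sub>F t::real in at_right 0. (fst (jacobi d x v h t) - t *\<^sub>R h) /\<^sub>R norm t
        = fst (jacobi d x v h t) /\<^sub>R t - h"
      by (auto simp: eventually_at_filter scaleR_diff_right)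
    ultimately have "((\<lambda>t. fst (jacobi d x v h t) /\<^sub>R t - h) \<longlongrightarrow> 0) (at_right 0)"
      by (rule Lim_transform_eventually)
    then have J: "((\<lambda>t. fst (jacobi d x v h t) /\<^sub>R t) \<longlongrightarrow> h) (at_right 0)" by (rule LIM_zero_cancel)
    have "isCont (\<lambda>t. snd d (geo x v t)) 0"
      using has_vector_derivative_continuous[OF geodesic_coords(1)[OF geo(1) d(2)], of x v 0] d(3)
      by (simp add: geo)
    then have "((\<lambda>t. snd d (geo x v t)) \<longlongrightarrow> snd d x) (at_right 0)"
      unfolding isCont_def by (simp add: geo filterlim_at_split)
    from P.tendsto_G[OF this chartD(8)[OF d(2,3)] J J]
    have "((\<lambda>t. metric_coords M d (snd d (geo x v t)) (fst (jacobi d x v h t) /\<^sub>R t)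
        (fst (jacobi d x v h t) /\<^sub>R t)) \<longlongrightarrow> metric_coords M d (snd d x) h h) (at_right 0)" .
    moreover have "\<forall>\<^sub>F t in at_right 0. metric_coords M d (snd d (geo x v t)) (fst (jacobi d x v h t) /\<^sub>R t)
        (fst (jacobi d x v h t) /\<^sub>R t) = f t / t\<^sup>2"
      unfolding eventually_at_right_field
    proof (intro exI[of _ "\<delta> / 2"] conjI allI impI)
      fix t assume t: "0 < t" "t < \<delta> / 2"
      then have in_t: "geo x v t \<in> fst d" by (intro in_d) simp
      have a: "snd d (geo x v t) \<in> chart_image d" by (rule chartD(8)[OF d(2) in_t])
      have "metric_coords M d (snd d (geo x v t)) (fst (jacobi d x v h t) /\<^sub>R t)
          (fst (jacobi d x v h t) /\<^sub>R t) = inverse t * (inverse t * f t)"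
        using t by (simp only: linear_scale[OF P.lin(1)[OF a]] linear_scale[OF P.lin(2)[OF a]]
            real_scaleR_def f_eq[OF less_imp_le[OF t(1)] d(1) in_t])
      then show "metric_coords M d (snd d (geo x v t)) (fst (jacobi d x v h t) /\<^sub>R t)
          (fst (jacobi d x v h t) /\<^sub>R t) = f t / t\<^sup>2"
        by (simp add: power2_eq_square field_simps)
    qed (use \<delta>(1) in simp)
    ultimately have "((\<lambda>t. f t / t\<^sup>2) \<longlongrightarrow> metric_coords M d (snd d x) h h) (at_right 0)"
      by (rule Lim_transform_eventually)
    moreover have "metric_coords M d (snd d x) h h = rmetric M x h h"
    proof -
      have "coord_velocity d (geo x h) 0 = h"
        using velocity_coord_velocity[of "geo x h" 0, symmetric] by (simp only: geo d_def)
      then show ?thesis using geodesic_velocity_eq(2)[OF geo(1) d(2), of x h 0] d(3) by (simp add: geo)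
    qed
    ultimately show ?thesis by simp
  qed
  have "rmetric M x h h \<le> f 1"
    by (rule rauch_real[OF main[THEN conjunct1] main[THEN conjunct2] nn lim])
  then show ?thesis using f_eq[of 1 k] k y by (simp add: exp_map_eq)
qed

lemma exp_map_strict_deriv:
  assumes k: "k \<in> atlas M" and y: "exp_map M x v \<in> fst k"
  obtains A where "strict_deriv (\<lambda>w. snd k (exp_map M x w)) A v"
    "\<And>h. rmetric M x h h \<le> metric_coords M k (snd k (exp_map M x v)) (A h) (A h)"
    "\<forall>\<^sub>F w in nhds v. exp_map M x w \<in> fst k"
proof -
  have ps: "phase_strict x v 1 k (\<lambda>h. jacobi k x v h 1)"
    using jacobi_phase_strict[OF _ k] y by (simp add: exp_map_eq)
  have "strict_deriv (\<lambda>w. fst (phase k (geo x w) 1)) (\<lambda>h. fst (jacobi k x v h 1)) v"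
    using strict_deriv_compose[OF _ strict_deriv_linear[OF bounded_linear_fst]] ps
    unfolding phase_strict_def by blast
  then show thesis
    using that[of "\<lambda>h. fst (jacobi k x v h 1)"] jacobi_expanding[OF k y] ps
    by (simp add: exp_map_eq phase_strict_def)
qed

end

section \<open>Lifting along local homeomorphisms\<close>

text \<open>The tube lemma: finitely many product boxes cover the compact slice over
  \<open>p\<close>, and the intersection of their first factors is a neighbourhood of
  \<open>p\<close>.\<close>

lemma eventually_compact_tube:
  fixes h :: "'p::topological_space \<Rightarrow> 'k::topological_space \<Rightarrow> 'm::topological_space"
  assumes K: "compact K" and p: "p \<in> P" and cont: "continuous_on (P \<times> K) (\<lambda>(q, t). h q t)"
    and V: "open V" and sub: "\<And>t. t \<in> K \<Longrightarrow> h p t \<in> V"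
  shows "\<forall>\<^sub>F q in at p within P. \<forall>t\<in>K. h q t \<in> V"
proof -
  have "\<exists>A. open A \<and> A \<inter> (P \<times> K) = (\<lambda>(q, t). h q t) -` V \<inter> (P \<times> K)"
    using cont V unfolding continuous_on_open_invariant by iprover
  then obtain O' where "open O' \<and> O' \<inter> (P \<times> K) = (\<lambda>(q, t). h q t) -` V \<inter> (P \<times> K)" ..
  then have O': "open O'" "O' \<inter> (P \<times> K) = (\<lambda>(q, t). h q t) -` V \<inter> (P \<times> K)" by auto
  have "\<exists>A B. open A \<and> open B \<and> p \<in> A \<and> t \<in> B \<and> A \<times> B \<subseteq> O'" if t: "t \<in> K" for t
  proof -
    have "(p, t) \<in> O'" using O'(2) sub[OF t] t p by auto
    with O'(1) obtain A B where "open A" "open B" "(p, t) \<in> A \<times> B" "A \<times> B \<subseteq> O'" by (rule open_prod_elim)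
    then show ?thesis by blast
  qed
  then obtain A B where AB: "\<And>t. t \<in> K \<Longrightarrow> open (A t) \<and> open (B t) \<and> p \<in> A t \<and> t \<in> B t \<and> A t \<times> B t \<subseteq> O'"
    by metis
  obtain C where C: "C \<subseteq> K" "finite C" "K \<subseteq> (\<Union>t\<in>C. B t)"
    by (rule compactE_image[OF K, of K B]) (use AB in blast)+
  have "open (\<Inter>t\<in>C. A t)" "p \<in> (\<Inter>t\<in>C. A t)" using C AB by (auto intro!: open_INT)
  then have "\<forall>\<^sub>F q in at p within P. q \<in> (\<Inter>t\<in>C. A t) \<and> q \<in> P"
    unfolding eventually_at_topological by blast
  then show ?thesis
  proof eventually_elim
    case (elim q)
    show ?case
    proof
      fix t assume t: "t \<in> K"
      then obtain s where s: "s \<in> C" "t \<in> B s" using C by blast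
      then have "(q, t) \<in> O'" using AB[of s] C elim by blast
      then show "h q t \<in> V" using O'(2) elim t by auto
    qed
  qed
qed

text \<open>The properties are stated in the form in which invariance of domain yields them; local
  inverses are derived from them.\<close>

locale local_homeo =
  fixes e :: "'a::real_normed_vector \<Rightarrow> 'm::t2_space"
  assumes cont_e: "continuous_on UNIV e"
    and open_map_e: "open U \<Longrightarrow> open (e ` U)"
    and locally_inj_e: "\<exists>U. open U \<and> v \<in> U \<and> inj_on e U"
begin

text \<open>The set of agreement is closed by continuity and open by local injectivity.\<close>

lemma lift_unique:
  fixes g1 g2 :: "'t::topological_space \<Rightarrow> 'a"
  assumes S: "connected S" and g1: "continuous_on S g1" and g2: "continuous_on S g2"
    and eq: "\<And>t. t \<in> S \<Longrightarrow> e (g1 t) = e (g2 t)" and s: "s \<in> S" "g1 s = g2 s" and t: "t \<in> S"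
  shows "g1 t = g2 t"
proof -
  let ?T = "{t \<in> S. g1 t - g2 t = 0}"
  have "closedin (top_of_set S) ?T"
    by (intro continuous_closedin_preimage_constant continuous_intros g1 g2)
  moreover have "openin (top_of_set S) ?T"
  proof (subst openin_subopen, intro ballI)
    fix t assume "t \<in> ?T"
    then have t: "t \<in> S" "g1 t = g2 t" by auto
    obtain U where U: "open U" "g1 t \<in> U" "inj_on e U" using locally_inj_e by metis
    have "openin (top_of_set S) (S \<inter> g1 -` U)" "openin (top_of_set S) (S \<inter> g2 -` U)"
      using continuous_openin_preimage_gen g1 g2 U(1) by blast+
    then have "openin (top_of_set S) ((S \<inter> g1 -` U) \<inter> (S \<inter> g2 -` U))" by (rule openin_Int)
    moreover have "(S \<inter> g1 -` U) \<inter> (S \<inter> g2 -` U) \<subseteq> ?T"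
      using eq U(3) by (auto dest: inj_onD)
    ultimately show "\<exists>T. openin (top_of_set S) T \<and> t \<in> T \<and> T \<subseteq> ?T"
      using t U(2) by (intro exI[of _ "(S \<inter> g1 -` U) \<inter> (S \<inter> g2 -` U)"]) auto
  qed
  ultimately have "?T = {} \<or> ?T = S" using S unfolding connected_clopen by blast
  then show ?thesis using s t by auto
qed

lemma local_inverse:
  assumes U: "open U" "inj_on e U"
  shows "continuous_on (e ` U) (inv_into U e)"
proof (rule continuous_on_inverse_open_map[OF _ refl])
  show "continuous_on U e" using cont_e continuous_on_subset by blast
  show "inv_into U e (e x) = x" if "x \<in> U" for x using U(2) that by simp
  fix V assume "openin (top_of_set U) V"
  then have "open V" "V \<subseteq> U" using U(1) by (auto simp: openin_open_eq)
  then show "openin (top_of_set (e ` U)) (e ` V)"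
    using open_map_e U(1) by (simp add: openin_open_eq image_mono)
qed

text \<open>Continuity in the parameter at \<open>p\<close> is propagated in time. Over a short
  interval the lift at \<open>p\<close> stays in a set \<open>U\<close> on which \<open>e\<close> is
  injective; for \<open>q\<close> near \<open>p\<close>, uniqueness identifies the lift with the
  inverse of \<open>e\<close> on \<open>U\<close> applied to \<open>h q\<close>, which depends
  continuously on \<open>q\<close>.\<close>

lemma lift_depends_continuously:
  fixes h :: "'p::topological_space \<Rightarrow> real \<Rightarrow> 'm"
  assumes cont_h: "continuous_on (P \<times> {0..1}) (\<lambda>(q, t). h q t)"
    and g: "\<And>q. q \<in> P \<Longrightarrow> continuous_on {0..1} (g q)"
    and lift: "\<And>q t. q \<in> P \<Longrightarrow> t \<in> {0..1} \<Longrightarrow> e (g q t) = h q t"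
    and g0: "continuous_on P (\<lambda>q. g q 0)"
  shows "continuous_on P (\<lambda>q. g q 1)"
proof -
  have "1 \<le> (1::real) \<longrightarrow> ((\<lambda>q. g q 1) \<longlongrightarrow> g p 1) (at p within P)" if p: "p \<in> P" for p
  proof (rule forward_induct[where P = "\<lambda>t. t \<le> 1 \<longrightarrow> ((\<lambda>q. g q t) \<longlongrightarrow> g p t) (at p within P)"])
    show "0 \<le> (1::real) \<longrightarrow> ((\<lambda>q. g q 0) \<longlongrightarrow> g p 0) (at p within P)"
      using g0 p by (simp add: continuous_on_def)
    show "0 \<le> (1::real)" by simp
    fix T :: real assume T: "0 \<le> T"
    show "\<exists>\<delta>>0. \<forall>s t. 0 \<le> s \<longrightarrow> T - \<delta> < s \<longrightarrow> s \<le> T \<longrightarrow> s \<le> t \<longrightarrow> t < T + \<delta> \<longrightarrow>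
        (s \<le> 1 \<longrightarrow> ((\<lambda>q. g q s) \<longlongrightarrow> g p s) (at p within P)) \<longrightarrow>
        (t \<le> 1 \<longrightarrow> ((\<lambda>q. g q t) \<longlongrightarrow> g p t) (at p within P))"
    proof (cases "T \<le> 1")
      case False
      \<comment> \<open>With this radius every admissible time exceeds 1, where nothing is
        claimed.\<close>
      then show ?thesis by (intro exI[of _ "T - 1"]) auto
    next
      case T1: True
      obtain U where U: "open U" "g p T \<in> U" "inj_on e U" using locally_inj_e by metis
      have "\<forall>\<^sub>F t in at T within {0..1}. g p t \<in> U"
        using g[OF p] T T1 U by (auto simp: continuous_on_def dest: topological_tendstoD)
      then obtain \<delta> where \<delta>: "0 < \<delta>" "\<And>t. \<lbrakk>t \<in> {0..1}; dist t T < \<delta>\<rbrakk> \<Longrightarrow> g p t \<in> U"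
        using U(2) unfolding eventually_at by (metis dist_self dist_nz)
      have "((\<lambda>q. g q t) \<longlongrightarrow> g p t) (at p within P)"
        if st: "0 \<le> s" "T - \<delta> < s" "s \<le> T" "s \<le> t" "t < T + \<delta>" "t \<le> 1"
          and IH: "((\<lambda>q. g q s) \<longlongrightarrow> g p s) (at p within P)" for s t
      proof -
        have in_U: "g p r \<in> U" if "r \<in> {s..t}" for r
          using that st by (intro \<delta>(2)) (auto simp: dist_real_def)
        have in_V: "h p r \<in> e ` U" if "r \<in> {s..t}" for r
          using in_U[OF that] lift[OF p, of r] that st by (metis atLeastAtMost_iff image_eqI order_trans)
        have V: "open (e ` U)" by (rule open_map_e[OF U(1)])
        have "continuous_on (P \<times> {s..t}) (\<lambda>(q, t). h q t)"
          by (rule continuous_on_subset[OF cont_h]) (use st in auto)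
        from eventually_compact_tube[OF compact_Icc p this V in_V]
        have "\<forall>\<^sub>F q in at p within P. \<forall>r\<in>{s..t}. h q r \<in> e ` U" .
        moreover have "\<forall>\<^sub>F q in at p within P. g q s \<in> U"
          using topological_tendstoD[OF IH U(1)] in_U[of s] st by simp
        moreover have "\<forall>\<^sub>F q in at p within P. q \<in> P" by (auto simp: eventually_at_topological)
        ultimately have ev: "\<forall>\<^sub>F q in at p within P. inv_into U e (h q t) = g q t"
        proof eventually_elim
          case (elim q)
          have "inv_into U e (h q t) = g q t"
          proof (rule lift_unique[where S = "{s..t}" and s = s])
            show "continuous_on {s..t} (\<lambda>r. inv_into U e (h q r))"
            proof (rule continuous_on_compose2[OF local_inverse[OF U(1,3)]])
              have "continuous_on {s..t} (\<lambda>r. (\<lambda>(q, t). h q t) (q, r))"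
                by (rule continuous_on_compose2[OF cont_h]) (use elim st in \<open>auto intro!: continuous_intros\<close>)
              then show "continuous_on {s..t} (h q)" by simp
            qed (use elim in auto)
            show "continuous_on {s..t} (g q)"
              by (rule continuous_on_subset[OF g]) (use elim st in auto)
            show "e (inv_into U e (h q r)) = e (g q r)" if "r \<in> {s..t}" for r
              using elim that st lift[of q r] by (auto simp: f_inv_into_f)
            show "inv_into U e (h q s) = g q s"
              using elim st lift[of q s] U(3) by (metis atLeastAtMost_iff inv_into_f_f order_trans)
          qed (use st in auto)
          then show ?case .
        qed
        have t01: "t \<in> {0..1}" using st by auto
        have "((\<lambda>q. (\<lambda>(q, t). h q t) (q, t)) \<longlongrightarrow> (\<lambda>(q, t). h q t) (p, t)) (at p within P)"
        proof -
          have "continuous_on P (\<lambda>q. (\<lambda>(q, t). h q t) (q, t))"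
            by (rule continuous_on_compose2[OF cont_h]) (use t01 in \<open>auto intro!: continuous_intros\<close>)
          then show ?thesis using p by (simp add: continuous_on_def)
        qed
        then have ht: "((\<lambda>q. h q t) \<longlongrightarrow> h p t) (at p within P)" by simp
        have "isCont (inv_into U e) (h p t)"
          using continuous_on_eq_continuous_at[OF V, THEN iffD1, OF local_inverse[OF U(1,3)]] in_V[of t] st
          by (meson atLeastAtMost_iff order_refl)
        from isCont_tendsto_compose[OF this ht]
        have "((\<lambda>q. inv_into U e (h q t)) \<longlongrightarrow> inv_into U e (h p t)) (at p within P)" .
        moreover have "inv_into U e (h p t) = g p t"
          using lift[OF p t01] in_U[of t] st U(3) by (metis atLeastAtMost_iff inv_into_f_f order_refl)
        ultimately show ?thesis using Lim_transform_eventually[OF _ ev] by simp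
      qed
      then show ?thesis using \<delta>(1) by (intro exI[of _ \<delta>]) auto
    qed
  qed
  then show ?thesis by (simp add: continuous_on_def)
qed

end

text \<open>Even covering in terms of sections: one neighbourhood \<open>N\<close> of
  \<open>y\<close> serves all points of the fibres over \<open>N\<close>. This uniformity is what
  allows path lifts to be continued.\<close>

locale evenly_covered = local_homeo e for e :: "'a::real_normed_vector \<Rightarrow> 'm::t2_space" +
  assumes section_exists: "\<exists>N. open N \<and> y \<in> N \<and>
    (\<forall>v. e v \<in> N \<longrightarrow> (\<exists>\<sigma>. continuous_on N \<sigma> \<and> \<sigma> (e v) = v \<and> (\<forall>z\<in>N. e (\<sigma> z) = z)))"
begin

text \<open>Near time \<open>T\<close> the path lies in a neighbourhood \<open>N\<close> that has a
  section through whatever point the lift has reached at \<open>s\<close>, so the lift can be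
  carried past \<open>T\<close> without examining its limit.\<close>

lemma path_lift:
  assumes \<alpha>: "continuous_on {0..1} \<alpha>" and v: "e v = \<alpha> 0"
  shows "\<exists>g. continuous_on {0..1::real} g \<and> g 0 = v \<and> (\<forall>t\<in>{0..1}. e (g t) = \<alpha> t)"
proof -
  have "(1::real) \<le> 1 \<longrightarrow> (\<exists>g. continuous_on {0..1} g \<and> g 0 = v \<and> (\<forall>r\<in>{0..1}. e (g r) = \<alpha> r))"
  proof (rule forward_induct[where P = "\<lambda>t. t \<le> 1 \<longrightarrow>
      (\<exists>g. continuous_on {0..t} g \<and> g 0 = v \<and> (\<forall>r\<in>{0..t}. e (g r) = \<alpha> r))"])
    show "0 \<le> (1::real) \<longrightarrow> (\<exists>g. continuous_on {0..0} g \<and> g 0 = v \<and> (\<forall>r\<in>{0..0::real}. e (g r) = \<alpha> r))"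
      using v by (auto intro!: exI[of _ "\<lambda>_. v"])
    show "0 \<le> (1::real)" by simp
    fix T :: real assume T: "0 \<le> T"
    show "\<exists>\<delta>>0. \<forall>s t. 0 \<le> s \<longrightarrow> T - \<delta> < s \<longrightarrow> s \<le> T \<longrightarrow> s \<le> t \<longrightarrow> t < T + \<delta> \<longrightarrow>
        (s \<le> 1 \<longrightarrow> (\<exists>g. continuous_on {0..s} g \<and> g 0 = v \<and> (\<forall>r\<in>{0..s}. e (g r) = \<alpha> r))) \<longrightarrow>
        (t \<le> 1 \<longrightarrow> (\<exists>g. continuous_on {0..t} g \<and> g 0 = v \<and> (\<forall>r\<in>{0..t}. e (g r) = \<alpha> r)))"
    proof (cases "T \<le> 1")
      case False
      then show ?thesis by (intro exI[of _ "T - 1"]) auto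
    next
      case T1: True
      obtain N where N: "open N" "\<alpha> T \<in> N" and sec: "\<And>v. e v \<in> N \<Longrightarrow>
          \<exists>\<sigma>. continuous_on N \<sigma> \<and> \<sigma> (e v) = v \<and> (\<forall>z\<in>N. e (\<sigma> z) = z)"
        using section_exists by metis
      have "\<forall>\<^sub>F t in at T within {0..1}. \<alpha> t \<in> N"
        using \<alpha> T T1 N by (auto simp: continuous_on_def dest: topological_tendstoD)
      then obtain \<delta> where \<delta>: "0 < \<delta>" "\<And>t. \<lbrakk>t \<in> {0..1}; dist t T < \<delta>\<rbrakk> \<Longrightarrow> \<alpha> t \<in> N"
        using N(2) unfolding eventually_at by (metis dist_self dist_nz)
      have "\<exists>g. continuous_on {0..t} g \<and> g 0 = v \<and> (\<forall>r\<in>{0..t}. e (g r) = \<alpha> r)"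
        if st: "0 \<le> s" "T - \<delta> < s" "s \<le> T" "s \<le> t" "t < T + \<delta>" "t \<le> 1"
          and IH: "\<exists>g. continuous_on {0..s} g \<and> g 0 = v \<and> (\<forall>r\<in>{0..s}. e (g r) = \<alpha> r)" for s t
      proof -
        obtain g where g: "continuous_on {0..s} g" "g 0 = v" "\<And>r. r \<in> {0..s} \<Longrightarrow> e (g r) = \<alpha> r"
          using IH by blast
        have in_N: "\<alpha> r \<in> N" if "r \<in> {s..t}" for r
          using that st by (intro \<delta>(2)) (auto simp: dist_real_def)
        have gs: "e (g s) = \<alpha> s" using g(3) st by simp
        have "e (g s) \<in> N" using gs in_N st by simp
        then obtain \<sigma> where \<sigma>: "continuous_on N \<sigma>" "\<sigma> (e (g s)) = g s" "\<And>z. z \<in> N \<Longrightarrow> e (\<sigma> z) = z"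
          using sec by blast
        have "continuous_on ({0..s} \<union> {s..t}) (\<lambda>r. if r \<le> s then g r else \<sigma> (\<alpha> r))"
        proof (rule continuous_on_cases)
          show "continuous_on {s..t} (\<lambda>r. \<sigma> (\<alpha> r))"
            by (rule continuous_on_compose2[OF \<sigma>(1) continuous_on_subset[OF \<alpha>]]) (use st in_N in auto)
        qed (use g \<sigma> gs in auto)
        moreover have "{0..s} \<union> {s..t} = {0..t}" using st by auto
        ultimately show ?thesis
          using g \<sigma> in_N st by (intro exI[of _ "\<lambda>r. if r \<le> s then g r else \<sigma> (\<alpha> r)"]) auto
      qed
      then show ?thesis using \<delta>(1) by (intro exI[of _ \<delta>]) auto
    qed
  qed
  then show ?thesis by simp
qed

text \<open>Free homotopies of loops suffice. For surjectivity, two constant loops are homotopic and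
  the track of the base point is a path to lift. For injectivity, the image of a segment between two
  points of a fibre is a loop; shrinking it to a constant loop makes the endpoints of its lift
  coincide.\<close>

lemma bij_if_simply_connected:
  assumes sc: "simply_connected (UNIV :: 'm set)"
  shows "bij e"
proof (rule bijI)
  have homotopic: "\<exists>h. continuous_on ({0..1::real} \<times> {0..1::real}) h \<and> (\<forall>x\<in>{0..1}. h (0, x) = p x) \<and>
      (\<forall>x\<in>{0..1}. h (1, x) = q x) \<and> (\<forall>t\<in>{0..1}. h (t, 1) = h (t, 0))"
    if "continuous_on {0..1} p" "p 1 = p 0" "continuous_on {0..1} q" "q 1 = q 0" for p q :: "real \<Rightarrow> 'm"
  proof -
    have "homotopic_loops UNIV p q"
      using sc that unfolding simply_connected_def path_def pathstart_def pathfinish_def by blast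
    then show ?thesis unfolding homotopic_loops by (auto simp: pathstart_def pathfinish_def)
  qed
  show "surj e"
  proof (rule surjI)
    fix y
    obtain h where h: "continuous_on ({0..1::real} \<times> {0..1::real}) h" "\<forall>x\<in>{0..1}. h (0, x) = e 0"
        "\<forall>x\<in>{0..1}. h (1, x) = y"
      using homotopic[of "\<lambda>_. e 0" "\<lambda>_. y"] by auto
    have "continuous_on {0..1} (\<lambda>s. h (s, 0))"
      by (rule continuous_on_compose2[OF h(1)]) (auto intro!: continuous_intros)
    then obtain g where "\<forall>t\<in>{0..1}. e (g t) = h (t, 0)" using path_lift[of "\<lambda>s. h (s, 0)" 0] h(2) by auto
    then have "e (g 1) = y" using h(3) by simp
    then show "e (SOME v. e v = y) = y" by (metis (mono_tags) someI)
  qed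
  show "inj e"
  proof (rule injI)
    fix v w assume vw: "e v = e w"
    define l where "l t = (1 - t) *\<^sub>R v + t *\<^sub>R w" for t :: real
    have cont_l: "continuous_on {0..1} l" unfolding l_def by (intro continuous_intros)
    have "continuous_on {0..1} (\<lambda>t. e (l t))"
      by (rule continuous_on_compose2[OF cont_e cont_l]) auto
    then obtain h where h: "continuous_on ({0..1::real} \<times> {0..1::real}) h" "\<forall>x\<in>{0..1}. h (0, x) = e (l x)"
        "\<forall>x\<in>{0..1}. h (1, x) = e v" "\<forall>t\<in>{0..1}. h (t, 1) = h (t, 0)"
      using homotopic[of "\<lambda>t. e (l t)" "\<lambda>_. e v"] vw by (auto simp: l_def)
    have "continuous_on {0..1} (\<lambda>s. h (s, 0))"
      by (rule continuous_on_compose2[OF h(1)]) (auto intro!: continuous_intros)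
    \<comment> \<open>During a free homotopy the base point moves; \<open>g\<close> lifts its track
      and supplies the starting points of the lifted loops.\<close>
    then obtain g where g: "continuous_on {0..1} g" "g 0 = v" "\<forall>t\<in>{0..1}. e (g t) = h (t, 0)"
      using path_lift[of "\<lambda>s. h (s, 0)" v] h(2) by (auto simp: l_def)
    have "\<exists>k. continuous_on {0..1::real} k \<and> k 0 = g s \<and> (\<forall>t\<in>{0..1}. e (k t) = h (s, t))"
      if s: "s \<in> {0..1}" for s
    proof (rule path_lift)
      show "continuous_on {0..1} (\<lambda>t. h (s, t))"
        by (rule continuous_on_compose2[OF h(1)]) (use s in \<open>auto intro!: continuous_intros\<close>)
      show "e (g s) = h (s, 0)" using g(3) s by simp
    qed
    then obtain k where k: "\<And>s. s \<in> {0..1} \<Longrightarrow> continuous_on {0..1::real} (k s)"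
        "\<And>s. s \<in> {0..1} \<Longrightarrow> k s 0 = g s" "\<And>s t. s \<in> {0..1} \<Longrightarrow> t \<in> {0..1} \<Longrightarrow> e (k s t) = h (s, t)"
      by metis
    have "continuous_on {0..1} (\<lambda>s. k s 1)"
    proof (rule lift_depends_continuously[where h = "\<lambda>s t. h (s, t)"])
      show "continuous_on ({0..1} \<times> {0..1}) (\<lambda>(q, t). h (q, t))" using h(1) by simp
      show "continuous_on {0..1} (\<lambda>q. k q 0)" by (rule continuous_on_eq[OF g(1)]) (simp add: k(2))
    qed (use k in auto)
    \<comment> \<open>The final loop is constant, hence so is its lift.\<close>
    moreover have "k 1 1 = g 1"
      using lift_unique[of "{0..1}" "k 1" "\<lambda>_. g 1" 0 1] k g(3) h(3) by simp
    moreover have "e (k s 1) = e (g s)" if "s \<in> {0..1}" for s using k(3) g(3) h(4) that by simp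
    \<comment> \<open>Start and end points of the lifted loops both lift the track of the base
      point; they agree at \<open>s = 1\<close>, hence also at \<open>s = 0\<close>.\<close>
    ultimately have "k 0 1 = g 0"
      using lift_unique[of "{0..1}" "\<lambda>s. k s 1" g 1 0] g(1) by simp
    moreover have "k 0 1 = l 1"
      using lift_unique[of "{0..1}" "k 0" l 0 1] k cont_l h(2) g(2) by (simp add: l_def)
    ultimately show "v = w" using g(2) by (simp add: l_def)
  qed
qed

end

section \<open>The exponential map is an expanding bijection\<close>

lemma (in metric_patch) upper_bound:
  assumes a: "a \<in> W"
  obtains C where "0 < C" "\<And>v. G a v v \<le> C * (norm v)\<^sup>2"
proof -
  define C where "C = (\<Sum>i\<in>Basis. \<Sum>j\<in>Basis. \<bar>G a i j\<bar>) + 1"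
  have "0 < C" by (simp add: C_def add_nonneg_pos sum_nonneg)
  moreover have "G a v v \<le> C * (norm v)\<^sup>2" for v
  proof -
    have "G a v v \<le> (\<Sum>i\<in>Basis. \<Sum>j\<in>Basis. \<bar>G a i j\<bar>) * norm v * norm v"
      using bilinear_bound_Basis[OF bil[OF a], of v v] by linarith
    also have "\<dots> \<le> C * norm v * norm v" by (intro mult_right_mono) (auto simp: C_def)
    finally show ?thesis by (simp add: power2_eq_square mult.assoc)
  qed
  ultimately show thesis using that by blast
qed

section \<open>The norm on a tangent space\<close>

context rmanifold
begin

lemma Dtransition_self:
  assumes k: "k \<in> atlas M" and y: "y \<in> fst k"
  shows "Dtransition k k (snd k y) h = h"
proof -
  have m: "k \<in> maximal_atlas M" by (rule atlas_maximal[OF k])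
  have "((\<lambda>a. a) has_derivative (\<lambda>h. h)) (at (snd k y))" by (rule has_derivative_ident)
  then have "(transition k k has_derivative (\<lambda>h. h)) (at (snd k y))"
    by (rule has_derivative_transform_within_open[OF _ chartD(2)[OF m] chartD(8)[OF m y]])
      (simp add: transition_def chartD[OF m])
  from has_derivative_unique[OF this transition_has_derivative[OF overlapping_atlas[OF m k] y y]]
  show ?thesis by metis
qed

text \<open>Identifies the inner product at \<open>x\<close> with a coordinate metric, so that the
  results of \<open>metric_patch\<close> apply to the tangent space at \<open>x\<close>.\<close>

lemma rmetric_chart_at: "rmetric M x u v = metric_coords M (chart_at M x) (snd (chart_at M x) x) u v"
  by (simp add: metric_coords_eq chart_at_maximal chart_at Dtransition_self)

lemma tangent_patch: "metric_patch (chart_image (chart_at M x)) (metric_coords M (chart_at M x))"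
    "snd (chart_at M x) x \<in> chart_image (chart_at M x)"
  by (rule metric_patch_chart[OF chart_at_maximal], rule chartD(8)[OF chart_at_maximal chart_at(2)])

lemma rmetric_sym: "rmetric M x u v = rmetric M x v u"
  using riemannian by (simp add: riemannian_manifold_def)

lemma rmetric_linear: "linear (\<lambda>u. rmetric M x u v)" "linear (rmetric M x u)"
  using riemannian by (auto simp: riemannian_manifold_def bilinear_def)

lemmas rmetric_simps = rmetric_linear[THEN linear_add] rmetric_linear[THEN linear_diff]
  rmetric_linear[THEN linear_scale] rmetric_linear[THEN linear_neg] rmetric_linear[THEN linear_0]

lemma rmetric_nonneg: "0 \<le> rmetric M x v v"
  unfolding rmetric_chart_at by (rule metric_patch.nonneg[OF tangent_patch])

lemma tnorm_nonneg: "0 \<le> tnorm M x v"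
  by (simp add: tnorm_def rmetric_nonneg)

lemma tnorm_power2: "(tnorm M x v)\<^sup>2 = rmetric M x v v"
  by (simp add: tnorm_def rmetric_nonneg)

lemma tnorm_0: "tnorm M x 0 = 0"
  by (simp add: tnorm_def rmetric_simps)

lemma tnorm_pos: "v \<noteq> 0 \<Longrightarrow> 0 < tnorm M x v"
  using riemannian by (simp add: tnorm_def riemannian_manifold_def)

lemma tnorm_scale: "tnorm M x (r *\<^sub>R v) = \<bar>r\<bar> * tnorm M x v"
  by (simp add: tnorm_def rmetric_simps real_sqrt_mult mult.assoc[symmetric] power2_eq_square[symmetric])

lemma tnorm_minus: "tnorm M x (- v) = tnorm M x v"
  using tnorm_scale[of x "-1" v] by simp

lemma rmetric_Cauchy_Schwarz: "\<bar>rmetric M x u v\<bar> \<le> tnorm M x u * tnorm M x v"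
proof -
  have "(rmetric M x u v)\<^sup>2 \<le> (tnorm M x u * tnorm M x v)\<^sup>2"
    unfolding power_mult_distrib tnorm_power2 rmetric_chart_at
    by (rule metric_patch.Cauchy_Schwarz[OF tangent_patch])
  then show ?thesis by (rule abs_le_square_iff[THEN iffD2, THEN order_trans]) (simp add: tnorm_nonneg)
qed

lemma tnorm_triangle: "tnorm M x (u + v) \<le> tnorm M x u + tnorm M x v"
proof (rule power2_le_imp_le)
  have "(tnorm M x (u + v))\<^sup>2 = (tnorm M x u)\<^sup>2 + (tnorm M x v)\<^sup>2 + 2 * rmetric M x u v"
    by (simp add: tnorm_power2 rmetric_simps rmetric_sym[of x v u])
  then show "(tnorm M x (u + v))\<^sup>2 \<le> (tnorm M x u + tnorm M x v)\<^sup>2"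
    using rmetric_Cauchy_Schwarz[of x u v] by (simp add: power2_sum)
qed (simp add: tnorm_nonneg)

lemma tnorm_coercive:
  obtains c where "0 < c" "\<And>v. c * norm v \<le> tnorm M x v"
proof -
  obtain c where c: "0 < c" "\<And>v. c * (norm v)\<^sup>2 \<le> rmetric M x v v"
    using metric_patch.coercive[OF tangent_patch, of x] unfolding rmetric_chart_at by metis
  have "sqrt c * norm v \<le> tnorm M x v" for v
    using real_sqrt_le_mono[OF c(2)[of v]] by (simp add: tnorm_def real_sqrt_mult)
  then show thesis using that[of "sqrt c"] c(1) by simp
qed

lemma tnorm_upper:
  obtains C where "0 < C" "\<And>v. tnorm M x v \<le> C * norm v"
proof -
  obtain C where C: "0 < C" "\<And>v. rmetric M x v v \<le> C * (norm v)\<^sup>2"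
    using metric_patch.upper_bound[OF tangent_patch, of x] unfolding rmetric_chart_at by metis
  have "tnorm M x v \<le> sqrt C * norm v" for v
    using real_sqrt_le_mono[OF C(2)[of v]] by (simp add: tnorm_def real_sqrt_mult)
  then show thesis using that[of "sqrt C"] C(1) by simp
qed

end

text \<open>Continuous lifts of differentiable curves are differentiable. The lower bound on
  \<open>A\<close> first shows that increments of \<open>g\<close> are O(|s - t|); then the
  linearization error of \<open>f\<close> along \<open>g\<close> is o(|s - t|), and the bound on
  \<open>A\<close> applies again to the deviation from \<open>g'\<close>.\<close>

lemma has_vector_derivative_implicit:
  fixes f :: "'a::euclidean_space \<Rightarrow> 'a" and g :: "real \<Rightarrow> 'a"
  assumes f: "(f has_derivative A) (at (g t))" and c: "0 < c" "\<And>h. c * norm h \<le> norm (A h)"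
    and g: "isCont g t" and D: "((\<lambda>s. f (g s)) has_vector_derivative D) (at t)"
  obtains g' where "(g has_vector_derivative g') (at t)" "A g' = D"
proof -
  have lin: "linear A" by (rule has_derivative_linear[OF f])
  have "inj A" unfolding linear_injective_0[OF lin]
  proof (intro allI impI)
    fix h assume "A h = 0"
    then have "c * norm h \<le> 0" using c(2)[of h] by simp
    then show "h = 0" using c(1) by (simp add: mult_le_0_iff)
  qed
  then obtain g' where g': "A g' = D" using linear_injective_imp_surjective[OF lin] by (metis surjD)
  have near_f: "\<forall>\<^sub>F s in at t. norm (f (g s) - f (g t) - A (g s - g t)) \<le> \<eta> * norm (g s - g t)" if \<eta>: "0 < \<eta>" for \<eta>
  proof -
    obtain d where d: "0 < d" "\<And>y. norm (y - g t) < d \<Longrightarrow> norm (f y - f (g t) - A (y - g t)) \<le> \<eta> * norm (y - g t)"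
      using conjunct2[OF f[unfolded has_derivative_at_alt], rule_format, OF \<eta>] by blast
    have "\<forall>\<^sub>F s in at t. dist (g s) (g t) < d" using g d(1) unfolding isCont_def by (rule tendstoD)
    then show ?thesis by eventually_elim (simp add: d(2) dist_norm)
  qed
  have near_D: "\<forall>\<^sub>F s in at t. norm (f (g s) - f (g t) - (s - t) *\<^sub>R D) \<le> \<eta> * \<bar>s - t\<bar>" if \<eta>: "0 < \<eta>" for \<eta>
  proof -
    obtain d where "0 < d" "\<And>s. norm (s - t) < d \<Longrightarrow> norm (f (g s) - f (g t) - (s - t) *\<^sub>R D) \<le> \<eta> * norm (s - t)"
      using conjunct2[OF D[unfolded has_vector_derivative_def has_derivative_at_alt], rule_format, OF \<eta>] by blast
    then show ?thesis unfolding eventually_at by (auto simp: dist_norm)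
  qed
  \<comment> \<open>Half of the lower bound \<open>c\<close> is spent on absorbing the linearization
    error, hence the factor \<open>2 / c\<close>.\<close>
  define B where "B = 2 / c * (norm D + 1)"
  have B: "0 \<le> B" using c(1) by (simp add: B_def)
  have bound: "\<forall>\<^sub>F s in at t. norm (g s - g t) \<le> B * \<bar>s - t\<bar>"
    using near_f[OF half_gt_zero[OF c(1)]] near_D[OF zero_less_one]
  proof eventually_elim
    case (elim s)
    have "norm (f (g s) - f (g t)) \<le> norm (f (g s) - f (g t) - (s - t) *\<^sub>R D) + norm ((s - t) *\<^sub>R D)"
      by (metis diff_add_cancel norm_triangle_ineq)
    also have "\<dots> \<le> (norm D + 1) * \<bar>s - t\<bar>"
      using elim(2) by (simp add: distrib_right mult.commute[of "norm D"])
    finally have 1: "norm (f (g s) - f (g t)) \<le> (norm D + 1) * \<bar>s - t\<bar>" .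
    have "c * norm (g s - g t) \<le> norm (A (g s - g t))" by (rule c(2))
    also have "\<dots> \<le> norm (f (g s) - f (g t)) + norm (f (g s) - f (g t) - A (g s - g t))"
      using norm_triangle_sub[of "A (g s - g t)" "f (g s) - f (g t)"] by (simp add: norm_minus_commute)
    also have "\<dots> \<le> (norm D + 1) * \<bar>s - t\<bar> + c / 2 * norm (g s - g t)" using 1 elim(1) by simp
    finally have "c / 2 * norm (g s - g t) \<le> (norm D + 1) * \<bar>s - t\<bar>" by simp
    then show ?case using c(1) by (simp add: B_def field_simps)
  qed
  have "(g has_vector_derivative g') (at t)"
    unfolding has_vector_derivative_def has_derivative_at_alt
  proof (intro conjI allI impI)
    show "bounded_linear (\<lambda>x. x *\<^sub>R g')" by (rule bounded_linear_scaleR_left)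
    fix \<epsilon> :: real assume \<epsilon>: "0 < \<epsilon>"
    \<comment> \<open>The errors of \<open>f\<close> and of the curve add up to
      \<open>\<eta> * (B + 1)\<close>, which must equal \<open>c * \<epsilon>\<close>.\<close>
    define \<eta> where "\<eta> = c * \<epsilon> / (B + 1)"
    have \<eta>: "0 < \<eta>" using c(1) \<epsilon> B by (simp add: \<eta>_def)
    have \<eta>B: "\<eta> * (B + 1) = c * \<epsilon>" using B by (simp add: \<eta>_def)
    have "\<forall>\<^sub>F s in at t. norm (g s - g t - (s - t) *\<^sub>R g') \<le> \<epsilon> * norm (s - t)"
      using near_f[OF \<eta>] near_D[OF \<eta>] bound
    proof eventually_elim
      case (elim s)
      have "c * norm (g s - g t - (s - t) *\<^sub>R g') \<le> norm (A (g s - g t - (s - t) *\<^sub>R g'))" by (rule c(2))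
      also have "A (g s - g t - (s - t) *\<^sub>R g') = A (g s - g t) - (s - t) *\<^sub>R D"
        by (simp add: linear_diff[OF lin] linear_scale[OF lin] g')
      also have "\<dots> = (f (g s) - f (g t) - (s - t) *\<^sub>R D) - (f (g s) - f (g t) - A (g s - g t))" by simp
      also have "norm \<dots> \<le> \<eta> * \<bar>s - t\<bar> + \<eta> * norm (g s - g t)"
        using norm_triangle_ineq4 elim(1,2) by (meson add_mono order_trans)
      also have "\<dots> \<le> \<eta> * \<bar>s - t\<bar> + \<eta> * (B * \<bar>s - t\<bar>)"
        using elim(3) \<eta> by simp
      also have "\<dots> = \<eta> * (B + 1) * \<bar>s - t\<bar>" by (simp add: algebra_simps)
      also have "\<dots> = c * (\<epsilon> * \<bar>s - t\<bar>)" by (simp add: \<eta>B)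
      finally show ?case using c(1) by simp
    qed
    then obtain d where "0 < d"
      "\<And>s. \<lbrakk>s \<noteq> t; dist s t < d\<rbrakk> \<Longrightarrow> norm (g s - g t - (s - t) *\<^sub>R g') \<le> \<epsilon> * norm (s - t)"
      unfolding eventually_at by auto
    then show "\<exists>d>0. \<forall>s. norm (s - t) < d \<longrightarrow> norm (g s - g t - (s - t) *\<^sub>R g') \<le> \<epsilon> * norm (s - t)"
      by (intro exI[of _ d]) (metis (no_types) cancel_comm_monoid_add_class.diff_cancel diff_self dist_norm
        mult_zero_right norm_zero order_refl scaleR_zero_left)
  qed
  then show thesis using that g' by blast
qed

section \<open>Local injectivity of the exponential map and lifting of curves\<close>

context hadamard
begin

abbreviation "ex \<equiv> exp_map M"

text \<open>Translates the Riemannian expansion into a Euclidean lower bound for the derivative, by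
  comparing the metrics at both ends with the Euclidean norm.\<close>

lemma exp_map_chart:
  assumes k: "k \<in> atlas M" and y: "ex x v \<in> fst k"
  obtains A c where "0 < c" "\<And>h. c * norm h \<le> norm (A h)" "strict_deriv (\<lambda>w. snd k (ex x w)) A v"
    "\<And>h. rmetric M x h h \<le> metric_coords M k (snd k (ex x v)) (A h) (A h)"
    "\<forall>\<^sub>F w in nhds v. ex x w \<in> fst k"
proof -
  interpret P: metric_patch "chart_image k" "metric_coords M k" by (rule metric_patch_chart[OF atlas_maximal[OF k]])
  obtain A where A: "strict_deriv (\<lambda>w. snd k (ex x w)) A v"
    "\<And>h. rmetric M x h h \<le> metric_coords M k (snd k (ex x v)) (A h) (A h)"
    "\<forall>\<^sub>F w in nhds v. ex x w \<in> fst k"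
    by (rule exp_map_strict_deriv[OF k y]) blast
  obtain C where C: "0 < C" "\<And>u. metric_coords M k (snd k (ex x v)) u u \<le> C * (norm u)\<^sup>2"
    using P.upper_bound[OF chartD(8)[OF atlas_maximal[OF k] y]] by metis
  obtain b where b: "0 < b" "\<And>h. b * norm h \<le> tnorm M x h" using tnorm_coercive by metis
  have "b / sqrt C * norm h \<le> norm (A h)" for h
  proof -
    have "(b * norm h)\<^sup>2 \<le> (tnorm M x h)\<^sup>2" using b by (intro power_mono) auto
    also have "\<dots> \<le> C * (norm (A h))\<^sup>2" using A(2)[of h] C(2)[of "A h"] by (simp add: tnorm_power2)
    also have "\<dots> = (sqrt C * norm (A h))\<^sup>2" using C(1) by (simp add: power_mult_distrib)
    finally have "b * norm h \<le> sqrt C * norm (A h)" by (rule power2_le_imp_le) (use C(1) in simp)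
    then show ?thesis using C(1) by (simp add: field_simps)
  qed
  then show thesis using that[of "b / sqrt C" A] A b(1) C(1) by simp
qed

lemma exp_map_isCont: "isCont (ex x) v"
proof -
  define k where "k = chart_at M (ex x v)"
  have k: "k \<in> atlas M" "k \<in> maximal_atlas M" "ex x v \<in> fst k" by (auto simp: k_def chart_at chart_at_maximal)
  obtain A where A: "strict_deriv (\<lambda>w. snd k (ex x w)) A v" "\<forall>\<^sub>F w in nhds v. ex x w \<in> fst k"
    using exp_map_strict_deriv[OF k(1,3)] by metis
  have "isCont (chart_inv k) (snd k (ex x v))"
    using chartD(2,4,8)[OF k(2)] k(3) by (simp add: continuous_on_eq_continuous_at)
  then have "isCont (\<lambda>w. chart_inv k (snd k (ex x w))) v"
    by (rule isCont_o2[OF strict_deriv_isCont[OF A(1)]])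
  moreover have "\<forall>\<^sub>F w in nhds v. chart_inv k (snd k (ex x w)) = ex x w"
    using A(2) by eventually_elim (simp add: chartD[OF k(2)])
  ultimately show ?thesis using isCont_cong by fast
qed

text \<open>Strictness at \<open>v\<close> controls pairs of points near \<open>v\<close>, so the
  lower bound on the derivative gives injectivity on a ball; openness is invariance of domain, using
  equality of dimensions.\<close>

lemma exp_map_locally:
  assumes "open U" "v \<in> U"
  obtains r where "0 < r" "ball v r \<subseteq> U" "inj_on (ex x) (ball v r)" "open (ex x ` ball v r)"
proof -
  define k where "k = chart_at M (ex x v)"
  have k: "k \<in> atlas M" "k \<in> maximal_atlas M" "ex x v \<in> fst k" by (auto simp: k_def chart_at chart_at_maximal)
  obtain A c where c: "0 < c" "\<And>h. c * norm h \<le> norm (A h)" and A: "strict_deriv (\<lambda>w. snd k (ex x w)) A v"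
    "\<forall>\<^sub>F w in nhds v. ex x w \<in> fst k"
    using exp_map_chart[OF k(1,3)] by metis
  obtain r1 where r1: "0 < r1" "\<And>w. w \<in> ball v r1 \<Longrightarrow> ex x w \<in> fst k"
    using A(2) unfolding eventually_nhds_metric by (metis dist_commute mem_ball)
  obtain r2 where r2: "0 < r2" "ball v r2 \<subseteq> U" using assms by (meson open_contains_ball)
  \<comment> \<open>An error of half the lower bound cannot cancel the derivative.\<close>
  have "0 < c / 2" using c(1) by simp
  then obtain r3 where r3: "0 < r3" "\<And>w w'. \<lbrakk>w \<in> ball v r3; w' \<in> ball v r3\<rbrakk>
      \<Longrightarrow> norm (snd k (ex x w') - snd k (ex x w) - A (w' - w)) \<le> c / 2 * norm (w' - w)"
    using strict_derivD[OF A(1)] by metis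
  define r where "r = min r1 (min r2 r3)"
  have r: "0 < r" using r1 r2 r3 by (simp add: r_def)
  have inj: "inj_on (\<lambda>w. snd k (ex x w)) (ball v r)"
  proof (rule inj_onI)
    fix w w' assume w: "w \<in> ball v r" "w' \<in> ball v r" and eq: "snd k (ex x w) = snd k (ex x w')"
    have "c * norm (w' - w) \<le> norm (A (w' - w))" by (rule c(2))
    also have "\<dots> \<le> c / 2 * norm (w' - w)" using r3(2)[of w w'] w eq by (simp add: r_def)
    finally have "c * norm (w' - w) \<le> 0" by simp
    then show "w = w'" using c(1) by (simp add: mult_le_0_iff)
  qed
  have in_k: "ex x w \<in> fst k" if "w \<in> ball v r" for w using r1(2) that by (simp add: r_def)
  have "continuous_on (ball v r) (\<lambda>w. snd k (ex x w))"
    by (rule continuous_on_compose2[OF chartD(3)[OF k(2)]])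
      (use exp_map_isCont in_k in \<open>auto intro: continuous_at_imp_continuous_on\<close>)
  from invariance_of_domain[OF this open_ball inj]
  have op: "open ((\<lambda>w. snd k (ex x w)) ` ball v r)" .
  have "ex x ` ball v r = fst k \<inter> snd k -` ((\<lambda>w. snd k (ex x w)) ` ball v r)"
  proof (intro equalityI subsetI)
    fix y assume "y \<in> fst k \<inter> snd k -` ((\<lambda>w. snd k (ex x w)) ` ball v r)"
    then obtain w where w: "y \<in> fst k" "w \<in> ball v r" "snd k y = snd k (ex x w)" by auto
    then have "y = ex x w" using chartD(5)[OF k(2)] in_k by metis
    with w show "y \<in> ex x ` ball v r" by blast
  qed (use in_k in auto)
  then have "open (ex x ` ball v r)"
    using continuous_open_preimage[OF chartD(3,1)[OF k(2)] op] by simp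
  moreover have "inj_on (ex x) (ball v r)" using inj by (auto simp: inj_on_def)
  moreover have "ball v r \<subseteq> U" using r2(2) by (auto simp: r_def)
  ultimately show thesis using that r by blast
qed

lemma local_homeo_exp: "local_homeo (ex x)"
proof
  show "continuous_on UNIV (ex x)" by (simp add: continuous_at_imp_continuous_on exp_map_isCont)
  show "\<exists>U. open U \<and> v \<in> U \<and> inj_on (ex x) U" for v
    by (rule exp_map_locally[of UNIV v x]) (auto intro!: exI[of _ "ball v _"])
  show "open (ex x ` U)" if U: "open U" for U
    unfolding open_subopen[of "ex x ` U"]
  proof (intro ballI)
    fix y assume "y \<in> ex x ` U"
    then obtain v where v: "v \<in> U" "y = ex x v" by blast
    obtain r where "0 < r" "ball v r \<subseteq> U" "open (ex x ` ball v r)" using exp_map_locally[OF U v(1)] by metis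
    then show "\<exists>T. open T \<and> y \<in> T \<and> T \<subseteq> ex x ` U"
      using v by (intro exI[of _ "ex x ` ball v r"]) auto
  qed
qed

text \<open>A continuous majorant of the speed, with any atlas chart allowed at each interior time.
  It covers pieces of C1 curves and segments in coordinates alike, and it leaves out the end points,
  where only one-sided derivatives exist.\<close>

definition speed_bound :: "real \<Rightarrow> real \<Rightarrow> (real \<Rightarrow> 'm) \<Rightarrow> (real \<Rightarrow> real) \<Rightarrow> bool" where
  "speed_bound a b \<alpha> sp \<longleftrightarrow> continuous_on {a..b} \<alpha> \<and> continuous_on {a..b} sp \<and>
     (\<forall>t\<in>{a<..<b}. \<exists>k\<in>atlas M. \<alpha> t \<in> fst k \<and> 0 \<le> sp t \<and>
        (\<exists>D. ((\<lambda>s. snd k (\<alpha> s)) has_vector_derivative D) (at t) \<and>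
           metric_coords M k (snd k (\<alpha> t)) D D \<le> (sp t)\<^sup>2))"

lemma speed_bound_subset:
  assumes "speed_bound a b \<alpha> sp" "{c..d} \<subseteq> {a..b}"
  shows "speed_bound c d \<alpha> sp"
proof (cases "c < d")
  case True
  then have "a \<le> c" "d \<le> b" using assms(2) by auto
  then have "{c<..<d} \<subseteq> {a<..<b}" by auto
  then show ?thesis using assms unfolding speed_bound_def by (meson continuous_on_subset subsetD)
next
  case False
  then show ?thesis using assms unfolding speed_bound_def by (auto intro: continuous_on_subset)
qed

lemma speed_bound_cong:
  assumes sp: "speed_bound a b \<alpha> sp" and eq: "\<And>t. t \<in> {a..b} \<Longrightarrow> \<beta> t = \<alpha> t"
  shows "speed_bound a b \<beta> sp"
  unfolding speed_bound_def
proof (intro conjI ballI)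
  show "continuous_on {a..b} \<beta>"
    by (rule continuous_on_eq[of _ \<alpha>]) (use sp eq in \<open>auto simp: speed_bound_def\<close>)
  show "continuous_on {a..b} sp" using sp by (simp add: speed_bound_def)
  fix t assume t: "t \<in> {a<..<b}"
  then obtain k D where k: "k \<in> atlas M" "\<alpha> t \<in> fst k" "0 \<le> sp t"
    "((\<lambda>s. snd k (\<alpha> s)) has_vector_derivative D) (at t)" "metric_coords M k (snd k (\<alpha> t)) D D \<le> (sp t)\<^sup>2"
    using sp unfolding speed_bound_def by blast
  have "((\<lambda>s. snd k (\<beta> s)) has_vector_derivative D) (at t)"
    by (rule has_vector_derivative_transform_within_open[OF k(4), of "{a<..<b}"]) (use t eq in auto)
  moreover have "\<beta> t = \<alpha> t" using t eq by simp
  ultimately show "\<exists>k\<in>atlas M. \<beta> t \<in> fst k \<and> 0 \<le> sp t \<and>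
      (\<exists>D. ((\<lambda>s. snd k (\<beta> s)) has_vector_derivative D) (at t) \<and> metric_coords M k (snd k (\<beta> t)) D D \<le> (sp t)\<^sup>2)"
    using k by metis
qed

text \<open>The lift is differentiable and, by the expansion of the derivative, no faster than the
  curve below. All its velocities lie in the single Euclidean space at \<open>x\<close>, so the
  displacement is bounded by the integral of the speed.\<close>

lemma lift_length:
  assumes sp: "speed_bound a b (\<lambda>t. ex x (g t)) sp" and g: "continuous_on {a..b} g" and ab: "a \<le> b"
  shows "tnorm M x (g b - g a) \<le> integral {a..b} sp"
proof (cases "a = b")
  case True
  then show ?thesis by (simp add: tnorm_0)
next
  case False
  then have ab: "a < b" using ab by simp
  \<comment> \<open>Pairing with the displacement makes the problem scalar; Cauchy-Schwarz produces
    one factor \<open>tnorm M x \<xi>\<close> too many, which is cancelled at the end.\<close>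
  define \<xi> where "\<xi> = g b - g a"
  have conts: "continuous_on {a..b} sp" using sp by (simp add: speed_bound_def)
  have "\<exists>g'. (g has_vector_derivative g') (at t) \<and> tnorm M x g' \<le> sp t" if t: "t \<in> {a<..<b}" for t
  proof -
    obtain k D where k: "k \<in> atlas M" "ex x (g t) \<in> fst k" and s0: "0 \<le> sp t"
      and D: "((\<lambda>s. snd k (ex x (g s))) has_vector_derivative D) (at t)"
      "metric_coords M k (snd k (ex x (g t))) D D \<le> (sp t)\<^sup>2"
      using sp t unfolding speed_bound_def by blast
    obtain A c where c: "0 < c" "\<And>h. c * norm h \<le> norm (A h)" and A: "strict_deriv (\<lambda>w. snd k (ex x w)) A (g t)"
      "\<And>h. rmetric M x h h \<le> metric_coords M k (snd k (ex x (g t))) (A h) (A h)"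
      using exp_map_chart[OF k] by metis
    have "isCont g t" using g t by (metis at_within_Icc_at atLeastAtMost_iff continuous_on_eq_continuous_within
        greaterThanLessThan_iff less_eq_real_def)
    then obtain g' where g': "(g has_vector_derivative g') (at t)" "A g' = D"
      using has_vector_derivative_implicit[OF strict_deriv_has_derivative[OF A(1)] c _ D(1)] by metis
    have "(tnorm M x g')\<^sup>2 \<le> (sp t)\<^sup>2" using A(2)[of g'] D(2) by (simp add: tnorm_power2 g'(2))
    then show ?thesis using g'(1) s0 by (blast intro: power2_le_imp_le)
  qed
  then obtain g' where g': "\<And>t. t \<in> {a<..<b} \<Longrightarrow> (g has_vector_derivative g' t) (at t)"
    "\<And>t. t \<in> {a<..<b} \<Longrightarrow> tnorm M x (g' t) \<le> sp t" by metis
  have bl: "bounded_linear (\<lambda>u. rmetric M x u \<xi>)"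
    using rmetric_linear(1) by (simp add: linear_conv_bounded_linear)
  have "norm (rmetric M x (g b) \<xi> - rmetric M x (g a) \<xi>)
      \<le> tnorm M x \<xi> * integral {a..b} sp - tnorm M x \<xi> * integral {a..a} sp"
  proof (rule differentiable_bound_general[OF ab])
    show "continuous_on {a..b} (\<lambda>t. rmetric M x (g t) \<xi>)"
      by (rule bounded_linear.continuous_on[OF bl g])
    show "continuous_on {a..b} (\<lambda>t. tnorm M x \<xi> * integral {a..t} sp)"
      by (intro continuous_intros indefinite_integral_continuous_1 integrable_continuous_interval conts)
    fix t assume t: "a < t" "t < b"
    show "((\<lambda>t. rmetric M x (g t) \<xi>) has_vector_derivative rmetric M x (g' t) \<xi>) (at t)"
      by (rule bounded_linear.has_vector_derivative[OF bl g'(1)]) (use t in simp)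
    have "((\<lambda>t. integral {a..t} sp) has_vector_derivative sp t) (at t within {a..b})"
      by (rule integral_has_vector_derivative[OF conts]) (use t in simp)
    then have "((\<lambda>t. integral {a..t} sp) has_vector_derivative sp t) (at t)"
      using t by (simp add: at_within_Icc_at)
    then show "((\<lambda>t. tnorm M x \<xi> * integral {a..t} sp) has_vector_derivative tnorm M x \<xi> * sp t) (at t)"
      by (rule bounded_linear.has_vector_derivative[OF bounded_linear_mult_right])
    have "\<bar>rmetric M x (g' t) \<xi>\<bar> \<le> tnorm M x (g' t) * tnorm M x \<xi>" by (rule rmetric_Cauchy_Schwarz)
    also have "\<dots> \<le> sp t * tnorm M x \<xi>" using g'(2)[of t] t by (intro mult_right_mono tnorm_nonneg) simp
    finally show "norm (rmetric M x (g' t) \<xi>) \<le> tnorm M x \<xi> * sp t" by (simp add: mult.commute)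
  qed
  also have "rmetric M x (g b) \<xi> - rmetric M x (g a) \<xi> = (tnorm M x \<xi>)\<^sup>2"
    unfolding tnorm_power2 by (simp add: \<xi>_def rmetric_simps)
  finally have "tnorm M x \<xi> * tnorm M x \<xi> \<le> tnorm M x \<xi> * integral {a..b} sp"
    by (simp add: power2_eq_square)
  moreover have "0 \<le> integral {a..b} sp"
  proof (rule integral_nonneg[OF integrable_continuous_interval[OF conts]])
    fix t assume "t \<in> {a..b}"
    have "continuous_on (closure {a<..<b}) sp" using conts ab by simp
    moreover have "\<And>t. t \<in> {a<..<b} \<Longrightarrow> 0 \<le> sp t" using sp by (auto simp: speed_bound_def)
    moreover have "t \<in> closure {a<..<b}" using \<open>t \<in> {a..b}\<close> ab by simp
    ultimately show "0 \<le> sp t" by (meson continuous_ge_on_closure)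
  qed
  ultimately show ?thesis
    using tnorm_nonneg[of x \<xi>] by (cases "tnorm M x \<xi> = 0") (auto simp: \<xi>_def[symmetric])
qed

text \<open>A lift cannot escape in finite time: its speed is bounded by the maximum of
  \<open>sp\<close>, so it is Lipschitz and extends continuously to the limit time. From there a
  local inverse continues it.\<close>

lemma speed_lift:
  assumes sp: "speed_bound a b \<alpha> sp" and ab: "a \<le> b" and v: "ex x v = \<alpha> a"
  shows "\<exists>g. continuous_on {a..b} g \<and> g a = v \<and> (\<forall>t\<in>{a..b}. ex x (g t) = \<alpha> t)"
proof -
  interpret L: local_homeo "ex x" by (rule local_homeo_exp)
  define lifts where "lifts t g \<longleftrightarrow> continuous_on {a..t} g \<and> g a = v \<and> (\<forall>r\<in>{a..t}. ex x (g r) = \<alpha> r)" for t g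
  have cont\<alpha>: "continuous_on {a..b} \<alpha>" and contsp: "continuous_on {a..b} sp"
    using sp by (auto simp: speed_bound_def)
  have "\<exists>g. lifts b g"
  proof (rule real_induct[where P = "\<lambda>t. \<exists>g. lifts t g" and a = a and b = b])
    show "\<exists>g. lifts a g" using v by (intro exI[of _ "\<lambda>_. v"]) (simp add: lifts_def)
    show "b \<in> {a..b}" using ab by simp
  next
    fix T assume T: "a < T" "T \<le> b" and IH: "\<And>\<tau>. \<tau> \<in> {a..<T} \<Longrightarrow> \<exists>g. lifts \<tau> g"
    then obtain G where G: "\<And>\<tau>. \<tau> \<in> {a..<T} \<Longrightarrow> lifts \<tau> (G \<tau>)" by metis
    have same: "G \<tau> r = G \<sigma> r" if "a \<le> r" "r \<le> \<tau>" "r \<le> \<sigma>" "\<tau> < T" "\<sigma> < T" for r \<sigma> \<tau>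
    proof (rule L.lift_unique[where S = "{a..r}" and s = a])
      show "continuous_on {a..r} (G \<tau>)" "continuous_on {a..r} (G \<sigma>)"
        using G[of \<tau>] G[of \<sigma>] that by (auto simp: lifts_def intro: continuous_on_subset)
    qed (use G[of \<tau>] G[of \<sigma>] that in \<open>auto simp: lifts_def\<close>)
    \<comment> \<open>By uniqueness the lifts chosen for different times agree on common intervals,
      so the diagonal glues them together.\<close>
    define g where "g r = G r r" for r
    have gG: "g r = G \<tau> r" if "a \<le> r" "r \<le> \<tau>" "\<tau> < T" for r \<tau>
      unfolding g_def using that by (intro same) auto
    have contg: "continuous_on {a..\<tau>} g" if "\<tau> \<in> {a..<T}" for \<tau>
      by (rule continuous_on_eq[of _ "G \<tau>"]) (use G[OF that] gG that in \<open>auto simp: lifts_def\<close>)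
    have lift: "ex x (g r) = \<alpha> r" if "r \<in> {a..<T}" for r
      using G[OF that] that by (auto simp: lifts_def g_def)
    obtain B where B: "\<And>t. t \<in> {a..b} \<Longrightarrow> norm (sp t) \<le> B"
      using compact_imp_bounded[OF compact_continuous_image[OF contsp compact_Icc]]
      unfolding bounded_iff by (metis image_eqI)
    obtain c where c: "0 < c" "\<And>h. c * norm h \<le> tnorm M x h" using tnorm_coercive by metis
    have B0: "0 \<le> B" using B[of a] ab by (metis atLeastAtMost_iff norm_ge_zero order_refl order_trans)
    have lip: "norm (g r - g s) \<le> B / c * (r - s)" if rs: "a \<le> s" "s \<le> r" "r < T" for r s
    proof -
      have "tnorm M x (g r - g s) \<le> integral {s..r} sp"
      proof (rule lift_length)
        have "speed_bound s r \<alpha> sp" by (rule speed_bound_subset[OF sp]) (use rs T in auto)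
        then show "speed_bound s r (\<lambda>t. ex x (g t)) sp"
          by (rule speed_bound_cong) (use lift rs in auto)
        show "continuous_on {s..r} g" by (rule continuous_on_subset[OF contg[of r]]) (use rs in auto)
      qed (use rs in simp)
      also have "\<dots> \<le> integral {s..r} (\<lambda>_. B)"
        using B rs T by (intro integral_le integrable_continuous_interval continuous_on_subset[OF contsp])
          (auto intro: order_trans[OF abs_ge_self])
      also have "\<dots> = B * (r - s)" using rs by (simp add: mult.commute)
      finally show ?thesis using c(2)[of "g r - g s"] c(1) by (simp add: field_simps)
    qed
    have "(B / c)-lipschitz_on {a..<T} g"
    proof (rule lipschitz_onI)
      show "dist (g r) (g s) \<le> B / c * dist r s" if "r \<in> {a..<T}" "s \<in> {a..<T}" for r s
        using lip[of r s] lip[of s r] that by (cases "s \<le> r") (auto simp: dist_norm norm_minus_commute)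
    qed (use B0 c in simp)
    from lipschitz_on_uniformly_continuous[OF this]
    obtain g1 where g1: "uniformly_continuous_on (closure {a..<T}) g1" "\<And>r. r \<in> {a..<T} \<Longrightarrow> g r = g1 r"
      using uniformly_continuous_on_extension_on_closure by metis
    have cg1: "continuous_on {a..T} g1" using uniformly_continuous_imp_continuous[OF g1(1)] T by simp
    have "ex x (g1 T) = \<alpha> T"
    proof (rule tendsto_unique[where F = "at T within {a..T}"])
      show "at T within {a..T} \<noteq> bot" using T by (simp add: at_within_Icc_at_left trivial_limit_at_left_real)
      have "continuous_on {a..T} (\<lambda>r. ex x (g1 r))"
        by (rule continuous_on_compose2[OF L.cont_e cg1]) auto
      then have "((\<lambda>r. ex x (g1 r)) \<longlongrightarrow> ex x (g1 T)) (at T within {a..T})"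
        using T by (auto simp: continuous_on_def)
      then show "(\<alpha> \<longlongrightarrow> ex x (g1 T)) (at T within {a..T})"
      proof (rule Lim_transform_eventually)
        show "\<forall>\<^sub>F r in at T within {a..T}. ex x (g1 r) = \<alpha> r"
          unfolding eventually_at_filter
        proof (rule always_eventually, intro allI impI)
          fix r assume "r \<noteq> T" "r \<in> {a..T}"
          then have r: "r \<in> {a..<T}" by auto
          show "ex x (g1 r) = \<alpha> r" using lift[OF r] g1(2)[OF r] by simp
        qed
      qed
      have "continuous_on {a..T} \<alpha>" by (rule continuous_on_subset[OF cont\<alpha>]) (use T in auto)
      then show "(\<alpha> \<longlongrightarrow> \<alpha> T) (at T within {a..T})" using T by (auto simp: continuous_on_def)
    qed
    moreover have "ex x (g1 r) = \<alpha> r" if "r \<in> {a..<T}" for r using lift[OF that] g1(2)[OF that] by simp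
    ultimately have "ex x (g1 r) = \<alpha> r" if "r \<in> {a..T}" for r using that by (cases "r = T") auto
    moreover have "g1 a = v" using g1(2)[of a] G[of a] T by (simp add: g_def lifts_def)
    ultimately show "\<exists>g. lifts T g" using cg1 by (auto simp: lifts_def)
  next
    fix T assume T: "a \<le> T" "T < b" and IH: "\<And>\<tau>. \<tau> \<in> {a..T} \<Longrightarrow> \<exists>g. lifts \<tau> g"
    have "T \<in> {a..T}" using T by simp
    from IH[OF this] obtain g where "lifts T g" ..
    then have g: "continuous_on {a..T} g" "g a = v" "\<And>r. r \<in> {a..T} \<Longrightarrow> ex x (g r) = \<alpha> r"
      by (auto simp: lifts_def)
    obtain U where U: "open U" "g T \<in> U" "inj_on (ex x) U" using L.locally_inj_e by metis
    have V: "open (ex x ` U)" by (rule L.open_map_e[OF U(1)])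
    have gT: "ex x (g T) = \<alpha> T" using g(3) T by simp
    have aT: "\<alpha> T \<in> ex x ` U" using gT U(2) by (metis image_eqI)
    have "(\<alpha> \<longlongrightarrow> \<alpha> T) (at T within {a..b})" using cont\<alpha> T by (auto simp: continuous_on_def)
    from topological_tendstoD[OF this V aT]
    obtain \<delta> where \<delta>: "0 < \<delta>" "\<And>t. \<lbrakk>t \<in> {a..b}; t \<noteq> T; dist t T < \<delta>\<rbrakk> \<Longrightarrow> \<alpha> t \<in> ex x ` U"
      unfolding eventually_at by blast
    have "\<exists>g. lifts \<tau> g" if \<tau>: "\<tau> \<in> {T<..<T + min \<delta> (b - T)}" for \<tau>
    proof -
      have in_V: "\<alpha> r \<in> ex x ` U" if "r \<in> {T..\<tau>}" for r
        using that \<tau> aT T \<delta>(2)[of r] by (cases "r = T") (auto simp: dist_real_def)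
      have "continuous_on ({a..T} \<union> {T..\<tau>}) (\<lambda>r. if r \<le> T then g r else inv_into U (ex x) (\<alpha> r))"
      proof (rule continuous_on_cases)
        show "continuous_on {T..\<tau>} (\<lambda>r. inv_into U (ex x) (\<alpha> r))"
          by (rule continuous_on_compose2[OF L.local_inverse[OF U(1,3)] continuous_on_subset[OF cont\<alpha>]])
            (use T \<tau> in_V in auto)
        show "\<forall>r. r \<in> {a..T} \<and> \<not> r \<le> T \<or> r \<in> {T..\<tau>} \<and> r \<le> T \<longrightarrow> g r = inv_into U (ex x) (\<alpha> r)"
          using U gT by (auto simp: gT[symmetric])
      qed (use g in auto)
      moreover have "{a..T} \<union> {T..\<tau>} = {a..\<tau>}" using T \<tau> by auto
      moreover have "ex x (inv_into U (ex x) (\<alpha> r)) = \<alpha> r" if "r \<in> {T..\<tau>}" for r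
        using in_V[OF that] by (rule f_inv_into_f)
      ultimately have "lifts \<tau> (\<lambda>r. if r \<le> T then g r else inv_into U (ex x) (\<alpha> r))"
        using g T by (auto simp: lifts_def)
      then show ?thesis by blast
    qed
    then show "\<exists>\<delta>>0. \<forall>\<tau>\<in>{T<..<T + \<delta>}. \<exists>g. lifts \<tau> g"
      using \<delta>(1) T by (intro exI[of _ "min \<delta> (b - T)"]) auto
  qed
  then show ?thesis by (auto simp: lifts_def)
qed

text \<open>Over a coordinate ball the section through \<open>v\<close> is built by lifting, from
  \<open>v\<close>, the coordinate segments issuing from the image of \<open>v\<close>; its value is
  the end point of the lift, continuous by \<open>lift_depends_continuously\<close>.\<close>

lemma evenly_covered_exp: "evenly_covered (ex x)"
proof -
  interpret L: local_homeo "ex x" by (rule local_homeo_exp)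
  show ?thesis
  proof
    fix y
    define k where "k = chart_at M y"
    have k: "k \<in> atlas M" "k \<in> maximal_atlas M" "y \<in> fst k" by (auto simp: k_def chart_at chart_at_maximal)
    interpret P: metric_patch "chart_image k" "metric_coords M k" by (rule metric_patch_chart[OF k(2)])
    obtain r where r: "0 < r" "ball (snd k y) r \<subseteq> chart_image k"
      using chartD(2,8)[OF k(2)] k(3) by (meson open_contains_ball)
    define N where "N = fst k \<inter> snd k -` ball (snd k y) r"
    have N: "open N" "y \<in> N"
      unfolding N_def using continuous_open_preimage[OF chartD(3,1)[OF k(2)] open_ball] k(3) r(1) by auto
    have "\<exists>\<sigma>. continuous_on N \<sigma> \<and> \<sigma> (ex x v) = v \<and> (\<forall>z\<in>N. ex x (\<sigma> z) = z)" if v: "ex x v \<in> N" for v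
    proof -
      define z where "z = ex x v"
      define l where "l b t = (1 - t) *\<^sub>R snd k z + t *\<^sub>R snd k b" for b and t :: real
      define h where "h b t = chart_inv k (l b t)" for b t
      have l_in: "l b t \<in> ball (snd k y) r" if "b \<in> N" "t \<in> {0..1}" for b t
        unfolding l_def using that v
        by (intro convexD[OF convex_ball]) (auto simp: N_def z_def)
      have l_im: "l b t \<in> chart_image k" if "b \<in> N" "t \<in> {0..1}" for b t
        using l_in[OF that] r(2) by blast
      have contl: "continuous_on (N \<times> UNIV) (\<lambda>(b, t). l b t)"
        unfolding l_def case_prod_unfold
        by (intro continuous_intros continuous_on_compose2[OF chartD(3)[OF k(2)] continuous_on_fst])
          (auto simp: N_def)
      have conth: "continuous_on (N \<times> {0..1}) (\<lambda>(b, t). h b t)"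
        unfolding h_def case_prod_unfold
        by (rule continuous_on_compose2[OF chartD(4)[OF k(2)], of _ "\<lambda>p. l (fst p) (snd p)"])
          (use continuous_on_subset[OF contl[unfolded case_prod_unfold], of "N \<times> {0..1}"] l_im in auto)
      have "\<exists>g. continuous_on {0..1} g \<and> g 0 = v \<and> (\<forall>t\<in>{0..1}. ex x (g t) = h b t)" if b: "b \<in> N" for b
      proof (rule speed_lift)
        define D where "D = snd k b - snd k z"
        have hk: "h b t \<in> fst k" "snd k (h b t) = l b t" if "t \<in> {0..1}" for t
          using l_im[OF b that] by (simp_all add: h_def chartD[OF k(2)])
        have "continuous_on {0..1} (\<lambda>t. (\<lambda>(b, t). h b t) (b, t))"
          by (rule continuous_on_compose2[OF conth]) (use b in \<open>auto intro!: continuous_intros\<close>)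
        then have ch: "continuous_on {0..1} (h b)" by simp
        have "continuous_on {0..1} (\<lambda>t. metric_coords M k (l b t) D D)"
          by (rule continuous_on_compose2[OF P.cont_G]) (use l_im[OF b] in \<open>auto simp: l_def intro!: continuous_intros\<close>)
        then have cs: "continuous_on {0..1} (\<lambda>t. sqrt (metric_coords M k (l b t) D D))"
          by (rule continuous_on_real_sqrt)
        have "\<exists>k'\<in>atlas M. h b t \<in> fst k' \<and> 0 \<le> sqrt (metric_coords M k (l b t) D D) \<and>
            (\<exists>D'. ((\<lambda>s. snd k' (h b s)) has_vector_derivative D') (at t) \<and>
             metric_coords M k' (snd k' (h b t)) D' D' \<le> (sqrt (metric_coords M k (l b t) D D))\<^sup>2)"
          if t: "t \<in> {0<..<1}" for t
        proof (intro bexI[of _ k] conjI exI[of _ D])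
          have t': "t \<in> {0..1}" using t by auto
          show "h b t \<in> fst k" by (rule hk(1)[OF t'])
          have nn: "0 \<le> metric_coords M k (l b t) D D" by (rule P.nonneg[OF l_im[OF b t']])
          then show "0 \<le> sqrt (metric_coords M k (l b t) D D)" by simp
          show "metric_coords M k (snd k (h b t)) D D \<le> (sqrt (metric_coords M k (l b t) D D))\<^sup>2"
            using nn hk(2)[OF t'] by simp
          have "(l b has_vector_derivative D) (at t)"
            unfolding l_def D_def by (auto intro!: derivative_eq_intros simp: algebra_simps)
          then show "((\<lambda>s. snd k (h b s)) has_vector_derivative D) (at t)"
            by (rule has_vector_derivative_transform_within_open[of _ _ _ "{0<..<1}"])
              (use t hk(2) in auto)
        qed (rule k(1))
        then show "speed_bound 0 1 (h b) (\<lambda>t. sqrt (metric_coords M k (l b t) D D))"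
          using ch cs unfolding speed_bound_def by blast
        show "ex x v = h b 0"
          using v by (simp add: h_def l_def z_def[symmetric] chartD[OF k(2)] N_def)
      qed simp
      then obtain g where g: "\<And>b. b \<in> N \<Longrightarrow> continuous_on {0..1} (g b)" "\<And>b. b \<in> N \<Longrightarrow> g b 0 = v"
        "\<And>b t. b \<in> N \<Longrightarrow> t \<in> {0..1} \<Longrightarrow> ex x (g b t) = h b t" by metis
      have "continuous_on N (\<lambda>b. g b 1)"
      proof (rule L.lift_depends_continuously[OF conth g(1,3)])
        show "continuous_on N (\<lambda>b. g b 0)" by (rule continuous_on_eq[of _ "\<lambda>_. v"]) (auto simp: g(2))
      qed
      moreover have "ex x (g b 1) = b" if "b \<in> N" for b
        using g(3)[OF that, of 1] that by (simp add: h_def l_def chartD[OF k(2)] N_def)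
      \<comment> \<open>The segment from \<open>z\<close> to itself is constant, and so is its lift;
        hence the section passes through \<open>v\<close>.\<close>
      moreover have "g z 1 = v"
      proof (rule L.lift_unique[where S = "{0..1}" and s = 0])
        show "continuous_on {0..1} (g z)" using g(1) v by (simp add: z_def)
        have "l z t = snd k z" for t by (simp add: l_def algebra_simps)
        then show "ex x (g z t) = ex x v" if "t \<in> {0..1}" for t
          using g(3)[OF _ that, of z] v by (simp add: h_def z_def[symmetric] chartD[OF k(2)] N_def)
      qed (use g(2) v in \<open>auto simp: z_def\<close>)
      ultimately show ?thesis unfolding z_def by blast
    qed
    then show "\<exists>N. open N \<and> y \<in> N \<and> (\<forall>v. ex x v \<in> N \<longrightarrow>
        (\<exists>\<sigma>. continuous_on N \<sigma> \<and> \<sigma> (ex x v) = v \<and> (\<forall>z\<in>N. ex x (\<sigma> z) = z)))"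
      using N by blast
  qed
qed

lemma bij_exp_map: "bij (ex x)"
  using evenly_covered.bij_if_simply_connected[OF evenly_covered_exp] hadamard
  by (simp add: hadamard_manifold_def)

end

section \<open>The Riemannian distance\<close>

context hadamard
begin

text \<open>The speed in the open interval has a continuous extension to the end points, where
  \<open>velocity\<close> need not be meaningful.\<close>

lemma C1_curve_speed:
  assumes c: "C1_curve_on M a b c" and ab: "a < b"
  shows "\<exists>sp. speed_bound a b c sp \<and> (\<forall>t\<in>{a<..<b}. sp t = tnorm M (c t) (velocity M c t))"
proof -
  have cont: "continuous_on {a..b} c" using c by (simp add: C1_curve_on_def)
  obtain D where "\<forall>k\<in>maximal_atlas M. continuous_on {t\<in>{a..b}. c t \<in> fst k} (D k) \<and>
      (\<forall>t\<in>{a..b}. c t \<in> fst k \<longrightarrow> ((\<lambda>s. snd k (c s)) has_vector_derivative D k t) (at t within {a..b}))"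
    using bchoice[OF conjunct2[OF c[unfolded C1_curve_on_def]]] ..
  then have D: "\<And>k. k \<in> maximal_atlas M \<Longrightarrow> continuous_on {t\<in>{a..b}. c t \<in> fst k} (D k)"
    "\<And>k t. \<lbrakk>k \<in> maximal_atlas M; t \<in> {a..b}; c t \<in> fst k\<rbrakk> \<Longrightarrow>
       ((\<lambda>s. snd k (c s)) has_vector_derivative D k t) (at t within {a..b})"
    by blast+
  \<comment> \<open>Built from the one-sided derivatives of the C1 condition. The chart varies with
    \<open>t\<close>, so continuity is checked in a fixed chart by means of
    \<open>sp_eq\<close>.\<close>
  define sp where "sp t = sqrt (metric_coords M (chart_at M (c t)) (snd (chart_at M (c t)) (c t))
    (D (chart_at M (c t)) t) (D (chart_at M (c t)) t))" for t
  have sp_eq: "sp t = sqrt (metric_coords M k (snd k (c t)) (D k t) (D k t))"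
    if t: "t \<in> {a..b}" and k: "k \<in> atlas M" "c t \<in> fst k" for t k
  proof -
    define d where "d = chart_at M (c t)"
    have d: "d \<in> atlas M" "d \<in> maximal_atlas M" "c t \<in> fst d" by (auto simp: d_def chart_at chart_at_maximal)
    have o: "overlapping k d" by (rule overlapping_atlas[OF atlas_maximal[OF k(1)] d(1)])
    have ct: "continuous (at t within {a..b}) c" using cont t by (simp add: continuous_on_eq_continuous_within)
    have "((\<lambda>s. snd d (c s)) has_vector_derivative Dtransition k d (snd k (c t)) (D k t)) (at t within {a..b})"
      by (rule coord_derivative_change[OF o k(2) d(3) ct t D(2)[OF atlas_maximal[OF k(1)] t k(2)]])
    moreover have "at t within {a..b} \<noteq> bot" using t ab by (simp add: trivial_limit_within islimpt_Icc)
    ultimately have "D d t = Dtransition k d (snd k (c t)) (D k t)"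
      using vector_derivative_unique_within D(2)[OF d(2) t d(3)] by blast
    then show ?thesis
      using metric_coords_invariant[OF o k(2) d(3)] by (simp add: sp_def d_def[symmetric])
  qed
  have "continuous_on {a..b} sp"
    unfolding continuous_on_def
  proof
    fix t assume t: "t \<in> {a..b}"
    define k where "k = chart_at M (c t)"
    have k: "k \<in> atlas M" "k \<in> maximal_atlas M" "c t \<in> fst k" by (auto simp: k_def chart_at chart_at_maximal)
    interpret P: metric_patch "chart_image k" "metric_coords M k" by (rule metric_patch_chart[OF k(2)])
    have ct: "(c \<longlongrightarrow> c t) (at t within {a..b})" using cont t by (simp add: continuous_on_def)
    have ev: "\<forall>\<^sub>F s in at t within {a..b}. c s \<in> fst k \<and> s \<in> {a..b}"
      using topological_tendstoD[OF ct chartD(1)[OF k(2)] k(3)]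
      by (auto simp: eventually_at_filter elim: eventually_mono)
    have "((\<lambda>s. snd k (c s)) \<longlongrightarrow> snd k (c t)) (at t within {a..b})"
      by (rule isCont_tendsto_compose[OF _ ct])
        (use chartD(1,3)[OF k(2)] k(3) in \<open>simp add: continuous_on_eq_continuous_at\<close>)
    moreover have "(D k \<longlongrightarrow> D k t) (at t within {a..b})"
    proof -
      have "(D k \<longlongrightarrow> D k t) (at t within {t\<in>{a..b}. c t \<in> fst k})"
        using D(1)[OF k(2)] t k(3) by (simp add: continuous_on_def)
      moreover have "at t within {t\<in>{a..b}. c t \<in> fst k} = at t within {a..b}"
      proof (rule antisym)
        show "at t within {t\<in>{a..b}. c t \<in> fst k} \<le> at t within {a..b}" by (rule at_le) auto
        show "at t within {a..b} \<le> at t within {t\<in>{a..b}. c t \<in> fst k}"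
          unfolding le_filter_def
        proof (intro allI impI)
          fix P assume "\<forall>\<^sub>F s in at t within {t\<in>{a..b}. c t \<in> fst k}. P s"
          then have "\<forall>\<^sub>F s in at t within {a..b}. c s \<in> fst k \<longrightarrow> P s"
            unfolding eventually_at_filter by (auto elim: eventually_mono)
          with ev show "\<forall>\<^sub>F s in at t within {a..b}. P s" by eventually_elim simp
        qed
      qed
      ultimately show ?thesis by simp
    qed
    ultimately have "((\<lambda>s. sqrt (metric_coords M k (snd k (c s)) (D k s) (D k s))) \<longlongrightarrow>
        sqrt (metric_coords M k (snd k (c t)) (D k t) (D k t))) (at t within {a..b})"
      by (intro tendsto_real_sqrt P.tendsto_G chartD(8)[OF k(2,3)])
    then have "(sp \<longlongrightarrow> sqrt (metric_coords M k (snd k (c t)) (D k t) (D k t))) (at t within {a..b})"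
    proof (rule Lim_transform_eventually)
      show "\<forall>\<^sub>F s in at t within {a..b}. sqrt (metric_coords M k (snd k (c s)) (D k s) (D k s)) = sp s"
        using ev by eventually_elim (simp add: sp_eq[OF _ k(1)])
    qed
    then show "(sp \<longlongrightarrow> sp t) (at t within {a..b})" by (simp add: sp_eq[OF t k(1,3)])
  qed
  moreover have "\<exists>k\<in>atlas M. c t \<in> fst k \<and> 0 \<le> sp t \<and>
      (\<exists>D. ((\<lambda>s. snd k (c s)) has_vector_derivative D) (at t) \<and> metric_coords M k (snd k (c t)) D D \<le> (sp t)\<^sup>2)
      \<and> sp t = tnorm M (c t) (velocity M c t)"
    if t: "t \<in> {a<..<b}" for t
  proof -
    define k where "k = chart_at M (c t)"
    have k: "k \<in> atlas M" "k \<in> maximal_atlas M" "c t \<in> fst k" by (auto simp: k_def chart_at chart_at_maximal)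
    interpret P: metric_patch "chart_image k" "metric_coords M k" by (rule metric_patch_chart[OF k(2)])
    have t': "t \<in> {a..b}" using t by simp
    have Dk: "((\<lambda>s. snd k (c s)) has_vector_derivative D k t) (at t)"
      using D(2)[OF k(2) t' k(3)] t by (simp add: at_within_Icc_at)
    have nn: "0 \<le> metric_coords M k (snd k (c t)) (D k t) (D k t)" by (rule P.nonneg[OF chartD(8)[OF k(2,3)]])
    have "isCont c t"
      using cont t t' by (metis at_within_Icc_at continuous_on_eq_continuous_within greaterThanLessThan_iff)
    from velocity_eq(2)[OF k(2,3) this Dk]
    have "sp t = tnorm M (c t) (velocity M c t)" by (simp add: sp_eq[OF t' k(1,3)] tnorm_def)
    moreover have "metric_coords M k (snd k (c t)) (D k t) (D k t) \<le> (sp t)\<^sup>2" "0 \<le> sp t"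
      using nn by (simp_all add: sp_eq[OF t' k(1,3)])
    ultimately show ?thesis using k Dk by blast
  qed
  ultimately show ?thesis using cont unfolding speed_bound_def by blast
qed

text \<open>The curve is lifted piece by piece from \<open>v\<close>; injectivity of the exponential
  map forces the lift to end at \<open>w\<close>.\<close>

lemma curve_length_ge:
  assumes c: "piecewise_C1_path M c" and start: "pathstart c = ex x v" and finish: "pathfinish c = ex x w"
  shows "tnorm M x (w - v) \<le> curve_length M c"
proof -
  define F where "F t = tnorm M (c t) (velocity M c t)" for t
  obtain n :: nat and \<tau> where \<tau>: "\<tau> 0 = 0" "\<tau> n = 1" "\<And>i. i < n \<Longrightarrow> \<tau> i < \<tau> (Suc i)"
    "\<And>i. i < n \<Longrightarrow> C1_curve_on M (\<tau> i) (\<tau> (Suc i)) c"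
    using c unfolding piecewise_C1_path_def by blast
  \<comment> \<open>The vector \<open>u\<close> is the end point of the lift so far. Integrability
    is carried along, since otherwise the integrals over the pieces could not be added.\<close>
  have "i \<le> n \<Longrightarrow> 0 \<le> \<tau> i \<and> F integrable_on {0..\<tau> i} \<and>
      (\<exists>u. ex x u = c (\<tau> i) \<and> tnorm M x (u - v) \<le> integral {0..\<tau> i} F)" for i
  proof (induction i)
    case 0
    have "F integrable_on {0}" using integrable_on_refl[of F "0::real"] by simp
    then show ?case using start by (auto intro!: exI[of _ v] simp: \<tau>(1) tnorm_0 pathstart_def)
  next
    case (Suc i)
    then have i: "i < n" by simp
    obtain u where IH: "0 \<le> \<tau> i" "F integrable_on {0..\<tau> i}" "ex x u = c (\<tau> i)"
      "tnorm M x (u - v) \<le> integral {0..\<tau> i} F" using Suc by auto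
    obtain sp where sp: "speed_bound (\<tau> i) (\<tau> (Suc i)) c sp" "\<And>t. t \<in> {\<tau> i<..<\<tau> (Suc i)} \<Longrightarrow> sp t = F t"
      using C1_curve_speed[OF \<tau>(4)[OF i] \<tau>(3)[OF i]] unfolding F_def by blast
    have le: "\<tau> i \<le> \<tau> (Suc i)" using \<tau>(3)[OF i] by simp
    obtain g where g: "continuous_on {\<tau> i..\<tau> (Suc i)} g" "g (\<tau> i) = u"
      "\<And>t. t \<in> {\<tau> i..\<tau> (Suc i)} \<Longrightarrow> ex x (g t) = c t"
      using speed_lift[OF sp(1) le IH(3)] by blast
    have sp': "speed_bound (\<tau> i) (\<tau> (Suc i)) (\<lambda>t. ex x (g t)) sp"
      by (rule speed_bound_cong[OF sp(1)]) (simp add: g(3))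
    have 1: "tnorm M x (g (\<tau> (Suc i)) - u) \<le> integral {\<tau> i..\<tau> (Suc i)} sp"
      using lift_length[OF sp' g(1) le] by (simp add: g(2))
    have int_sp: "sp integrable_on {\<tau> i..\<tau> (Suc i)}"
      using sp(1) by (auto simp: speed_bound_def intro: integrable_continuous_interval)
    have spike: "F t = sp t" if "t \<in> {\<tau> i..\<tau> (Suc i)} - {\<tau> i, \<tau> (Suc i)}" for t
      using that by (intro sp(2)[symmetric]) auto
    have neg: "negligible {\<tau> i, \<tau> (Suc i)}" by simp
    have int_F: "F integrable_on {\<tau> i..\<tau> (Suc i)}"
      by (rule integrable_spike[OF int_sp neg]) (rule spike)
    have eq: "integral {\<tau> i..\<tau> (Suc i)} F = integral {\<tau> i..\<tau> (Suc i)} sp"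
      by (rule integral_spike[OF neg]) (simp add: spike)
    have int: "F integrable_on {0..\<tau> (Suc i)}"
      by (rule Henstock_Kurzweil_Integration.integrable_combine[OF IH(1) le IH(2) int_F])
    have "integral {0..\<tau> i} F + integral {\<tau> i..\<tau> (Suc i)} F = integral {0..\<tau> (Suc i)} F"
      by (rule Henstock_Kurzweil_Integration.integral_combine[OF IH(1) le int])
    moreover have "tnorm M x (g (\<tau> (Suc i)) - v) \<le> tnorm M x (g (\<tau> (Suc i)) - u) + tnorm M x (u - v)"
      using tnorm_triangle[of x "g (\<tau> (Suc i)) - u" "u - v"] by simp
    ultimately have "tnorm M x (g (\<tau> (Suc i)) - v) \<le> integral {0..\<tau> (Suc i)} F"
      using 1 IH(4) eq by linarith
    moreover have "ex x (g (\<tau> (Suc i))) = c (\<tau> (Suc i))" using g(3) le by simp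
    ultimately show ?case using int IH(1) le by auto
  qed
  from this[of n] obtain u where u: "ex x u = c 1" "tnorm M x (u - v) \<le> integral {0..1} F"
    by (auto simp: \<tau>(2))
  have "ex x u = ex x w" using u(1) finish by (simp add: pathfinish_def)
  then have "u = w" using bij_exp_map[of x] by (simp add: bij_def inj_eq)
  then show ?thesis using u(2) by (simp add: curve_length_def F_def[abs_def])
qed

lemma geo_path:
  "piecewise_C1_path M (geo x v)" "curve_length M (geo x v) = tnorm M x v"
proof -
  have "C1_curve_on M 0 1 (geo x v)"
    unfolding C1_curve_on_def
  proof (intro conjI ballI)
    show "continuous_on {0..1} (geo x v)"
      by (intro continuous_at_imp_continuous_on ballI geodesic_isCont[OF geo(1)])
    fix k assume k: "k \<in> maximal_atlas M"
    show "\<exists>D. continuous_on {t \<in> {0..1}. geo x v t \<in> fst k} D \<and>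
        (\<forall>t\<in>{0..1}. geo x v t \<in> fst k \<longrightarrow>
          ((\<lambda>s. snd k (geo x v s)) has_vector_derivative D t) (at t within {0..1}))"
    proof (intro exI[of _ "coord_velocity k (geo x v)"] conjI ballI impI)
      show "continuous_on {t \<in> {0..1}. geo x v t \<in> fst k} (coord_velocity k (geo x v))"
        by (intro continuous_at_imp_continuous_on ballI
            has_vector_derivative_continuous[OF geodesic_coords(2)[OF geo(1) k]]) simp
    qed (rule has_vector_derivative_at_within[OF geodesic_coords(1)[OF geo(1) k]])
  qed
  then show "piecewise_C1_path M (geo x v)"
    unfolding piecewise_C1_path_def by (intro exI[of _ 1] exI[of _ real]) simp
  show "curve_length M (geo x v) = tnorm M x v"
    by (simp add: curve_length_def geo_speed)
qed

text \<open>If the speed is not integrable, the integral is 0 by convention. The bound makes the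
  infimum in \<open>rdist\<close> one of a set bounded below.\<close>

lemma curve_length_nonneg: "0 \<le> curve_length M c"
  unfolding curve_length_def
  by (cases "(\<lambda>t. tnorm M (c t) (velocity M c t)) integrable_on {0..1}")
    (auto intro: integral_nonneg simp: tnorm_nonneg not_integrable_integral)

lemma rdist_exp_le: "rdist M x (ex x v) \<le> tnorm M x v"
  unfolding rdist_def
proof (rule cInf_lower)
  show "tnorm M x v \<in> {curve_length M c |c. piecewise_C1_path M c \<and> pathstart c = x \<and> pathfinish c = ex x v}"
    using geo_path[of x v] by (auto intro!: exI[of _ "geo x v"] simp: pathstart_def pathfinish_def geo exp_map_eq)
  show "bdd_below {curve_length M c |c. piecewise_C1_path M c \<and> pathstart c = x \<and> pathfinish c = ex x v}"
    by (rule bdd_belowI[of _ 0]) (auto simp: curve_length_nonneg)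
qed

lemma exp_map_surj: "\<exists>v. y = ex x v"
  using bij_exp_map[of x] by (auto simp: bij_def dest: surjD)

text \<open>The infimum form of \<open>curve_length_ge\<close>. The set of lengths has to be
  nonempty for this; a geodesic between the two points, which exists by surjectivity of the
  exponential map at the first, is a member.\<close>

lemma rdist_expanding: "tnorm M x (w - v) \<le> rdist M (ex x v) (ex x w)"
  unfolding rdist_def
proof (rule cInf_greatest)
  obtain u where "ex x w = ex (ex x v) u" using exp_map_surj by blast
  then have "curve_length M (geo (ex x v) u)
      \<in> {curve_length M c |c. piecewise_C1_path M c \<and> pathstart c = ex x v \<and> pathfinish c = ex x w}"
    using geo_path by (auto intro!: exI[of _ "geo (ex x v) u"] simp: pathstart_def pathfinish_def geo exp_map_eq)
  then show "{curve_length M c |c. piecewise_C1_path M c \<and> pathstart c = ex x v \<and> pathfinish c = ex x w} \<noteq> {}"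
    by blast
qed (auto intro: curve_length_ge)

lemma rdist_exp: "rdist M x (ex x v) = tnorm M x v"
  using rdist_exp_le[of x v] rdist_expanding[of x v 0] by (simp add: exp_map_0)

text \<open>Read off from the reversed minimizing geodesic, which has the same speed; arbitrary
  curves need not be reversed.\<close>

lemma rdist_sym: "rdist M x y = rdist M y x"
proof -
  obtain v where y: "y = ex x v" using exp_map_surj by blast
  define V where "V = velocity M (geo x v) 1"
  have "x = ex y (- V)" using geo_affine[of x v 1 "-1" 1] by (simp add: y V_def exp_map_eq geo)
  then have "rdist M y x = tnorm M y (- V)" using rdist_exp by metis
  also have "\<dots> = tnorm M x v" using geo_speed[of x v 1] by (simp add: tnorm_minus y V_def exp_map_eq)
  finally show ?thesis by (simp add: y rdist_exp)
qed

lemma rdist_nonneg: "0 \<le> rdist M x y"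
proof -
  obtain v where "y = ex x v" using exp_map_surj by blast
  then show ?thesis by (simp add: rdist_exp tnorm_nonneg)
qed

text \<open>The triangle inequality follows from the expansion property at \<open>x\<close> and the one for \<open>tnorm M x\<close>.\<close>

lemma rdist_triangle: "rdist M x z \<le> rdist M x y + rdist M y z"
proof -
  obtain v w where "y = ex x v" "z = ex x w" using exp_map_surj by metis
  then show ?thesis
    using rdist_expanding[of x w v] tnorm_triangle[of x "w - v" v] by (simp add: rdist_exp)
qed

lemma rdist_geo: "rdist M (geo x u s) (geo x u t) = \<bar>t - s\<bar> * tnorm M x u"
proof -
  define V where "V = velocity M (geo x u) s"
  have "geo x u t = ex (geo x u s) ((t - s) *\<^sub>R V)"
    using geo_affine[of x u s "t - s" 1] by (simp add: V_def exp_map_eq)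
  then have "rdist M (geo x u s) (geo x u t) = tnorm M (geo x u s) ((t - s) *\<^sub>R V)" by (simp add: rdist_exp)
  then show ?thesis by (simp add: tnorm_scale V_def geo_speed)
qed

text \<open>The CAT(0) inequality is the expansion property at the point \<open>geo y u s\<close>.\<close>

lemma rdist_CN:
  assumes s: "0 \<le> s" "s \<le> 1"
  shows "(rdist M (geo y u s) z)\<^sup>2 \<le> (1 - s) * (rdist M y z)\<^sup>2 + s * (rdist M (geo y u 1) z)\<^sup>2
    - s * (1 - s) * (tnorm M y u)\<^sup>2"
proof -
  define m where "m = geo y u s"
  define V where "V = velocity M (geo y u) s"
  obtain w where z: "z = ex m w" using exp_map_surj by blast
  have y: "y = ex m (- s *\<^sub>R V)"
    using geo_affine[of y u s "-s" 1] by (simp add: m_def V_def exp_map_eq geo)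
  have y1: "geo y u 1 = ex m ((1 - s) *\<^sub>R V)"
    using geo_affine[of y u s "1 - s" 1] by (simp add: m_def V_def exp_map_eq)
  have V: "(tnorm M y u)\<^sup>2 = rmetric M m V V"
    by (simp add: m_def V_def tnorm_power2[symmetric] geo_speed)
  have "(tnorm M m (w + s *\<^sub>R V))\<^sup>2 \<le> (rdist M y z)\<^sup>2"
    using rdist_expanding[of m w "- s *\<^sub>R V"] by (intro power_mono) (simp_all add: y z tnorm_nonneg)
  then have 1: "rmetric M m w w + 2 * s * rmetric M m w V + s\<^sup>2 * rmetric M m V V \<le> (rdist M y z)\<^sup>2"
    unfolding tnorm_power2
    by (simp add: rmetric_simps rmetric_sym[of m V w] power2_eq_square algebra_simps)
  have "(tnorm M m (w - (1 - s) *\<^sub>R V))\<^sup>2 \<le> (rdist M (geo y u 1) z)\<^sup>2"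
    using rdist_expanding[of m w "(1 - s) *\<^sub>R V"] by (intro power_mono) (simp_all add: y1 z tnorm_nonneg)
  then have 2: "rmetric M m w w - 2 * (1 - s) * rmetric M m w V + (1 - s)\<^sup>2 * rmetric M m V V
      \<le> (rdist M (geo y u 1) z)\<^sup>2"
    unfolding tnorm_power2
    by (simp add: rmetric_simps rmetric_sym[of m V w] power2_eq_square algebra_simps)
  \<comment> \<open>Stewart's identity in the Euclidean space at \<open>m\<close>: with these
    weights the inner products of \<open>w\<close> and \<open>V\<close> cancel.\<close>
  have "(1 - s) * (rmetric M m w w + 2 * s * rmetric M m w V + s\<^sup>2 * rmetric M m V V)
      + s * (rmetric M m w w - 2 * (1 - s) * rmetric M m w V + (1 - s)\<^sup>2 * rmetric M m V V)
      = rmetric M m w w + s * (1 - s) * rmetric M m V V"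
    by (simp add: power2_eq_square algebra_simps)
  moreover have "(rdist M m z)\<^sup>2 = rmetric M m w w" by (simp add: z rdist_exp tnorm_power2)
  moreover note mult_left_mono[OF 1, of "1 - s"] mult_left_mono[OF 2, of s]
  ultimately show ?thesis using s by (simp add: m_def[symmetric] V)
qed

text \<open>The CAT(0) inequality is used twice, on the geodesic from \<open>a\<close> with the
  point \<open>geo b w s\<close> and on the geodesic from \<open>b\<close> with the point
  \<open>a\<close>; the squared lengths of both sides then cancel exactly.\<close>

lemma rdist_common_endpoint:
  assumes s: "0 \<le> s" "s \<le> 1" and q: "geo a u 1 = geo b w 1"
  shows "rdist M (geo a u s) (geo b w s) \<le> (1 - s) * rdist M a b"
proof (rule power2_le_imp_le)
  define q where "q = geo a u 1"
  have qb: "geo b w 1 = q" using assms by (simp add: q_def)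
  have aq: "rdist M a q = tnorm M a u" and bq: "rdist M b q = tnorm M b w"
    unfolding qb[symmetric] q_def using rdist_geo[of a u 0 1] rdist_geo[of b w 0 1] q by (simp_all add: geo)
  have qm: "rdist M q (geo b w s) = (1 - s) * tnorm M b w"
    using rdist_geo[of b w 1 s] s by (simp add: qb)
  have 1: "(rdist M (geo a u s) (geo b w s))\<^sup>2 \<le> (1 - s) * (rdist M a (geo b w s))\<^sup>2
      + s * ((1 - s) * tnorm M b w)\<^sup>2 - s * (1 - s) * (tnorm M a u)\<^sup>2"
    using rdist_CN[OF s, of a u "geo b w s"] by (simp add: q_def[symmetric] qm)
  have 2: "(rdist M a (geo b w s))\<^sup>2 \<le> (1 - s) * (rdist M a b)\<^sup>2 + s * (tnorm M a u)\<^sup>2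
      - s * (1 - s) * (tnorm M b w)\<^sup>2"
    using rdist_CN[OF s, of b w a] by (simp add: qb rdist_sym[of _ a] aq)
  have "(1 - s) * (rdist M a (geo b w s))\<^sup>2 \<le> (1 - s) * ((1 - s) * (rdist M a b)\<^sup>2 + s * (tnorm M a u)\<^sup>2
      - s * (1 - s) * (tnorm M b w)\<^sup>2)"
    using 2 s by (intro mult_left_mono) auto
  with 1 show "(rdist M (geo a u s) (geo b w s))\<^sup>2 \<le> ((1 - s) * rdist M a b)\<^sup>2"
    by (simp add: power2_eq_square algebra_simps)
qed (use s rdist_nonneg in simp)

section \<open>Asymptotic rays\<close>

lemma asymptotic_iff: "asymptotic M \<gamma> \<sigma> \<longleftrightarrow> (\<exists>B. \<forall>t\<ge>0. rdist M (\<gamma> t) (\<sigma> t) \<le> B)"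
  unfolding asymptotic_def bounded_iff using rdist_nonneg by (auto simp: abs_of_nonneg)

lemma asymptotic_unique:
  assumes 1: "asymptotic M (ray M x u) \<gamma>" and 2: "asymptotic M (ray M x u') \<gamma>"
  shows "u = u'"
proof (rule ccontr)
  assume "u \<noteq> u'"
  then have pos: "0 < tnorm M x (u' - u)" by (intro tnorm_pos) simp
  obtain B B' where B: "\<And>t. 0 \<le> t \<Longrightarrow> rdist M (ray M x u t) (\<gamma> t) \<le> B"
    "\<And>t. 0 \<le> t \<Longrightarrow> rdist M (ray M x u' t) (\<gamma> t) \<le> B'"
    using 1 2 unfolding asymptotic_iff by blast
  have bd: "t * tnorm M x (u' - u) \<le> B + B'" if t: "0 \<le> t" for t
  proof -
    have "t * tnorm M x (u' - u) = tnorm M x (t *\<^sub>R u' - t *\<^sub>R u)"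
      using t by (simp add: tnorm_scale scaleR_diff_right[symmetric])
    also have "\<dots> \<le> rdist M (ray M x u t) (ray M x u' t)"
      unfolding ray_def by (rule rdist_expanding)
    also have "\<dots> \<le> rdist M (ray M x u t) (\<gamma> t) + rdist M (\<gamma> t) (ray M x u' t)" by (rule rdist_triangle)
    also have "\<dots> \<le> B + B'" using B[OF t] by (simp add: rdist_sym[of "\<gamma> t"])
    finally show ?thesis .
  qed
  \<comment> \<open>At this time the linear lower bound for the distance of the two rays exceeds
    \<open>B + B'\<close>.\<close>
  define t where "t = (\<bar>B + B'\<bar> + 1) / tnorm M x (u' - u)"
  have "0 \<le> t" using pos by (simp add: t_def)
  from bd[OF this] show False using pos by (simp add: t_def)
qed

text \<open>Links the topology of the manifold with the distance: the inverse of the exponential map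
  at \<open>y\<close> is continuous, so the distance to \<open>y\<close>, being the norm of a
  preimage, tends to 0.\<close>

lemma rdist_tendsto:
  assumes "(f \<longlongrightarrow> y) F"
  shows "((\<lambda>n. rdist M (f n) z) \<longlongrightarrow> rdist M y z) F"
proof -
  interpret L: local_homeo "ex y" by (rule local_homeo_exp)
  have bij: "inj (ex y)" "surj (ex y)" using bij_exp_map[of y] by (auto simp: bij_def)
  have "continuous_on UNIV (inv (ex y))" using L.local_inverse[of UNIV] bij by simp
  then have "isCont (inv (ex y)) y" by (simp add: continuous_on_eq_continuous_at)
  from isCont_tendsto_compose[OF this assms]
  have "((\<lambda>n. inv (ex y) (f n)) \<longlongrightarrow> inv (ex y) y) F" .
  moreover have "inv (ex y) y = 0" using inv_f_f[OF bij(1), of 0] by (simp add: exp_map_0)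
  ultimately have lim: "((\<lambda>n. inv (ex y) (f n)) \<longlongrightarrow> 0) F" by simp
  obtain C where C: "\<And>v. tnorm M y v \<le> C * norm v" using tnorm_upper by metis
  have dist: "rdist M y (f n) \<le> C * norm (inv (ex y) (f n))" for n
  proof -
    have "rdist M y (f n) = tnorm M y (inv (ex y) (f n))"
      using rdist_exp[of y "inv (ex y) (f n)"] by (simp add: surj_f_inv_f[OF bij(2)])
    then show ?thesis using C by simp
  qed
  have "((\<lambda>n. rdist M (f n) z - rdist M y z) \<longlongrightarrow> 0) F"
  proof (rule Lim_null_comparison)
    have "norm (rdist M (f n) z - rdist M y z) \<le> C * norm (inv (ex y) (f n))" for n
      using rdist_triangle[of "f n" z y] rdist_triangle[of y z "f n"] dist[of n] rdist_sym[of y "f n"]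
      by (simp add: abs_le_iff)
    then show "\<forall>\<^sub>F n in F. norm (rdist M (f n) z - rdist M y z) \<le> C * norm (inv (ex y) (f n))" by simp
    show "((\<lambda>n. C * norm (inv (ex y) (f n))) \<longlongrightarrow> 0) F"
      using tendsto_mult_right_zero[OF tendsto_norm_zero[OF lim]] .
  qed
  then show ?thesis by (rule LIM_zero_cancel)
qed

lemma compact_unit_tangent: "compact {u. tnorm M x u = 1}"
proof -
  obtain c where c: "0 < c" "\<And>v. c * norm v \<le> tnorm M x v" using tnorm_coercive by metis
  have "norm u \<le> 1 / c" if "tnorm M x u = 1" for u using c(2)[of u] c(1) that by (simp add: field_simps)
  then have "bounded {u. tnorm M x u = 1}" by (auto simp: bounded_iff)
  moreover have "continuous_on UNIV (\<lambda>u. tnorm M x u)"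
  proof -
    have "((\<lambda>u. metric_coords M (chart_at M x) (snd (chart_at M x) x) u u) \<longlongrightarrow>
        metric_coords M (chart_at M x) (snd (chart_at M x) x) v v) (at v)" for v
      by (rule metric_patch.tendsto_G[OF tangent_patch(1) tendsto_const tangent_patch(2)])
        (rule tendsto_ident_at)+
    then have "((\<lambda>u. tnorm M x u) \<longlongrightarrow> tnorm M x v) (at v)" for v
      unfolding tnorm_def rmetric_chart_at by (intro tendsto_real_sqrt)
    then show ?thesis by (simp add: continuous_on_def)
  qed
  then have "closed ((\<lambda>u. tnorm M x u) -` {1})" by (intro closed_vimage) auto
  then have "closed {u. tnorm M x u = 1}" by (simp add: vimage_def)
  ultimately show ?thesis by (simp add: compact_eq_bounded_closed)
qed

text \<open>The ray from \<open>x\<close> asymptotic to \<open>\<gamma>\<close> is a limit of the geodesics from \<open>x\<close> to \<open>\<gamma>(n)\<close>.\<close>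

lemma asymptotic_exists:
  assumes \<eta>: "tnorm M p \<eta> = 1"
  shows "\<exists>u. tnorm M x u = 1 \<and> asymptotic M (ray M p \<eta>) (ray M x u)"
proof -
  define D where "D = rdist M x p"
  have "\<exists>w. ray M p \<eta> (real n) = ex x w" for n using exp_map_surj by blast
  then obtain w where w: "\<And>n. ray M p \<eta> (real n) = ex x (w n)" by metis
  define l where "l n = tnorm M x (w n)" for n
  have d_ray: "rdist M p (ray M p \<eta> t) = t" if "0 \<le> t" for t
    using that by (simp add: ray_def rdist_exp tnorm_scale \<eta>)
  have l_dist: "l n = rdist M x (ray M p \<eta> (real n))" for n by (simp add: l_def w rdist_exp)
  have l_bound: "\<bar>real n - l n\<bar> \<le> D" for n
    using rdist_triangle[of x "ray M p \<eta> (real n)" p] rdist_triangle[of p "ray M p \<eta> (real n)" x]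
    by (simp add: l_dist d_ray D_def rdist_sym[of p x] abs_le_iff)
  define u where "u n = w n /\<^sub>R l n" for n
  \<comment> \<open>One \<open>D\<close> bounds the distance at equal fractions of two geodesics
    with a common end point; the other bounds the shift in parameter, as the lengths
    \<open>real n\<close> and \<open>l n\<close> differ by at most \<open>D\<close>.\<close>
  have est: "rdist M (ray M p \<eta> t) (ex x (t *\<^sub>R u n)) \<le> 2 * D" if t: "0 \<le> t" "t \<le> l n" "0 < l n" for t n
  proof -
    define s where "s = t / l n"
    have s: "0 \<le> s" "s \<le> 1" using t by (auto simp: s_def)
    have 1: "ex x (t *\<^sub>R u n) = geo x (w n) s"
      by (simp add: geo_eq_exp_map u_def s_def divide_inverse)
    have 2: "ray M p \<eta> r = geo p (real n *\<^sub>R \<eta>) (r / real n)" if "0 < n" for r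
      using that by (simp add: ray_eq geo_scale)
    have "geo x (w n) 1 = geo p (real n *\<^sub>R \<eta>) 1"
      using w[of n] by (simp add: exp_map_eq ray_eq geo_scale)
    from rdist_common_endpoint[OF s this]
    have "rdist M (geo x (w n) s) (geo p (real n *\<^sub>R \<eta>) s) \<le> (1 - s) * D" by (simp add: D_def)
    also have "\<dots> \<le> D" using s rdist_nonneg[of x p] by (simp add: D_def mult_left_le_one_le)
    finally have 3: "rdist M (geo x (w n) s) (geo p \<eta> (real n * s)) \<le> D" by (simp add: geo_scale)
    have "rdist M (geo p \<eta> t) (geo p \<eta> (real n * s)) = \<bar>real n * s - t\<bar>" by (simp add: rdist_geo \<eta>)
    also have "real n * s - t = s * (real n - l n)" using t by (simp add: s_def field_simps)
    also have "\<bar>\<dots>\<bar> \<le> 1 * D" unfolding abs_mult using s l_bound[of n] by (intro mult_mono) auto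
    finally have 4: "rdist M (geo p \<eta> t) (geo p \<eta> (real n * s)) \<le> D" by simp
    have "rdist M (geo p \<eta> t) (geo x (w n) s)
        \<le> rdist M (geo p \<eta> t) (geo p \<eta> (real n * s)) + rdist M (geo p \<eta> (real n * s)) (geo x (w n) s)"
      by (rule rdist_triangle)
    then show ?thesis using 3 4 by (simp add: 1 ray_eq rdist_sym[of "geo p \<eta> (real n * s)"])
  qed
  \<comment> \<open>Shifting the index by \<open>N\<close> makes the lengths positive, so that the
    normalized directions are unit vectors, and gives \<open>l (r n + N)\<close> at least
    \<open>r n\<close>.\<close>
  obtain N :: nat where N: "D < real N" using reals_Archimedean2 by blast
  have lpos: "0 < l (n + N)" for n using l_bound[of "n + N"] N by (simp add: abs_le_iff)
  have "u (n + N) \<in> {u. tnorm M x u = 1}" for n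
    using lpos[of n] by (simp add: u_def tnorm_scale l_def)
  then obtain u0 r where u0: "tnorm M x u0 = 1" and r: "strict_mono r" and lim: "(\<lambda>n. u (r n + N)) \<longlonglongrightarrow> u0"
    using compact_unit_tangent[of x] unfolding compact_def
    by (auto simp: o_def dest!: spec[of _ "\<lambda>n. u (n + N)"])
  have "rdist M (ray M p \<eta> t) (ray M x u0 t) \<le> 2 * D" if t: "0 \<le> t" for t
  proof -
    have "(\<lambda>n. t *\<^sub>R u (r n + N)) \<longlonglongrightarrow> t *\<^sub>R u0" by (intro tendsto_intros lim)
    from isCont_tendsto_compose[OF exp_map_isCont this]
    have "(\<lambda>n. ex x (t *\<^sub>R u (r n + N))) \<longlonglongrightarrow> ex x (t *\<^sub>R u0)" .
    from rdist_tendsto[OF this]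
    have "(\<lambda>n. rdist M (ex x (t *\<^sub>R u (r n + N))) (ray M p \<eta> t)) \<longlonglongrightarrow> rdist M (ex x (t *\<^sub>R u0)) (ray M p \<eta> t)" .
    moreover have "\<forall>\<^sub>F n in sequentially. rdist M (ex x (t *\<^sub>R u (r n + N))) (ray M p \<eta> t) \<le> 2 * D"
    proof -
      obtain n0 :: nat where n0: "t \<le> real n0" using real_arch_simple by blast
      have "rdist M (ex x (t *\<^sub>R u (r n + N))) (ray M p \<eta> t) \<le> 2 * D" if n: "n0 \<le> n" for n
      proof -
        have "n0 \<le> r n" using seq_suble[OF r, of n] n by linarith
        then have "t \<le> real (r n)" using n0 by (meson of_nat_le_iff order_trans)
        then have "t \<le> l (r n + N)" using l_bound[of "r n + N"] N by (simp add: abs_le_iff)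
        from est[OF t this lpos] show ?thesis by (simp add: rdist_sym)
      qed
      then show ?thesis unfolding eventually_sequentially by blast
    qed
    ultimately have "rdist M (ex x (t *\<^sub>R u0)) (ray M p \<eta> t) \<le> 2 * D"
      by (intro tendsto_upperbound) auto
    then show ?thesis by (simp add: ray_def rdist_sym)
  qed
  then show ?thesis using u0 unfolding asymptotic_iff by blast
qed

lemma asymptotic_sym: "asymptotic M \<gamma> \<sigma> \<longleftrightarrow> asymptotic M \<sigma> \<gamma>"
  unfolding asymptotic_iff by (simp add: rdist_sym)

section \<open>The Busemann coupling\<close>

lemma exp_map_exp_inv: "ex p (exp_inv M p y) = y"
  using bij_exp_map[of p] by (simp add: exp_inv_def bij_def surj_f_inv_f)

lemma rdist_exp_inv: "rdist M p y = tnorm M p (exp_inv M p y)"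
  using rdist_exp[of p "exp_inv M p y"] by (simp add: exp_map_exp_inv)

lemma exp_inv_eq_0_iff: "exp_inv M p y = 0 \<longleftrightarrow> y = p"
proof
  assume "exp_inv M p y = 0"
  then show "y = p" using exp_map_exp_inv[of p y] by (simp add: exp_map_0)
next
  assume "y = p"
  then show "exp_inv M p y = 0"
    using bij_exp_map[of p] inv_f_f[of "ex p" 0] by (simp add: exp_inv_def bij_def exp_map_0)
qed

text \<open>Both constructions transport a direction along the asymptotic relation, in opposite
  senses. Existence and uniqueness of asymptotic rays make the descriptions in \<open>u_vec\<close>
  and \<open>eta_vec\<close> denote, and symmetry of the relation makes them mutually
  inverse.\<close>

lemma Y_point_V_vec: "Y_point M p x (V_vec M p x y) = y"
proof (cases "y = p")
  case True
  then show ?thesis by (simp add: V_vec_def Y_point_def)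
next
  case False
  define d where "d = rdist M p y"
  define \<eta> where "\<eta> = eta_point M p y"
  have d: "0 < d" using False by (simp add: d_def rdist_exp_inv tnorm_pos exp_inv_eq_0_iff)
  have \<eta>_eq: "\<eta> = - (exp_inv M p y /\<^sub>R d)" by (simp add: \<eta>_def eta_point_def d_def)
  have \<eta>: "tnorm M p \<eta> = 1"
    using d by (simp add: \<eta>_eq tnorm_minus tnorm_scale rdist_exp_inv[symmetric] d_def[symmetric])
  obtain u' where u': "tnorm M x u' = 1" "asymptotic M (ray M p \<eta>) (ray M x u')"
    using asymptotic_exists[OF \<eta>] by blast
  define u where "u = - u'"
  have u: "tnorm M x u = 1" "asymptotic M (ray M p \<eta>) (ray M x (- u))"
    using u' by (simp_all add: u_def tnorm_minus)
  have "u_vec M p x y = u"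
    unfolding u_vec_def \<eta>_def[symmetric]
  proof (rule the_equality)
    fix z assume "tnorm M x z = 1 \<and> asymptotic M (ray M p \<eta>) (ray M x (- z))"
    then have "- z = - u"
      using u(2) asymptotic_sym asymptotic_unique[of x "- z" "ray M p \<eta>" "- u"] by blast
    then show "z = u" by simp
  qed (use u in simp)
  then have V: "V_vec M p x y = d *\<^sub>R u" using False by (simp add: V_vec_def d_def)
  have "u \<noteq> 0" using u(1) by (auto simp: tnorm_0)
  have tV: "tnorm M x (d *\<^sub>R u) = d" using d u(1) by (simp add: tnorm_scale)
  have "unit_dir M x (d *\<^sub>R u) = u" using d by (simp add: unit_dir_def tV)
  \<comment> \<open>The direction \<open>\<eta>\<close> itself satisfies the description, and rays
    from \<open>p\<close> asymptotic to a given curve are unique.\<close>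
  then have "eta_vec M p x (d *\<^sub>R u) = \<eta>"
    unfolding eta_vec_def
    by (intro the_equality) (use \<eta> u(2) asymptotic_unique in auto)
  then have "Y_point M p x (d *\<^sub>R u) = ex p (- d *\<^sub>R \<eta>)"
    using d \<open>u \<noteq> 0\<close> by (simp add: Y_point_def tV)
  also have "- d *\<^sub>R \<eta> = exp_inv M p y" using d by (simp add: \<eta>_eq)
  finally show ?thesis by (simp add: V exp_map_exp_inv)
qed

text \<open>Rays from \<open>p\<close> are minimizing, so the function under the limit is 0 for all
  \<open>t \<ge> 0\<close>, and \<open>Lim\<close> takes this value.\<close>

lemma busemann_base: "u \<noteq> 0 \<Longrightarrow> busemann M p u p = 0"
proof -
  assume "u \<noteq> 0"
  then have "tnorm M p (unit_dir M p u) = 1" using tnorm_pos[of u p] by (simp add: unit_dir_def tnorm_scale)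
  then have "rdist M p (ray M p (unit_dir M p u) t) - t = 0" if "0 \<le> t" for t
    using that by (simp add: ray_def rdist_exp tnorm_scale)
  then have "\<forall>\<^sub>F t in at_top. rdist M p (ray M p (unit_dir M p u) t) - t = 0"
    by (rule eventually_mono[OF eventually_ge_at_top[of 0]])
  then have "((\<lambda>t. rdist M p (ray M p (unit_dir M p u) t) - t) \<longlongrightarrow> 0) at_top"
    by (rule tendsto_eventually)
  then show ?thesis unfolding busemann_def by (intro tendsto_Lim) auto
qed

lemma coupling_base: "coupling M p z p = 0"
  by (cases "z = p") (simp_all add: coupling_def busemann_base exp_inv_eq_0_iff)

end

text \<open>The term \<open>z = x\<close> of the supremum always gives one inequality, so equality
  amounts to the other one, which can be read off termwise. Finiteness of \<open>f x\<close> allows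
  it to be moved across; where \<open>f z\<close> is infinite, the termwise conditions hold
  trivially.\<close>

lemma fenchel_equality_iff:
  fixes f :: "'m \<Rightarrow> ereal" and H :: "'m \<Rightarrow> real"
  assumes f: "\<And>z. f z \<noteq> -\<infinity>" and x: "f x < \<infinity>"
  shows "f x + (SUP z. ereal (H z) - f z) = ereal (H x) \<longleftrightarrow> (\<forall>z. f x + ereal (H z - H x) \<le> f z)"
proof -
  obtain r where r: "f x = ereal r" using f[of x] x by (cases "f x") auto
  have "ereal (H x - r) \<le> (SUP z. ereal (H z) - f z)"
    using SUP_upper[of x UNIV "\<lambda>z. ereal (H z) - f z"] by (simp add: r)
  moreover have "f x + S = ereal (H x) \<longleftrightarrow> S = ereal (H x - r)" for S
    by (cases S) (auto simp: r)
  ultimately have "f x + (SUP z. ereal (H z) - f z) = ereal (H x) \<longleftrightarrow>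
      (SUP z. ereal (H z) - f z) \<le> ereal (H x - r)" by auto
  also have "\<dots> \<longleftrightarrow> (\<forall>z. ereal (H z) - f z \<le> ereal (H x - r))" by (simp add: SUP_le_iff)
  also have "\<dots> \<longleftrightarrow> (\<forall>z. f x + ereal (H z - H x) \<le> f z)"
  proof (rule all_cong1)
    fix z
    show "(ereal (H z) - f z \<le> ereal (H x - r)) = (f x + ereal (H z - H x) \<le> f z)"
      using f[of z] by (cases "f z") (auto simp: r)
  qed
  finally show ?thesis .
qed

theorem theorem7:
  fixes M :: "('m::{t2_space, second_countable_topology}, 'e::euclidean_space) riemannian"
    and f :: "'m \<Rightarrow> ereal" and p x :: 'm
  assumes "hadamard_manifold M"
    and "proper_fun f"
    and "x \<in> edomain f"
  shows "(\<forall>y. f x + conjugate M p f y = ereal (coupling M p x y) \<longleftrightarrow>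
             V_vec M p x y \<in> B_subdifferential M p f x) \<and>
         (is_arg_min f (\<lambda>z. True) x \<longleftrightarrow> 0 \<in> B_subdifferential M p f x) \<and>
         (0 \<in> B_subdifferential M p f x \<longleftrightarrow>
             f x + conjugate M p f p = ereal (coupling M p x p) \<and> coupling M p x p = 0)"
proof -
  interpret hadamard M by unfold_locales (rule assms(1))
  have fin: "\<And>z. f z \<noteq> -\<infinity>" "f x < \<infinity>" using assms(2,3) by (auto simp: proper_fun_def edomain_def)
  have main: "f x + conjugate M p f y = ereal (coupling M p x y) \<longleftrightarrow>
      V_vec M p x y \<in> B_subdifferential M p f x" for y
    using fenchel_equality_iff[of f x "\<lambda>z. coupling M p z y", OF fin]
    by (simp add: conjugate_def B_subdifferential_def Y_point_V_vec)
  have V0: "V_vec M p x p = 0" by (simp add: V_vec_def)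
  \<comment> \<open>For the zero vector the point \<open>Y_point\<close> is \<open>p\<close>, where
    the coupling vanishes, so the subgradient inequality becomes minimality.\<close>
  have "0 \<in> B_subdifferential M p f x \<longleftrightarrow> (\<forall>z. f x \<le> f z)"
    by (simp add: B_subdifferential_def Y_point_def coupling_base)
  then have "is_arg_min f (\<lambda>z. True) x \<longleftrightarrow> 0 \<in> B_subdifferential M p f x"
    by (auto simp: is_arg_min_def not_less)
  then show ?thesis using main[of p] main by (simp add: V0 coupling_base)
qed

end
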